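(* Let $p>1$, $N\ge2$, $\beta\in\mathbb{R}\setminus\{0\}$ and $\omega>\frac{p+1}{p-1}\frac{N^2}{\beta^2}$. Then (up to permutation of the edges of $\Gamma$ and rotation), the family of critical points of $S_\omega$ consists of $N$ profiles. The first $N-1$ profiles are given by $$\phi_k=(\underbrace{\phi_{x_1},\dots,\phi_{x_1}}_{k},\underbrace{\phi_{x_N},\dots,\phi_{x_N}}_{N-k}),\qquad k=1,\dots,N-1,$$ where $|x_1|=\frac{2}{(p-1)\sqrt\omega}\tanh^{-1}(t_1)$, $|x_N|=\frac{2}{(p-1)\sqrt\omega}\tanh^{-1}(t_N)$, and $0<t_1<t_N<1$ satisfy the system $$t_1^{p-1}-t_1^{p+1}=t_N^{p-1}-t_N^{p+1},\qquad kt_1^{-1}+(N-k)t_N^{-1}=|\beta|\sqrt\omega .$$ The $N$th critical point of $S_\omega$ is given by the symmetric profile $\phi_\beta$.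
   Context: $\Gamma$ is the star graph with $N\ge2$ half-lines $(0,\infty)$ joined at the vertex $0$. A function on $\Gamma$ is $v=(v_j)_{j=1}^N$ with $v_j:(0,\infty)\to\mathbb{C}$. $L^q(\Gamma)=\bigoplus_{j=1}^N L^q(\mathbb{R}^+)$ with norm $\|\cdot\|_q$, and $H^1(\Gamma)=\bigoplus_{j=1}^N H^1(\mathbb{R}^+)$ (no continuity condition at the vertex). The action functional is $$S_\omega(v)=\tfrac12\Big(\|v'\|_2^2+\frac1\beta\Big|\sum_{j=1}^Nv_j(0)\Big|^2\Big)+\tfrac\omega2\|v\|_2^2-\tfrac1{p+1}\|v\|_{p+1}^{p+1},\quad v\in H^1(\Gamma),$$ and a critical point of $S_\omega$ is $\phi\in H^1(\Gamma)$ with $S_\omega'(\phi)=0$ (derivative with $H^1(\Gamma)$ regarded as a real Hilbert space). Rotation means multiplication by $e^{i\theta}$, $\theta\in\mathbb{R}$. For $a\in\mathbb{R}$, $$\phi_a(x)=\Big\{\tfrac{(p+1)\omega}2\,\mathrm{sech}^2\Big(\tfrac{(p-1)\sqrt\omega}2(x+a)\Big)\Big\}^{\frac1{p-1}},\quad x>0.$$ The numbers $x_1,x_N$ are both negative if $\beta>0$ and both positive if $\beta<0$. The symmetric profile is $\phi_\beta=(\tilde\phi_\beta)_{j=1}^N$ (all components equal) with $$\tilde\phi_\beta(x)=\left[\frac{(p+1)\omega}{2}\,\mathrm{sech}^2\Big(\frac{(p-1)\sqrt\omega}{2}x-\tanh^{-1}\Big(\frac{N}{\beta\sqrt\omeg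a}\Big)\Big)\right]^{\frac1{p-1}}.$$
   Formalization: The classification is for nonzero critical points whose vertex values lie on a common ray from the origin; without this the claim is false, as 0 and, for N=2, (φ_0,−φ_0) are also critical points of S_ω but are not on the list. *)

theory Defs
  imports "HOL-Analysis.Analysis"
begin

text \<open>
  The edges of the star graph are numbered \<open>0, \<dots>, N - 1\<close>, each edge being the half-line \<open>(0, \<infinity>)\<close>.
  An \<open>H\<^sup>1\<close> function is represented on each edge by its continuous representative, so that
  its value at the vertex is the value at \<open>0\<close>. Values at negative arguments and components
  with index \<open>\<ge> N\<close> are irrelevant.
\<close>

type_synonym graph_fun = "nat \<Rightarrow> real \<Rightarrow> complex"

text \<open>\<open>v\<close> is locally absolutely continuous on \<open>[0, \<infinity>)\<close> with derivative \<open>g\<close> in \<open>L\<^sup>2(0, \<infinity>)\<close>.\<close>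

definition has_L2_deriv :: "(real \<Rightarrow> complex) \<Rightarrow> (real \<Rightarrow> complex) \<Rightarrow> bool" where
  "has_L2_deriv v g \<longleftrightarrow>
     set_borel_measurable lborel {0<..} g \<and>
     set_integrable lborel {0<..} (\<lambda>x. (cmod (g x))\<^sup>2) \<and>
     (\<forall>x\<ge>0. v x = v 0 + (LBINT t:{0<..x}. g t))"

definition H1_half_line :: "(real \<Rightarrow> complex) set" where
  "H1_half_line =
     {v. set_integrable lborel {0<..} (\<lambda>x. (cmod (v x))\<^sup>2) \<and> (\<exists>g. has_L2_deriv v g)}"

text \<open>The derivative is unique only almost everywhere; it is used only under integrals.\<close>

definition H1_deriv :: "(real \<Rightarrow> complex) \<Rightarrow> real \<Rightarrow> complex" where
  "H1_deriv v = (SOME g. has_L2_deriv v g)"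

definition H1_graph :: "nat \<Rightarrow> graph_fun set" where
  "H1_graph N = {v. \<forall>j<N. v j \<in> H1_half_line}"

text \<open>This is \<open>\<parallel>v\<parallel>\<^sub>q\<close> raised to the power \<open>q\<close>.\<close>

definition Lq_norm_pow :: "nat \<Rightarrow> real \<Rightarrow> graph_fun \<Rightarrow> real" where
  "Lq_norm_pow N q v = (\<Sum>j<N. LBINT x:{0<..}. cmod (v j x) powr q)"

definition H1_norm :: "nat \<Rightarrow> graph_fun \<Rightarrow> real" where
  "H1_norm N v = sqrt (Lq_norm_pow N 2 (\<lambda>j. H1_deriv (v j)) + Lq_norm_pow N 2 v)"

definition action :: "real \<Rightarrow> real \<Rightarrow> real \<Rightarrow> nat \<Rightarrow> graph_fun \<Rightarrow> real" where
  "action p \<omega> \<beta> N v =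
     1/2 * (Lq_norm_pow N 2 (\<lambda>j. H1_deriv (v j)) + 1/\<beta> * (cmod (\<Sum>j<N. v j 0))\<^sup>2)
     + \<omega>/2 * Lq_norm_pow N 2 v
     - 1/(p + 1) * Lq_norm_pow N (p + 1) v"

text \<open>
  The last conjunct says that the Frechet derivative of the action at \<open>\<phi>\<close>, with \<open>H\<^sup>1\<close> regarded
  as a real Hilbert space, exists and is zero.
\<close>

definition critical_point :: "real \<Rightarrow> real \<Rightarrow> real \<Rightarrow> nat \<Rightarrow> graph_fun \<Rightarrow> bool" where
  "critical_point p \<omega> \<beta> N \<phi> \<longleftrightarrow>
     \<phi> \<in> H1_graph N \<and>
     (\<forall>\<epsilon>>0. \<exists>\<delta>>0. \<forall>h\<in>H1_graph N. H1_norm N h < \<delta> \<longrightarrow>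
        \<bar>action p \<omega> \<beta> N (\<lambda>j x. \<phi> j x + h j x) - action p \<omega> \<beta> N \<phi>\<bar> \<le> \<epsilon> * H1_norm N h)"

definition nontrivial :: "nat \<Rightarrow> graph_fun \<Rightarrow> bool" where
  "nontrivial N \<phi> \<longleftrightarrow> (\<exists>j<N. \<exists>x\<ge>0. \<phi> j x \<noteq> 0)"

text \<open>
  The vertex values of all components lie on a common ray from the origin. Up to rotation,
  this excludes functions whose components have opposite signs at the vertex. Without such a
  condition there are further critical points: if \<open>N = 2\<close> then \<open>(\<phi>\<^sub>0, -\<phi>\<^sub>0)\<close>, with
  \<open>\<phi>\<^sub>0\<close> the unshifted soliton, is one, since both its derivatives at the vertex and the sum of its
  vertex values vanish.
\<close>

definition aligned_at_vertex :: "nat \<Rightarrow> graph_fun \<Rightarrow> bool" where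
  "aligned_at_vertex N \<phi> \<longleftrightarrow> (\<exists>\<theta>::real. \<forall>j<N. \<exists>r\<ge>0. \<phi> j 0 = cis \<theta> * complex_of_real r)"

definition sech :: "real \<Rightarrow> real" where
  "sech x = 1 / cosh x"

definition shifted_soliton :: "real \<Rightarrow> real \<Rightarrow> real \<Rightarrow> real \<Rightarrow> real" where
  "shifted_soliton p \<omega> a x =
     ((p + 1) * \<omega> / 2 * (sech ((p - 1) * sqrt \<omega> / 2 * (x + a)))\<^sup>2) powr (1 / (p - 1))"

definition symmetric_profile :: "real \<Rightarrow> real \<Rightarrow> real \<Rightarrow> nat \<Rightarrow> graph_fun" where
  "symmetric_profile p \<omega> \<beta> N = (\<lambda>j x. complex_of_real
     (((p + 1) * \<omega> / 2 *
       (sech ((p - 1) * sqrt \<omega> / 2 * x - artanh (real N / (\<beta> * sqrt \<omega>))))\<^sup>2) powr (1 / (p - 1))))"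

definition t_system :: "real \<Rightarrow> real \<Rightarrow> real \<Rightarrow> nat \<Rightarrow> nat \<Rightarrow> real \<Rightarrow> real \<Rightarrow> bool" where
  "t_system p \<omega> \<beta> N k t\<^sub>1 t\<^sub>N \<longleftrightarrow>
     0 < t\<^sub>1 \<and> t\<^sub>1 < t\<^sub>N \<and> t\<^sub>N < 1 \<and>
     t\<^sub>1 powr (p - 1) - t\<^sub>1 powr (p + 1) = t\<^sub>N powr (p - 1) - t\<^sub>N powr (p + 1) \<and>
     real k * inverse t\<^sub>1 + (real N - real k) * inverse t\<^sub>N = \<bar>\<beta>\<bar> * sqrt \<omega>"

text \<open>The shifts are negative for \<open>\<beta> > 0\<close> and positive for \<open>\<beta> < 0\<close>.\<close>

definition shift :: "real \<Rightarrow> real \<Rightarrow> real \<Rightarrow> real \<Rightarrow> real" where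
  "shift p \<omega> \<beta> t = - sgn \<beta> * (2 / ((p - 1) * sqrt \<omega>) * artanh t)"

definition asymmetric_profile ::
    "real \<Rightarrow> real \<Rightarrow> real \<Rightarrow> nat \<Rightarrow> real \<Rightarrow> real \<Rightarrow> graph_fun" where
  "asymmetric_profile p \<omega> \<beta> k t\<^sub>1 t\<^sub>N = (\<lambda>j x. complex_of_real
     (shifted_soliton p \<omega> (shift p \<omega> \<beta> (if j < k then t\<^sub>1 else t\<^sub>N)) x))"

definition equal_up_to_symmetry :: "nat \<Rightarrow> graph_fun \<Rightarrow> graph_fun \<Rightarrow> bool" where
  "equal_up_to_symmetry N \<phi> \<psi> \<longleftrightarrow>
     (\<exists>\<pi> (\<theta>::real). \<pi> permutes {..<N} \<and> (\<forall>j<N. \<forall>x\<ge>0. \<phi> j x = cis \<theta> * \<psi> (\<pi> j) x))"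

end

theory Submission
  imports Defs
begin

text \<open>
  On each edge a critical point solves \<open>u'' = \<omega> u - \<bar>u\<bar>\<^sup>p\<^sup>-\<^sup>1 u\<close>, and at the vertex all derivatives
  equal \<open>1 / \<beta>\<close> times the sum of the vertex values. The space of test functions has no continuity
  condition at the vertex, so one may test on a single edge; testing with piecewise linear
  functions gives the twice integrated equation at once, hence the regularity of \<open>u\<close>
  (\<open>critical_point_edge_solution\<close>). Conversely, decaying solutions of the edge equation with this
  vertex condition are critical, by integration by parts (\<open>edge_solutions_critical\<close>). Both
  directions rest on \<open>critical_point_iff_first_variation\<close>: the action differs from its linearisation
  by a quadratic remainder, because functions in \<open>H\<^sup>1\<close> are bounded.

  The energy \<open>\<bar>u'\<bar>\<^sup>2 - \<omega> \<bar>u\<bar>\<^sup>2 + 2 / (p + 1) \<bar>u\<bar>\<^sup>p\<^sup>+\<^sup>1\<close> is constant and integrable on the half-line, so it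
  vanishes. If the vertex values lie on a common ray and do not all vanish, then up to one common
  rotation the initial data on every edge are real, and zero energy makes them the data of a shifted
  soliton; uniqueness for the edge equation then identifies the edge with that soliton
  (\<open>critical_point_is_soliton_family\<close>).

  The shifts are encoded by \<open>t \<in> (0, 1)\<close>, the modulus of the hyperbolic tangent of the rescaled
  shift. Equality of the derivatives at the vertex says that \<open>t powr (p - 1) - t powr (p + 1)\<close> takes
  the same value on all edges, and the vertex condition says that the numbers \<open>1 / t\<close> add up to
  \<open>\<bar>\<beta>\<bar> sqrt \<omega>\<close>. The level sets of this function have at most two points, so up to a permutation
  of the edges either all parameters agree, or the first \<open>k\<close> and the last \<open>N - k\<close> agree and solve the
  system for \<open>k\<close>. That system has exactly one solution (\<open>t_system_unique_solution\<close>): with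
  \<open>s = ln (t\<^sub>N / t\<^sub>1)\<close> as the unknown, the logarithm of its left-hand side is strictly convex, and the
  lower bound on \<open>\<omega>\<close> says that it starts below the required level. The number \<open>k\<close> can be read off a
  profile, as the number of edges whose vertex value exceeds a fixed bound, so the \<open>N\<close> profiles are
  inequivalent.
\<close>

section \<open>The power nonlinearity\<close>

text \<open>This convexity inequality is the source of all estimates for the nonlinearity: comparing
  tangents at two points yields both a Lipschitz bound and a quadratic Taylor remainder.\<close>

lemma powr_above_tangent:
  fixes a b q :: real
  assumes "a \<ge> 0" "b \<ge> 0" "q > 1"
  shows "a powr q + q * a powr (q - 1) * (b - a) \<le> b powr q"
proof (cases "a = 0 \<or> b = 0")
  case True
  then show ?thesis
  proof
    assume "a = 0" then show ?thesis using assms by simp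
  next
    assume b: "b = 0"
    show ?thesis
    proof (cases "a = 0")
      case False
      then have "a powr q = a powr (q - 1) * a" using assms by (simp add: powr_diff)
      then have "a powr q + q * a powr (q - 1) * (b - a) = (1 - q) * a powr q"
        using b by (simp add: algebra_simps)
      also have "\<dots> \<le> 0" using assms by (simp add: mult_nonpos_nonneg)
      finally show ?thesis using b by simp
    qed (use assms b in simp)
  qed
next
  case False
  then have pos: "a > 0" "b > 0" using assms by auto
  have "q * a powr (q - 1) * (b - a) \<le> b powr q - a powr q"
  proof (rule convex_on_imp_above_tangent[where A="{0<..}"])
    show "convex_on {0<..} (\<lambda>x::real. x powr q)"
      using convex_on_subset[OF powr_convex] assms by auto
    show "((\<lambda>x. x powr q) has_real_derivative q * a powr (q - 1)) (at a within {0<..})"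
      using pos by (auto intro!: derivative_eq_intros)
    show "connected {0::real<..}" by simp
    show "a \<in> interior {0<..}" "b \<in> {0<..}" using pos by (auto simp: interior_open)
  qed
  then show ?thesis by simp
qed

definition power_nl :: "real \<Rightarrow> complex \<Rightarrow> complex" where
  "power_nl p z = complex_of_real (cmod z powr (p - 1)) * z"

text \<open>If \<open>\<bar>w\<bar> \<le> \<bar>z\<bar>\<close>, the difference splits into \<open>\<bar>z\<bar>\<^sup>p\<^sup>-\<^sup>1 (z - w)\<close> and a multiple of \<open>w\<close> whose modulus is at
  most \<open>\<bar>z\<bar>\<^sup>p - \<bar>w\<bar>\<^sup>p\<close>, to which the tangent inequality at \<open>\<bar>z\<bar>\<close> applies.\<close>

lemma power_nl_lipschitz:
  assumes p: "p > 1" and "cmod z \<le> M" "cmod w \<le> M"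
  shows "cmod (power_nl p z - power_nl p w) \<le> (p + 1) * M powr (p - 1) * cmod (z - w)"
proof -
  have *: "cmod (power_nl p z - power_nl p w) \<le> (p + 1) * M powr (p - 1) * cmod (z - w)"
    if zw: "cmod w \<le> cmod z" and M: "cmod z \<le> M" for z w
  proof -
    let ?a = "cmod z" and ?b = "cmod w"
    have split: "power_nl p z - power_nl p w
        = of_real (?a powr (p - 1)) * (z - w) + of_real (?a powr (p - 1) - ?b powr (p - 1)) * w"
      by (simp add: power_nl_def algebra_simps)
    have powp: "?b powr (p - 1) * ?b = ?b powr p" "?a powr (p - 1) * ?a = ?a powr p"
      using p by (cases "w = 0"; cases "z = 0"; simp add: powr_diff)+
    have mono: "?b powr (p - 1) \<le> ?a powr (p - 1)"
      using zw p by (intro powr_mono2) auto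
    have "(?a powr (p - 1) - ?b powr (p - 1)) * ?b \<le> ?a powr p - ?b powr p"
      using mult_left_mono[OF zw, of "?a powr (p - 1)"] powp by (simp add: algebra_simps)
    also have "\<dots> \<le> p * ?a powr (p - 1) * (?a - ?b)"
      using powr_above_tangent[of ?a ?b p] p by (simp add: algebra_simps)
    also have "\<dots> \<le> p * ?a powr (p - 1) * cmod (z - w)"
      using p norm_triangle_ineq2[of z w] by (intro mult_left_mono) auto
    finally have "cmod (of_real (?a powr (p - 1) - ?b powr (p - 1)) * w)
        \<le> p * ?a powr (p - 1) * cmod (z - w)"
      using mono by (simp add: norm_mult del: of_real_diff)
    moreover have "cmod (of_real (?a powr (p - 1)) * (z - w)) = ?a powr (p - 1) * cmod (z - w)"
      by (simp add: norm_mult)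
    ultimately have "cmod (power_nl p z - power_nl p w)
        \<le> ?a powr (p - 1) * cmod (z - w) + p * ?a powr (p - 1) * cmod (z - w)"
      unfolding split by (smt (verit) norm_triangle_ineq)
    also have "\<dots> = (p + 1) * ?a powr (p - 1) * cmod (z - w)" by (simp add: algebra_simps)
    also have "\<dots> \<le> (p + 1) * M powr (p - 1) * cmod (z - w)"
      using p M by (intro mult_right_mono mult_left_mono powr_mono2) auto
    finally show ?thesis .
  qed
  show ?thesis
    using *[of w z] *[of z w] assms by (cases "cmod w \<le> cmod z") (auto simp: norm_minus_commute)
qed

lemma Re_mult_cnj: "Re (z * cnj w) = z \<bullet> w"
  by (simp add: inner_complex_def)

text \<open>This reduces to real numbers, since \<open>Re (z * cnj u)\<close> is at most \<open>\<bar>z\<bar> \<bar>u\<bar>\<close>, with equality for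
  \<open>u = z\<close>.\<close>

lemma norm_powr_above_tangent:
  assumes p: "p > 1"
  shows "cmod z powr (p + 1) + (p + 1) * Re (power_nl p z * cnj (u - z)) \<le> cmod u powr (p + 1)"
proof -
  let ?a = "cmod z" and ?b = "cmod u"
  have "Re (z * cnj u) \<le> ?a * ?b"
    using complex_Re_le_cmod[of "z * cnj u"] by (simp add: norm_mult)
  moreover have "Re (z * cnj z) = ?a * ?a"
    by (metis cmod_power2 complex_mult_cnj Re_complex_of_real power2_eq_square)
  ultimately have "Re (z * cnj (u - z)) \<le> ?a * (?b - ?a)"
    by (simp add: algebra_simps)
  then have "?a powr (p - 1) * Re (z * cnj (u - z)) \<le> ?a powr (p - 1) * (?a * (?b - ?a))"
    by (intro mult_left_mono) auto
  also have "?a powr (p - 1) * (?a * (?b - ?a)) = ?a powr p * (?b - ?a)"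
    using p by (cases "z = 0") (simp_all add: powr_diff)
  also have "?a powr (p - 1) * Re (z * cnj (u - z)) = Re (power_nl p z * cnj (u - z))"
    by (simp add: power_nl_def algebra_simps)
  finally have "(p + 1) * Re (power_nl p z * cnj (u - z)) \<le> (p + 1) * (?a powr p * (?b - ?a))"
    using p by (intro mult_left_mono) auto
  moreover have "?a powr (p + 1) + (p + 1) * (?a powr p * (?b - ?a)) \<le> ?b powr (p + 1)"
    using powr_above_tangent[of ?a ?b "p + 1"] p by (simp add: mult.assoc)
  ultimately show ?thesis by linarith
qed

text \<open>The tangent at \<open>z\<close> bounds the remainder from below by \<open>0\<close>; the tangent at \<open>z + w\<close> bounds it from
  above by an increment of the nonlinearity.\<close>

lemma norm_powr_remainder:
  assumes p: "p > 1"
  shows "\<bar>cmod (z + w) powr (p + 1) - cmod z powr (p + 1) - (p + 1) * (power_nl p z \<bullet> w)\<bar>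
    \<le> (p + 1)\<^sup>2 * (cmod z + cmod w) powr (p - 1) * (cmod w)\<^sup>2"
proof -
  let ?R = "cmod (z + w) powr (p + 1) - cmod z powr (p + 1) - (p + 1) * Re (power_nl p z * cnj w)"
  let ?M = "cmod z + cmod w"
  have "?R \<ge> 0" using norm_powr_above_tangent[OF p, of z "z + w"] by simp
  moreover have "?R \<le> (p + 1) * Re ((power_nl p (z + w) - power_nl p z) * cnj w)"
    using norm_powr_above_tangent[OF p, of "z + w" z] by (simp add: algebra_simps)
  moreover have "Re ((power_nl p (z + w) - power_nl p z) * cnj w)
      \<le> (p + 1) * ?M powr (p - 1) * cmod w * cmod w"
  proof -
    have "Re ((power_nl p (z + w) - power_nl p z) * cnj w)
        \<le> cmod (power_nl p (z + w) - power_nl p z) * cmod w"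
      using complex_Re_le_cmod[of "(power_nl p (z + w) - power_nl p z) * cnj w"]
      by (simp add: norm_mult)
    also have "\<dots> \<le> (p + 1) * ?M powr (p - 1) * cmod w * cmod w"
      using power_nl_lipschitz[OF p norm_triangle_ineq[of z w], of z] by (intro mult_right_mono) auto
    finally show ?thesis .
  qed
  ultimately have "?R \<le> (p + 1) * ((p + 1) * ?M powr (p - 1) * cmod w * cmod w)" "?R \<ge> 0"
    using p mult_left_mono[of "Re ((power_nl p (z + w) - power_nl p z) * cnj w)"
        "(p + 1) * ?M powr (p - 1) * cmod w * cmod w" "p + 1"]
    by linarith+
  then show ?thesis unfolding Re_mult_cnj by (simp add: power2_eq_square algebra_simps)
qed

text \<open>The remainder estimate gives differentiability at zeros of \<open>f\<close> as well, where \<open>cmod\<close> is not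
  differentiable and no chain rule applies.\<close>

lemma has_real_derivative_norm_powr:
  fixes f :: "real \<Rightarrow> complex"
  assumes p: "p > 1" and f: "(f has_vector_derivative f') (at x within S)"
  shows "((\<lambda>x. cmod (f x) powr (p + 1)) has_real_derivative
           (p + 1) * (power_nl p (f x) \<bullet> f')) (at x within S)"
proof -
  let ?D = "\<lambda>w. (p + 1) * (power_nl p (f x) \<bullet> w)"
  have "((\<lambda>z. cmod z powr (p + 1)) has_derivative ?D) (at (f x))"
    unfolding has_derivative_at
  proof (intro conjI)
    show "bounded_linear ?D"
      by (intro bounded_linear_const_mult bounded_linear_inner_right)
    have "((\<lambda>h. (p + 1)\<^sup>2 * (cmod (f x) + cmod h) powr (p - 1) * cmod h) \<longlongrightarrow>
        (p + 1)\<^sup>2 * (cmod (f x) + cmod 0) powr (p - 1) * cmod 0) (at 0)"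
      using p by (intro tendsto_intros tendsto_powr2) (auto intro!: always_eventually)
    show "((\<lambda>h. norm (cmod (f x + h) powr (p + 1) - cmod (f x) powr (p + 1) - ?D h) / norm h) \<longlongrightarrow> 0) (at 0)"
    proof (rule Lim_null_comparison)
      show "\<forall>\<^sub>F h in at 0. norm (norm (cmod (f x + h) powr (p + 1) - cmod (f x) powr (p + 1) - ?D h) / norm h)
         \<le> (p + 1)\<^sup>2 * (cmod (f x) + cmod h) powr (p - 1) * cmod h"
      proof (intro always_eventually allI)
        fix h
        show "norm (norm (cmod (f x + h) powr (p + 1) - cmod (f x) powr (p + 1) - ?D h) / norm h)
         \<le> (p + 1)\<^sup>2 * (cmod (f x) + cmod h) powr (p - 1) * cmod h"
        proof (cases "h = 0")
          case False
          then show ?thesis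
            using norm_powr_remainder[OF p, of "f x" h]
            by (simp add: pos_divide_le_eq power2_eq_square mult.assoc)
        qed simp
      qed
    qed (use \<open>((\<lambda>h. (p + 1)\<^sup>2 * (cmod (f x) + cmod h) powr (p - 1) * cmod h) \<longlongrightarrow> _) _\<close> in simp)
  qed
  from has_derivative_compose[OF f[unfolded has_vector_derivative_def] this]
  show ?thesis
    unfolding has_field_derivative_def by (rule has_derivative_eq_rhs) (simp add: fun_eq_iff algebra_simps)
qed

lemma continuous_on_power_nl:
  assumes "p > 1"
  shows "continuous_on A (power_nl p)"
proof -
  have "isCont (power_nl p) z" for z
  proof -
    have "((\<lambda>w. (p + 1) * (cmod z + 1) powr (p - 1) * cmod (w - z)) \<longlongrightarrow> (p + 1) * (cmod z + 1) powr (p - 1) * cmod (z - z)) (at z)"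
      by (intro tendsto_intros)
    then have lim: "((\<lambda>w. (p + 1) * (cmod z + 1) powr (p - 1) * cmod (w - z)) \<longlongrightarrow> 0) (at z)"
      by simp
    have "((\<lambda>w. power_nl p w - power_nl p z) \<longlongrightarrow> 0) (at z)"
    proof (rule Lim_null_comparison[OF _ lim])
      have "\<forall>\<^sub>F w in at z. dist w z < 1" unfolding eventually_at by (intro exI[of _ 1]) auto
      then show "\<forall>\<^sub>F w in at z. norm (power_nl p w - power_nl p z)
          \<le> (p + 1) * (cmod z + 1) powr (p - 1) * cmod (w - z)"
      proof eventually_elim
        case (elim w)
        have "cmod w \<le> cmod z + 1"
          using elim norm_triangle_ineq[of z "w - z"] by (simp add: dist_norm)
        then show ?case using power_nl_lipschitz[OF assms] by simp
      qed
    qed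
    then show ?thesis unfolding isCont_def by (simp add: LIM_zero_iff)
  qed
  then show ?thesis by (simp add: continuous_at_imp_continuous_on)
qed

section \<open>Square-integrable functions on the half-line\<close>

abbreviation half_line :: "real measure" where
  "half_line \<equiv> restrict_space lborel {0<..}"

lemma set_integral_half_line:
  fixes f :: "real \<Rightarrow> 'a :: {banach, second_countable_topology}"
  shows "(LBINT x:{0<..}. f x) = (\<integral>x. f x \<partial>half_line)"
  by (simp add: set_lebesgue_integral_def integral_restrict_space)

definition L2 :: "(real \<Rightarrow> complex) \<Rightarrow> bool" where
  "L2 f \<longleftrightarrow> f \<in> borel_measurable half_line \<and> integrable half_line (\<lambda>x. (cmod (f x))\<^sup>2)"

definition L2_sq :: "(real \<Rightarrow> complex) \<Rightarrow> real" where
  "L2_sq f = (\<integral>x. (cmod (f x))\<^sup>2 \<partial>half_line)"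

text \<open>The real inner product: the action is differentiated over the real scalars.\<close>

definition L2_ip :: "(real \<Rightarrow> complex) \<Rightarrow> (real \<Rightarrow> complex) \<Rightarrow> real" where
  "L2_ip f g = (\<integral>x. f x \<bullet> g x \<partial>half_line)"

lemma L2_measurable [measurable_dest]: "L2 f \<Longrightarrow> f \<in> borel_measurable half_line"
  and L2_integrable_sq: "L2 f \<Longrightarrow> integrable half_line (\<lambda>x. (cmod (f x))\<^sup>2)"
  by (auto simp: L2_def)

lemma L2_integrable_ip:
  assumes "L2 f" "L2 g"
  shows "integrable half_line (\<lambda>x. f x \<bullet> g x)"
proof (rule Bochner_Integration.integrable_bound)
  show "integrable half_line (\<lambda>x. (cmod (f x))\<^sup>2 + (cmod (g x))\<^sup>2)"
    using assms by (auto simp: L2_def)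
  show "(\<lambda>x. f x \<bullet> g x) \<in> borel_measurable half_line" using assms by (auto simp: L2_def)
  have "\<bar>f x \<bullet> g x\<bar> \<le> (cmod (f x))\<^sup>2 + (cmod (g x))\<^sup>2" for x
    using Cauchy_Schwarz_ineq2[of "f x" "g x"] sum_squares_bound[of "cmod (f x)" "cmod (g x)"]
      mult_nonneg_nonneg[OF norm_ge_zero[of "f x"] norm_ge_zero[of "g x"]] by linarith
  then show "AE x in half_line. norm (f x \<bullet> g x) \<le> norm ((cmod (f x))\<^sup>2 + (cmod (g x))\<^sup>2)"
    by simp
qed

lemma cmod_add_sq: "(cmod (z + w))\<^sup>2 = (cmod z)\<^sup>2 + 2 * (z \<bullet> w) + (cmod w)\<^sup>2"
  by (simp add: power2_norm_eq_inner inner_add_left inner_add_right inner_commute)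

lemma L2_add:
  assumes "L2 f" "L2 g"
  shows "L2 (\<lambda>x. f x + g x)"
  unfolding L2_def cmod_add_sq
  using assms L2_integrable_ip[OF assms] by (auto simp: L2_def)

lemma L2_mult:
  assumes "L2 f"
  shows "L2 (\<lambda>x. c * f x)"
  using assms by (auto simp: L2_def norm_mult power_mult_distrib)

lemma L2_zero: "L2 (\<lambda>x. 0)"
  by (simp add: L2_def)

lemma L2_sq_add:
  assumes "L2 f" "L2 g"
  shows "L2_sq (\<lambda>x. f x + g x) = L2_sq f + 2 * L2_ip f g + L2_sq g"
  unfolding L2_sq_def L2_ip_def cmod_add_sq
  using assms L2_integrable_ip[OF assms] by (simp add: L2_def)

lemma L2_sq_nonneg: "L2_sq f \<ge> 0"
  by (auto simp: L2_sq_def)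

lemma L2_sq_mult: "L2_sq (\<lambda>x. c * f x) = (cmod c)\<^sup>2 * L2_sq f"
  by (simp add: L2_sq_def norm_mult power_mult_distrib)

lemma L2_ip_scaleR: "L2_ip f (\<lambda>x. c *\<^sub>R g x) = c * L2_ip f g"
  by (simp add: L2_ip_def)

lemma L2_cong_AE:
  assumes "AE x in half_line. f x = g x" "L2 f" "g \<in> borel_measurable half_line"
  shows "L2 g"
proof -
  have "integrable half_line (\<lambda>x. (cmod (g x))\<^sup>2)"
    by (rule integrable_cong_AE_imp[where g="\<lambda>x. (cmod (f x))\<^sup>2"]) (use assms in \<open>auto simp: L2_def\<close>)
  then show ?thesis using assms by (simp add: L2_def)
qed

lemma L2_sq_cong_AE:
  assumes "L2 f" "L2 g" "AE x in half_line. f x = g x"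
  shows "L2_sq f = L2_sq g"
  unfolding L2_sq_def by (rule integral_cong_AE) (use assms in \<open>auto simp: L2_def\<close>)

lemma L2_ip_cong_AE:
  assumes "L2 f" "L2 g" "AE x in half_line. f x = g x" "L2 h"
  shows "L2_ip h f = L2_ip h g" "L2_ip f h = L2_ip g h"
  unfolding L2_ip_def by (rule integral_cong_AE; use assms in \<open>auto simp: L2_def\<close>)+

text \<open>The elementary bound \<open>\<bar>z\<bar> \<le> 1 + \<bar>z\<bar>\<^sup>2\<close> makes square-integrable functions integrable on bounded
  intervals.\<close>

lemma L2_set_integrable_Ioc:
  assumes "L2 g" "0 \<le> x"
  shows "set_integrable lborel {x<..y} g"
proof -
  have "set_integrable lborel {0<..} (\<lambda>t. indicator {x<..y} t *\<^sub>R g t)"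
  proof (subst set_integrable_eq, simp, rule Bochner_Integration.integrable_bound)
    have "integrable half_line (\<lambda>t. indicator {x<..y} t :: real)"
    proof (rule integrable_real_indicator)
      have sub: "{x<..y} \<subseteq> {0<..}" using assms(2) by auto
      show "{x<..y} \<in> sets half_line" using sub by (simp add: sets_restrict_space_iff)
      show "emeasure half_line {x<..y} < \<infinity>"
        using sub emeasure_lborel_Ioc[of x y] by (cases "x \<le> y") (auto simp: emeasure_restrict_space)
    qed
    then show "integrable half_line (\<lambda>t. indicator {x<..y} t + (cmod (g t))\<^sup>2)"
      using assms by (auto simp: L2_def)
    have [measurable]: "g \<in> borel_measurable half_line" using assms by (rule_tac L2_measurable)
    have "indicat_real {x<..y} \<in> borel_measurable half_line"
      by (intro measurable_restrict_space1) auto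
    then show "(\<lambda>t. indicat_real {x<..y} t *\<^sub>R g t) \<in> borel_measurable half_line"
      by measurable
    have "cmod z \<le> 1 + (cmod z)\<^sup>2" for z
      using sum_squares_bound[of 1 "cmod z"] by (simp add: power2_eq_square) (smt (verit) norm_ge_zero)
    then show "AE t in half_line. norm (indicat_real {x<..y} t *\<^sub>R g t)
        \<le> norm (indicat_real {x<..y} t + (cmod (g t))\<^sup>2)"
      by (auto simp: indicator_def)
  qed
  moreover have "indicator {0<..} t *\<^sub>R (indicator {x<..y} t *\<^sub>R g t) = indicator {x<..y} t *\<^sub>R g t" for t
    using assms(2) by (auto simp: indicator_def)
  ultimately show ?thesis unfolding set_integrable_def by (simp del: scaleR_scaleR)
qed

text \<open>This is the Cauchy-Schwarz inequality on an interval, from \<open>2 \<bar>g\<bar> \<le> \<epsilon> \<bar>g\<bar>\<^sup>2 + 1 / \<epsilon>\<close>.\<close>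

lemma L2_integral_Ioc_bound:
  assumes g: "L2 g" and xy: "0 \<le> x" "x \<le> y"
  shows "(cmod (LBINT t:{x<..y}. g t))\<^sup>2 \<le> (y - x) * L2_sq g"
proof -
  let ?I = "cmod (LBINT t:{x<..y}. g t)" and ?G = "L2_sq g"
  have bound: "2 * ?I \<le> e * ?G + (y - x) / e" if e: "e > 0" for e
  proof -
    have gi: "set_integrable lborel {x<..y} g" by (rule L2_set_integrable_Ioc[OF g xy(1)])
    have sq0: "set_integrable lborel {0<..} (\<lambda>t. (cmod (g t))\<^sup>2)"
      using g by (simp add: set_integrable_eq L2_def)
    have sqi: "set_integrable lborel {x<..y} (\<lambda>t. (cmod (g t))\<^sup>2)"
      by (rule set_integrable_subset[OF sq0]) (use xy in auto)
    have ci: "set_integrable lborel {x<..y} (\<lambda>t. 1 / e)"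
      unfolding set_integrable_def by (intro integrable_scaleR_left integrable_real_indicator) (use xy in auto)
    have "2 * ?I \<le> 2 * (LBINT t:{x<..y}. cmod (g t))"
      using set_integral_norm_bound[OF gi] by simp
    also have "\<dots> = (LBINT t:{x<..y}. 2 * cmod (g t))" by simp
    also have "\<dots> \<le> (LBINT t:{x<..y}. e * (cmod (g t))\<^sup>2 + 1 / e)"
    proof (rule set_integral_mono)
      show "2 * cmod (g t) \<le> e * (cmod (g t))\<^sup>2 + 1 / e" for t
      proof -
        have "0 \<le> (e * cmod (g t) - 1)\<^sup>2 / e" using e by simp
        also have "\<dots> = e * (cmod (g t))\<^sup>2 + 1 / e - 2 * cmod (g t)"
          using e by (simp add: field_simps power2_eq_square)
        finally show ?thesis by simp
      qed
      show "set_integrable lborel {x<..y} (\<lambda>t. 2 * cmod (g t))"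
        using set_integrable_norm[OF gi] by simp
      show "set_integrable lborel {x<..y} (\<lambda>t. e * (cmod (g t))\<^sup>2 + 1 / e)"
        using sqi ci by (intro set_integral_add) auto
    qed
    also have "\<dots> = e * (LBINT t:{x<..y}. (cmod (g t))\<^sup>2) + (y - x) / e"
      using sqi ci xy by (subst set_integral_add) (auto simp: set_integral_const[of "{x<..y}" lborel] measure_def)
    also have "(LBINT t:{x<..y}. (cmod (g t))\<^sup>2) \<le> ?G"
      unfolding L2_sq_def set_integral_half_line[symmetric]
      unfolding set_lebesgue_integral_def
      by (rule integral_mono) (use sqi sq0 xy in \<open>auto simp: set_integrable_def indicator_def\<close>)
    finally show ?thesis using e by simp
  qed
  show ?thesis
  proof (cases "?I = 0")
    case True
    then show ?thesis using xy L2_sq_nonneg[of g] by (simp add: True[unfolded norm_eq_zero])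
  next
    case False
    then have I: "?I > 0" by simp
    have "x < y" using False xy by (cases "x = y") (auto simp: set_lebesgue_integral_def)
    \<comment> \<open>With this weight the term \<open>(y - x) / e\<close> is the modulus of the integral. The choice avoids
      dividing by the norm of \<open>g\<close>, which is not yet known to be nonzero.\<close>
    define e where "e = (y - x) / ?I"
    have e: "e > 0" using I \<open>x < y\<close> by (simp add: e_def)
    have "2 * ?I \<le> e * ?G + ?I" using bound[OF e] I \<open>x < y\<close> by (simp add: e_def)
    then have "?I * ?I \<le> ?I * (e * ?G)" using I by (intro mult_left_mono) auto
    also have "\<dots> = (y - x) * ?G" using I by (simp add: e_def)
    finally show ?thesis by (simp add: power2_eq_square)
  qed
qed

section \<open>The Sobolev space of the half-line\<close>

lemma has_L2_deriv_iff:
  "has_L2_deriv v g \<longleftrightarrow> L2 g \<and> (\<forall>x\<ge>0. v x = v 0 + (LBINT t:{0<..x}. g t))"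
proof -
  have "set_borel_measurable lborel {0<..} g \<longleftrightarrow> g \<in> borel_measurable half_line"
    unfolding set_borel_measurable_def by (subst borel_measurable_restrict_space_iff) auto
  moreover have "set_integrable lborel {0<..} (\<lambda>x. (cmod (g x))\<^sup>2) \<longleftrightarrow> integrable half_line (\<lambda>x. (cmod (g x))\<^sup>2)"
    by (simp add: set_integrable_eq)
  ultimately show ?thesis unfolding has_L2_deriv_def L2_def by blast
qed

lemma has_L2_derivD:
  assumes "has_L2_deriv v g"
  shows "L2 g" and "x \<ge> 0 \<Longrightarrow> v x = v 0 + (LBINT t:{0<..x}. g t)"
  using assms unfolding has_L2_deriv_iff by blast+

lemma has_L2_deriv_increment:
  assumes v: "has_L2_deriv v g" and xy: "0 \<le> x" "x \<le> y"
  shows "v y - v x = (LBINT t:{x<..y}. g t)"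
proof -
  note g = has_L2_derivD(1)[OF v]
  have "{0<..y} = {0<..x} \<union> {x<..y}" using xy by auto
  then have "(LBINT t:{0<..y}. g t) = (LBINT t:{0<..x}. g t) + (LBINT t:{x<..y}. g t)"
    using L2_set_integrable_Ioc[OF g] xy by (simp add: set_integral_Un)
  then show ?thesis using has_L2_derivD(2)[OF v, of x] has_L2_derivD(2)[OF v, of y] xy by simp
qed

text \<open>By the Cauchy-Schwarz inequality an \<open>L\<^sup>2\<close> derivative forces Hoelder continuity with exponent
  \<open>1 / 2\<close>; continuity, measurability and the Sobolev inequality all come from here.\<close>

lemma has_L2_deriv_holder:
  assumes v: "has_L2_deriv v g" and xy: "0 \<le> x" "0 \<le> y"
  shows "(cmod (v y - v x))\<^sup>2 \<le> \<bar>y - x\<bar> * L2_sq g"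
proof -
  have *: "(cmod (v y - v x))\<^sup>2 \<le> (y - x) * L2_sq g" if "0 \<le> x" "x \<le> y" for x y
    using L2_integral_Ioc_bound[OF has_L2_derivD(1)[OF v] that] has_L2_deriv_increment[OF v that] by simp
  show ?thesis using *[of x y] *[of y x] xy by (cases "x \<le> y") (auto simp: norm_minus_commute)
qed

lemma has_L2_deriv_continuous:
  assumes v: "has_L2_deriv v g"
  shows "continuous_on {0..} v"
  unfolding continuous_on_def
proof
  fix x :: real assume x: "x \<in> {0..}"
  have "((\<lambda>y. sqrt (\<bar>y - x\<bar> * L2_sq g)) \<longlongrightarrow> sqrt (\<bar>x - x\<bar> * L2_sq g)) (at x within {0..})"
    by (auto intro!: tendsto_eq_intros)
  then have lim: "((\<lambda>y. sqrt (\<bar>y - x\<bar> * L2_sq g)) \<longlongrightarrow> 0) (at x within {0..})" by simp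
  have "((\<lambda>y. v y - v x) \<longlongrightarrow> 0) (at x within {0..})"
  proof (rule Lim_null_comparison[OF _ lim])
    show "\<forall>\<^sub>F y in at x within {0..}. norm (v y - v x) \<le> sqrt (\<bar>y - x\<bar> * L2_sq g)"
      unfolding eventually_at_filter
      using has_L2_deriv_holder[OF v] x by (intro always_eventually) (auto intro!: real_le_rsqrt)
  qed
  then show "(v \<longlongrightarrow> v x) (at x within {0..})" by (simp add: LIM_zero_iff)
qed

lemma continuous_measurable_half_line:
  fixes v :: "real \<Rightarrow> 'a :: real_normed_vector"
  assumes "continuous_on {0..} v"
  shows "v \<in> borel_measurable half_line"
proof -
  have "v \<in> borel_measurable (restrict_space borel {0<..})"
    by (rule borel_measurable_continuous_on_restrict) (rule continuous_on_subset[OF assms], auto)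
  then show ?thesis by (simp cong: measurable_cong_sets add: sets_restrict_space)
qed

lemma continuous_set_integrable:
  fixes f :: "real \<Rightarrow> 'a :: euclidean_space"
  assumes "continuous_on {0..} f" "0 \<le> x"
  shows "set_integrable lborel {x<..y} f"
proof -
  have "set_integrable lborel {x..y} f"
    unfolding set_integrable_def
    by (rule borel_integrable_compact[OF compact_Icc continuous_on_subset[OF assms(1)]]) (use assms(2) in auto)
  then show ?thesis by (rule set_integrable_subset) auto
qed

text \<open>The positive and the negative part of \<open>f\<close> are densities of finite measures that agree on the
  half-lines \<open>(x, \<infinity>)\<close>, so these measures are equal.\<close>

lemma integral_tails_zero_imp_AE_zero:
  fixes f :: "real \<Rightarrow> real"
  assumes f: "integrable lborel f" and zero: "\<And>x. (LBINT t:{x<..}. f t) = 0"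
  shows "AE x in lborel. f x = 0"
proof -
  let ?P = "\<lambda>x. max 0 (f x)" and ?N = "\<lambda>x. max 0 (- f x)"
  have [measurable]: "f \<in> borel_measurable borel" using f by auto
  have PN: "integrable lborel ?P" "integrable lborel ?N"
    using f by (auto intro!: integrable_max)
  have em: "emeasure (density lborel (\<lambda>x. ennreal (h x))) {x<..} = ennreal (LBINT t:{x<..}. h t)"
    if h: "integrable lborel h" "\<And>x. h x \<ge> 0" for h :: "real \<Rightarrow> real" and x
  proof -
    have "emeasure (density lborel (\<lambda>x. ennreal (h x))) {x<..} = (\<integral>\<^sup>+t. ennreal (h t) * indicator {x<..} t \<partial>lborel)"
      using h by (intro emeasure_density) auto
    also have "\<dots> = (\<integral>\<^sup>+t. ennreal (indicator {x<..} t *\<^sub>R h t) \<partial>lborel)"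
      by (intro nn_integral_cong) (auto simp: indicator_def)
    also have "\<dots> = ennreal (LBINT t:{x<..}. h t)"
      unfolding set_lebesgue_integral_def
      using h by (intro nn_integral_eq_integral integrable_mult_indicator) auto
    finally show ?thesis .
  qed
  have eq: "(LBINT t:{x<..}. ?P t) = (LBINT t:{x<..}. ?N t)" for x
  proof -
    have "(LBINT t:{x<..}. ?P t) - (LBINT t:{x<..}. ?N t) = (LBINT t:{x<..}. ?P t - ?N t)"
      using integrable_mult_indicator[OF _ PN(1), of "{x<..}"] integrable_mult_indicator[OF _ PN(2), of "{x<..}"]
      by (subst set_integral_diff) (auto simp: set_integrable_def)
    also have "(\<lambda>t. ?P t - ?N t) = f" by auto
    finally show ?thesis using zero by simp
  qed
  have "density lborel (\<lambda>x. ennreal (?P x)) = density lborel (\<lambda>x. ennreal (?N x))"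
    by (rule measure_eqI_lessThan) (auto simp: em PN eq)
  then have "AE x in lborel. ennreal (?P x) = ennreal (?N x)"
    by (subst (asm) sigma_finite_measure.density_unique_iff[OF sigma_finite_lborel]) auto
  then show ?thesis by eventually_elim (auto simp: max_def split: if_splits)
qed

text \<open>Truncation to \<open>(0, n]\<close> makes the difference integrable on the real line, where the preceding lemma
  applies to its real and imaginary parts.\<close>

lemma AE_eq_half_lineI:
  fixes g h :: "real \<Rightarrow> complex"
  assumes gi: "\<And>x y. 0 \<le> x \<Longrightarrow> set_integrable lborel {x<..y} g"
    and hi: "\<And>x y. 0 \<le> x \<Longrightarrow> set_integrable lborel {x<..y} h"
    and eq: "\<And>x y. 0 \<le> x \<Longrightarrow> x \<le> y \<Longrightarrow> (LBINT t:{x<..y}. g t) = (LBINT t:{x<..y}. h t)"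
  shows "AE x in half_line. g x = h x"
proof -
  let ?d = "\<lambda>x. g x - h x"
  have int0: "(LBINT t:{x<..y}. ?d t) = 0" if "0 \<le> x" "x \<le> y" for x y
    using eq[OF that] gi[OF that(1)] hi[OF that(1)] by (simp add: set_integral_diff)
  have on_interval: "AE x in lborel. indicator {0<..real n} x *\<^sub>R ?d x = 0" for n
  proof -
    have i: "integrable lborel (\<lambda>x. indicator {0<..real n} x *\<^sub>R ?d x)"
      using set_integral_diff(1)[OF gi[of 0 "real n"] hi[of 0 "real n"]] by (simp add: set_integrable_def)
    have tails: "(LBINT t:{x<..}. indicator {0<..real n} t *\<^sub>R ?d t) = 0" for x
    proof -
      have "(LBINT t:{x<..}. indicator {0<..real n} t *\<^sub>R ?d t) = (LBINT t:{max 0 x<..real n}. ?d t)"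
        unfolding set_lebesgue_integral_def
        by (intro Bochner_Integration.integral_cong) (auto simp: indicator_def)
      also have "\<dots> = 0"
      proof (cases "max 0 x \<le> real n")
        case True then show ?thesis by (intro int0) auto
      qed (simp add: set_lebesgue_integral_def)
      finally show ?thesis .
    qed
    have part: "AE x in lborel. F (indicator {0<..real n} x *\<^sub>R ?d x) = 0"
      if F: "bounded_linear F" for F :: "complex \<Rightarrow> real"
    proof (rule integral_tails_zero_imp_AE_zero)
      show "integrable lborel (\<lambda>x. F (indicator {0<..real n} x *\<^sub>R ?d x))"
        by (rule integrable_bounded_linear[OF F i])
      fix x
      have "(LBINT t:{x<..}. F (indicator {0<..real n} t *\<^sub>R ?d t))
          = (\<integral>t. F (indicator {x<..} t *\<^sub>R (indicator {0<..real n} t *\<^sub>R ?d t)) \<partial>lborel)"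
        unfolding set_lebesgue_integral_def by (simp only: linear_scale[OF bounded_linear.linear[OF F]])
      also have "\<dots> = F (LBINT t:{x<..}. indicator {0<..real n} t *\<^sub>R ?d t)"
        unfolding set_lebesgue_integral_def
        by (rule integral_bounded_linear[OF F integrable_mult_indicator[OF _ i]]) simp
      also have "\<dots> = 0" using tails F by (simp add: linear_0[OF bounded_linear.linear])
      finally show "(LBINT t:{x<..}. F (indicator {0<..real n} t *\<^sub>R ?d t)) = 0" .
    qed
    from part[OF bounded_linear_Re] part[OF bounded_linear_Im] show ?thesis
      by eventually_elim (auto simp: complex_eq_iff)
  qed
  have "AE x in lborel. \<forall>n. indicator {0<..real n} x *\<^sub>R ?d x = 0"
    using on_interval by (subst AE_all_countable) blast
  then have "AE x in lborel. x \<in> {0<..} \<longrightarrow> g x = h x"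
  proof eventually_elim
    case (elim x)
    obtain n :: nat where "x \<le> real n" using real_arch_simple by blast
    then show ?case using elim[rule_format, of n] by (auto simp: indicator_def)
  qed
  then show ?thesis by (simp add: AE_restrict_space_iff)
qed

lemma L2_deriv_unique:
  assumes "has_L2_deriv v g" "has_L2_deriv v h"
  shows "AE x in half_line. g x = h x"
proof (rule AE_eq_half_lineI)
  show "set_integrable lborel {x<..y} g" "set_integrable lborel {x<..y} h" if "0 \<le> x" for x y
    using assms that by (auto intro: L2_set_integrable_Ioc has_L2_derivD)
  show "(LBINT t:{x<..y}. g t) = (LBINT t:{x<..y}. h t)" if "0 \<le> x" "x \<le> y" for x y
    using has_L2_deriv_increment[OF assms(1) that] has_L2_deriv_increment[OF assms(2) that] by simp
qed

lemma H1_deriv_props: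
  assumes "v \<in> H1_half_line"
  shows "has_L2_deriv v (H1_deriv v)"
  using assms someI_ex[of "has_L2_deriv v"] unfolding H1_deriv_def H1_half_line_def by blast

lemma H1_half_lineI:
  assumes "has_L2_deriv v g" "integrable half_line (\<lambda>x. (cmod (v x))\<^sup>2)"
  shows "v \<in> H1_half_line"
  using assms by (auto simp: H1_half_line_def set_integrable_eq)

lemma H1_L2:
  assumes "v \<in> H1_half_line"
  shows "L2 v" "L2 (H1_deriv v)"
  using assms continuous_measurable_half_line[OF has_L2_deriv_continuous[OF H1_deriv_props[OF assms]]]
    has_L2_derivD(1)[OF H1_deriv_props[OF assms]]
  by (auto simp: L2_def H1_half_line_def set_integrable_eq)

lemma H1_deriv_AE:
  assumes "has_L2_deriv v g"
  shows "AE x in half_line. H1_deriv v x = g x"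
proof -
  have "has_L2_deriv v (H1_deriv v)" using assms unfolding H1_deriv_def by (rule someI[of "has_L2_deriv v"])
  then show ?thesis using assms by (rule L2_deriv_unique)
qed

lemma has_L2_deriv_add:
  assumes "has_L2_deriv v g" "has_L2_deriv w h"
  shows "has_L2_deriv (\<lambda>x. v x + w x) (\<lambda>x. g x + h x)"
proof -
  have "(LBINT t:{0<..x}. g t + h t) = (LBINT t:{0<..x}. g t) + (LBINT t:{0<..x}. h t)" for x
    using assms by (intro set_integral_add L2_set_integrable_Ioc) (auto dest: has_L2_derivD)
  then have "v x + w x = v 0 + w 0 + (LBINT t:{0<..x}. g t + h t)" if "x \<ge> 0" for x
    using has_L2_derivD(2)[OF assms(1) that] has_L2_derivD(2)[OF assms(2) that] by simp
  then show ?thesis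
    using L2_add[OF has_L2_derivD(1)[OF assms(1)] has_L2_derivD(1)[OF assms(2)]]
    unfolding has_L2_deriv_iff by blast
qed

lemma has_L2_deriv_mult:
  assumes "has_L2_deriv v g"
  shows "has_L2_deriv (\<lambda>x. c * v x) (\<lambda>x. c * g x)"
proof -
  have "c * v x = c * v 0 + (LBINT t:{0<..x}. c * g t)" if "x \<ge> 0" for x
    using has_L2_derivD(2)[OF assms that] by (simp add: distrib_left)
  then show ?thesis
    using L2_mult[OF has_L2_derivD(1)[OF assms]] unfolding has_L2_deriv_iff by blast
qed

lemma H1_add:
  assumes "v \<in> H1_half_line" "w \<in> H1_half_line"
  shows "(\<lambda>x. v x + w x) \<in> H1_half_line"
    and "AE x in half_line. H1_deriv (\<lambda>x. v x + w x) x = H1_deriv v x + H1_deriv w x"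
proof -
  have d: "has_L2_deriv (\<lambda>x. v x + w x) (\<lambda>x. H1_deriv v x + H1_deriv w x)"
    using assms by (intro has_L2_deriv_add H1_deriv_props)
  show "(\<lambda>x. v x + w x) \<in> H1_half_line"
    using L2_add[OF H1_L2(1)[OF assms(1)] H1_L2(1)[OF assms(2)]] d by (auto simp: L2_def intro: H1_half_lineI)
  show "AE x in half_line. H1_deriv (\<lambda>x. v x + w x) x = H1_deriv v x + H1_deriv w x"
    by (rule H1_deriv_AE[OF d])
qed

lemma H1_mult:
  assumes "v \<in> H1_half_line"
  shows "(\<lambda>x. c * v x) \<in> H1_half_line"
    and "AE x in half_line. H1_deriv (\<lambda>x. c * v x) x = c * H1_deriv v x"
proof -
  have d: "has_L2_deriv (\<lambda>x. c * v x) (\<lambda>x. c * H1_deriv v x)"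
    using assms by (intro has_L2_deriv_mult H1_deriv_props)
  show "(\<lambda>x. c * v x) \<in> H1_half_line"
    using L2_mult[OF H1_L2(1)[OF assms]] d by (auto simp: L2_def intro: H1_half_lineI)
  show "AE x in half_line. H1_deriv (\<lambda>x. c * v x) x = c * H1_deriv v x"
    by (rule H1_deriv_AE[OF d])
qed

lemma H1_zero: "(\<lambda>x. 0) \<in> H1_half_line" "AE x in half_line. H1_deriv (\<lambda>x. 0) x = 0"
proof -
  have d: "has_L2_deriv (\<lambda>x. 0) (\<lambda>x. 0)" by (simp add: has_L2_deriv_iff L2_zero)
  show "(\<lambda>x. 0) \<in> H1_half_line" by (rule H1_half_lineI[OF d]) simp
  show "AE x in half_line. H1_deriv (\<lambda>x. 0) x = 0" by (rule H1_deriv_AE[OF d])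
qed

text \<open>The Sobolev inequality compares \<open>v x\<close> with the values on \<open>(x, x + 1]\<close>, which differ from it by
  at most the \<open>L\<^sup>2\<close> norm of the derivative, and averages over that interval.\<close>

lemma sobolev_half_line:
  assumes v: "v \<in> H1_half_line" and x: "x \<ge> 0"
  shows "(cmod (v x))\<^sup>2 \<le> 2 * (L2_sq (H1_deriv v) + L2_sq v)"
proof -
  let ?G = "L2_sq (H1_deriv v)"
  note d = H1_deriv_props[OF v] and vL = H1_L2(1)[OF v]
  have sq0: "set_integrable lborel {0<..} (\<lambda>t. (cmod (v t))\<^sup>2)"
    using vL by (simp add: set_integrable_eq L2_def)
  have sqi: "set_integrable lborel {x<..x+1} (\<lambda>t. (cmod (v t))\<^sup>2)"
    by (rule set_integrable_subset[OF sq0]) (use x in auto)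
  have ci: "set_integrable lborel {x<..x+1} (\<lambda>t. c)" for c :: real
    unfolding set_integrable_def by (intro integrable_scaleR_left integrable_real_indicator) auto
  have pt: "(cmod (v x))\<^sup>2 \<le> 2 * (cmod (v t))\<^sup>2 + 2 * ?G" if t: "t \<in> {x<..x+1}" for t
  proof -
    have "cmod (v x) \<le> cmod (v t) + cmod (v x - v t)"
      using norm_triangle_ineq[of "v t" "v x - v t"] by simp
    then have "(cmod (v x))\<^sup>2 \<le> (cmod (v t) + cmod (v x - v t))\<^sup>2" by (rule power_mono) simp
    also have "\<dots> \<le> 2 * (cmod (v t))\<^sup>2 + 2 * (cmod (v x - v t))\<^sup>2"
      using sum_squares_bound[of "cmod (v t)" "cmod (v x - v t)"] by (simp add: power2_sum)
    also have "(cmod (v x - v t))\<^sup>2 \<le> \<bar>x - t\<bar> * ?G"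
      using t x by (intro has_L2_deriv_holder[OF d]) auto
    also have "\<dots> \<le> 1 * ?G" using t by (intro mult_right_mono L2_sq_nonneg) auto
    finally show ?thesis by simp
  qed
  have "(cmod (v x))\<^sup>2 = (LBINT t:{x<..x+1}. (cmod (v x))\<^sup>2)"
    by (simp add: set_integral_const[of "{x<..x+1}" lborel] measure_def)
  also have "\<dots> \<le> (LBINT t:{x<..x+1}. 2 * (cmod (v t))\<^sup>2 + 2 * ?G)"
    using sqi ci pt by (intro set_integral_mono set_integral_add(1)) auto
  also have "\<dots> = 2 * (LBINT t:{x<..x+1}. (cmod (v t))\<^sup>2) + 2 * ?G"
    using sqi ci by (subst set_integral_add) (auto simp: set_integral_const[of "{x<..x+1}" lborel] measure_def)
  also have "(LBINT t:{x<..x+1}. (cmod (v t))\<^sup>2) \<le> L2_sq v"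
    unfolding L2_sq_def set_integral_half_line[symmetric]
    unfolding set_lebesgue_integral_def
    by (rule integral_mono) (use sqi sq0 x in \<open>auto simp: set_integrable_def indicator_def\<close>)
  finally show ?thesis by simp
qed

section \<open>The first variation of the action\<close>

lemma Lq_norm_pow_two: "Lq_norm_pow N 2 v = (\<Sum>j<N. L2_sq (v j))"
  by (simp add: Lq_norm_pow_def L2_sq_def set_integral_half_line)

lemma Lq_norm_pow_half_line: "Lq_norm_pow N q v = (\<Sum>j<N. \<integral>x. cmod (v j x) powr q \<partial>half_line)"
  by (simp add: Lq_norm_pow_def set_integral_half_line)

lemma H1_norm_sq:
  "(H1_norm N v)\<^sup>2 = (\<Sum>j<N. L2_sq (H1_deriv (v j))) + (\<Sum>j<N. L2_sq (v j))"
  by (simp add: H1_norm_def Lq_norm_pow_two sum_nonneg L2_sq_nonneg)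

lemma H1_norm_nonneg: "H1_norm N v \<ge> 0"
  by (simp add: H1_norm_def Lq_norm_pow_two sum_nonneg L2_sq_nonneg)

lemma edge_norm_le_H1_norm:
  assumes "j < N"
  shows "L2_sq (H1_deriv (v j)) + L2_sq (v j) \<le> (H1_norm N v)\<^sup>2"
proof -
  have "L2_sq (H1_deriv (v j)) \<le> (\<Sum>j<N. L2_sq (H1_deriv (v j)))"
    using assms by (intro member_le_sum) (auto simp: L2_sq_nonneg)
  moreover have "L2_sq (v j) \<le> (\<Sum>j<N. L2_sq (v j))"
    using assms by (intro member_le_sum) (auto simp: L2_sq_nonneg)
  ultimately show ?thesis by (simp add: H1_norm_sq)
qed

lemma H1_graph_pointwise_bound:
  assumes "v \<in> H1_graph N" "j < N" "x \<ge> 0"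
  shows "cmod (v j x) \<le> 2 * H1_norm N v"
proof -
  have "(cmod (v j x))\<^sup>2 \<le> 2 * (H1_norm N v)\<^sup>2"
    using sobolev_half_line[of "v j" x] edge_norm_le_H1_norm[OF assms(2), of v] assms by (simp add: H1_graph_def)
  also have "\<dots> \<le> (2 * H1_norm N v)\<^sup>2" by (simp add: power_mult_distrib)
  finally show ?thesis by (rule power2_le_imp_le) (simp add: H1_norm_nonneg)
qed

lemma H1_graph_mult:
  assumes "v \<in> H1_graph N"
  shows "(\<lambda>j x. c * v j x) \<in> H1_graph N"
  using assms by (simp add: H1_graph_def H1_mult)

lemma L2_sq_H1_deriv_mult:
  assumes "v \<in> H1_half_line"
  shows "L2_sq (H1_deriv (\<lambda>x. c * v x)) = (cmod c)\<^sup>2 * L2_sq (H1_deriv v)"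
proof -
  have "L2_sq (H1_deriv (\<lambda>x. c * v x)) = L2_sq (\<lambda>x. c * H1_deriv v x)"
    using assms by (intro L2_sq_cong_AE H1_L2 H1_mult L2_mult)
  then show ?thesis by (simp add: L2_sq_mult)
qed

lemma H1_norm_mult:
  assumes "v \<in> H1_graph N"
  shows "H1_norm N (\<lambda>j x. c * v j x) = cmod c * H1_norm N v"
proof (rule power2_eq_imp_eq)
  show "(H1_norm N (\<lambda>j x. c * v j x))\<^sup>2 = (cmod c * H1_norm N v)\<^sup>2"
    using assms unfolding H1_norm_sq power_mult_distrib
    by (simp add: L2_sq_mult L2_sq_H1_deriv_mult H1_graph_def sum_distrib_left distrib_left)
qed (auto simp: H1_norm_nonneg)

lemma AE_half_lineI:
  assumes "\<And>x. x > 0 \<Longrightarrow> P x"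
  shows "AE x in half_line. P x"
  using assms by (intro AE_I2) (simp add: space_restrict_space)

lemma L2_power_nl:
  assumes p: "p > 1" and v: "L2 v" and B: "\<And>x. x > 0 \<Longrightarrow> cmod (v x) \<le> B"
  shows "L2 (\<lambda>x. power_nl p (v x))"
proof -
  have [measurable]: "v \<in> borel_measurable half_line" by (rule L2_measurable[OF v])
  have m: "(\<lambda>x. power_nl p (v x)) \<in> borel_measurable half_line"
    unfolding power_nl_def by measurable
  have "integrable half_line (\<lambda>x. (cmod (power_nl p (v x)))\<^sup>2)"
  proof (rule Bochner_Integration.integrable_bound)
    show "integrable half_line (\<lambda>x. (B powr (p - 1))\<^sup>2 * (cmod (v x))\<^sup>2)"
      using L2_integrable_sq[OF v] by simp
    show "(\<lambda>x. (cmod (power_nl p (v x)))\<^sup>2) \<in> borel_measurable half_line" using m by measurable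
    show "AE x in half_line. norm ((cmod (power_nl p (v x)))\<^sup>2) \<le> norm ((B powr (p - 1))\<^sup>2 * (cmod (v x))\<^sup>2)"
    proof (rule AE_half_lineI)
      fix x :: real assume "x > 0"
      have "cmod (v x) powr (p - 1) \<le> B powr (p - 1)"
        using B[OF \<open>x > 0\<close>] p by (intro powr_mono2) auto
      then have "cmod (power_nl p (v x)) \<le> B powr (p - 1) * cmod (v x)"
        by (simp add: power_nl_def norm_mult mult_right_mono)
      then have "(cmod (power_nl p (v x)))\<^sup>2 \<le> (B powr (p - 1) * cmod (v x))\<^sup>2" by (rule power_mono) simp
      then show "norm ((cmod (power_nl p (v x)))\<^sup>2) \<le> norm ((B powr (p - 1))\<^sup>2 * (cmod (v x))\<^sup>2)"
        by (simp add: power_mult_distrib)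
    qed
  qed
  then show ?thesis using m by (simp add: L2_def)
qed

lemma integrable_norm_powr:
  assumes p: "p > 1" and v: "L2 v" and B: "\<And>x. x > 0 \<Longrightarrow> cmod (v x) \<le> B"
  shows "integrable half_line (\<lambda>x. cmod (v x) powr (p + 1))"
proof -
  have "cmod z powr (p + 1) = power_nl p z \<bullet> z" for z
  proof -
    have "power_nl p z \<bullet> z = cmod z powr (p - 1) * (cmod z)\<^sup>2"
      unfolding power_nl_def scaleR_conv_of_real[symmetric] by (simp add: power2_norm_eq_inner)
    also have "\<dots> = cmod z powr (p + 1)"
      using p by (cases "z = 0") (simp_all add: powr_add[symmetric] add.commute flip: powr_numeral)
    finally show ?thesis by simp
  qed
  then show ?thesis using L2_integrable_ip[OF L2_power_nl[OF p v B] v] by simp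
qed

text \<open>Boundedness of \<open>v\<close> and \<open>h\<close> turns the pointwise remainder estimate into one by the \<open>L\<^sup>2\<close> norm of
  \<open>h\<close>.\<close>

lemma potential_remainder:
  assumes p: "p > 1" and v: "L2 v" "\<And>x. x > 0 \<Longrightarrow> cmod (v x) \<le> B"
    and h: "L2 h" "\<And>x. x > 0 \<Longrightarrow> cmod (h x) \<le> C"
  shows "\<bar>(\<integral>x. cmod (v x + h x) powr (p + 1) \<partial>half_line) - (\<integral>x. cmod (v x) powr (p + 1) \<partial>half_line)
      - (p + 1) * L2_ip (\<lambda>x. power_nl p (v x)) h\<bar> \<le> (p + 1)\<^sup>2 * (B + C) powr (p - 1) * L2_sq h"
proof -
  let ?R = "\<lambda>x. cmod (v x + h x) powr (p + 1) - cmod (v x) powr (p + 1) - (p + 1) * (power_nl p (v x) \<bullet> h x)"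
  have i1: "integrable half_line (\<lambda>x. cmod (v x + h x) powr (p + 1))"
  proof (rule integrable_norm_powr[OF p L2_add[OF v(1) h(1)]])
    show "cmod (v x + h x) \<le> B + C" if "x > 0" for x
      using norm_triangle_ineq[of "v x" "h x"] v(2)[OF that] h(2)[OF that] by simp
  qed
  have i2: "integrable half_line (\<lambda>x. cmod (v x) powr (p + 1))"
    by (rule integrable_norm_powr[OF p v])
  have i3: "integrable half_line (\<lambda>x. power_nl p (v x) \<bullet> h x)"
    by (rule L2_integrable_ip[OF L2_power_nl[OF p v] h(1)])
  have eq: "(\<integral>x. cmod (v x + h x) powr (p + 1) \<partial>half_line) - (\<integral>x. cmod (v x) powr (p + 1) \<partial>half_line)
      - (p + 1) * L2_ip (\<lambda>x. power_nl p (v x)) h = (\<integral>x. ?R x \<partial>half_line)"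
    using i1 i2 i3 by (simp add: L2_ip_def)
  have "\<bar>\<integral>x. ?R x \<partial>half_line\<bar> \<le> (\<integral>x. \<bar>?R x\<bar> \<partial>half_line)" by (rule integral_abs_bound)
  also have "\<dots> \<le> (\<integral>x. (p + 1)\<^sup>2 * (B + C) powr (p - 1) * (cmod (h x))\<^sup>2 \<partial>half_line)"
  proof (rule integral_mono_AE)
    show "integrable half_line (\<lambda>x. \<bar>?R x\<bar>)"
      by (intro integrable_abs Bochner_Integration.integrable_diff integrable_mult_right i1 i2 i3)
    show "integrable half_line (\<lambda>x. (p + 1)\<^sup>2 * (B + C) powr (p - 1) * (cmod (h x))\<^sup>2)"
      using L2_integrable_sq[OF h(1)] by simp
    show "AE x in half_line. \<bar>?R x\<bar> \<le> (p + 1)\<^sup>2 * (B + C) powr (p - 1) * (cmod (h x))\<^sup>2"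
    proof (rule AE_half_lineI)
      fix x :: real assume x: "x > 0"
      have "(cmod (v x) + cmod (h x)) powr (p - 1) \<le> (B + C) powr (p - 1)"
        using v(2)[OF x] h(2)[OF x] p by (intro powr_mono2) auto
      then have "(p + 1)\<^sup>2 * (cmod (v x) + cmod (h x)) powr (p - 1) * (cmod (h x))\<^sup>2
          \<le> (p + 1)\<^sup>2 * (B + C) powr (p - 1) * (cmod (h x))\<^sup>2"
        by (intro mult_right_mono mult_left_mono) auto
      then show "\<bar>?R x\<bar> \<le> (p + 1)\<^sup>2 * (B + C) powr (p - 1) * (cmod (h x))\<^sup>2"
        using norm_powr_remainder[OF p, of "v x" "h x"] by linarith
    qed
  qed
  also have "\<dots> = (p + 1)\<^sup>2 * (B + C) powr (p - 1) * L2_sq h" by (simp add: L2_sq_def)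
  finally show ?thesis unfolding eq .
qed

text \<open>The derivative of the action at \<open>v\<close> in the direction \<open>h\<close>, with the derivatives of \<open>v\<close> and \<open>h\<close> kept
  in weak form.\<close>

definition first_variation :: "real \<Rightarrow> real \<Rightarrow> real \<Rightarrow> nat \<Rightarrow> graph_fun \<Rightarrow> graph_fun \<Rightarrow> real" where
  "first_variation p \<omega> \<beta> N v h =
     (\<Sum>j<N. L2_ip (H1_deriv (v j)) (H1_deriv (h j)) + \<omega> * L2_ip (v j) (h j)
        - L2_ip (\<lambda>x. power_nl p (v j x)) (h j))
     + 1 / \<beta> * ((\<Sum>j<N. v j 0) \<bullet> (\<Sum>j<N. h j 0))"

lemma first_variation_scale:
  assumes "v \<in> H1_graph N" "h \<in> H1_graph N"
  shows "first_variation p \<omega> \<beta> N v (\<lambda>j x. of_real c * h j x) = c * first_variation p \<omega> \<beta> N v h"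
proof -
  have "L2_ip (H1_deriv (v j)) (H1_deriv (\<lambda>x. of_real c * h j x)) = c * L2_ip (H1_deriv (v j)) (H1_deriv (h j))"
    if "j < N" for j
  proof -
    have "v j \<in> H1_half_line" "h j \<in> H1_half_line" using assms that by (auto simp: H1_graph_def)
    then have "L2_ip (H1_deriv (v j)) (H1_deriv (\<lambda>x. of_real c * h j x))
        = L2_ip (H1_deriv (v j)) (\<lambda>x. of_real c * H1_deriv (h j) x)"
      by (intro L2_ip_cong_AE(1) H1_L2 H1_mult L2_mult)
    then show ?thesis by (simp add: L2_ip_scaleR flip: scaleR_conv_of_real)
  qed
  moreover have "(\<Sum>j<N. v j 0) \<bullet> (\<Sum>j<N. of_real c * h j 0) = c * ((\<Sum>j<N. v j 0) \<bullet> (\<Sum>j<N. h j 0))"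
    by (simp flip: scaleR_conv_of_real scaleR_sum_right)
  moreover have "L2_ip f (\<lambda>x. of_real c * h j x) = c * L2_ip f (h j)" for f j
    using L2_ip_scaleR[of f c "h j"] by (simp add: scaleR_conv_of_real)
  ultimately have "first_variation p \<omega> \<beta> N v (\<lambda>j x. of_real c * h j x)
    = (\<Sum>j<N. c * (L2_ip (H1_deriv (v j)) (H1_deriv (h j)) + \<omega> * L2_ip (v j) (h j)
        - L2_ip (\<lambda>x. power_nl p (v j x)) (h j)))
     + 1 / \<beta> * (c * ((\<Sum>j<N. v j 0) \<bullet> (\<Sum>j<N. h j 0)))"
    unfolding first_variation_def by (intro arg_cong2[where f="(+)"] sum.cong) (auto simp: algebra_simps)
  then show ?thesis
    unfolding first_variation_def distrib_left sum_distrib_left by simp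
qed

text \<open>The quadratic terms of the action expand exactly; the remainder of the nonlinear term is
  quadratic because functions in \<open>H\<^sup>1\<close> are bounded.\<close>

lemma action_expansion:
  assumes p: "p > 1" and v: "v \<in> H1_graph N"
  shows "\<exists>K\<ge>0. \<forall>h\<in>H1_graph N. H1_norm N h \<le> 1 \<longrightarrow>
    \<bar>action p \<omega> \<beta> N (\<lambda>j x. v j x + h j x) - action p \<omega> \<beta> N v - first_variation p \<omega> \<beta> N v h\<bar>
      \<le> K * (H1_norm N h)\<^sup>2"
proof -
  define B where "B = 2 * H1_norm N v"
  \<comment> \<open>One summand for each term of the action. On every edge \<open>B\<close> bounds \<open>v\<close>, and \<open>2\<close> bounds the test
    functions of norm at most \<open>1\<close>.\<close>
  define K where "K = 1/2 + 2 * (real N)\<^sup>2 / \<bar>\<beta>\<bar> + \<bar>\<omega>\<bar> / 2 + (p + 1) * (B + 2) powr (p - 1)"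
  have "K \<ge> 0" using p by (simp add: K_def)
  moreover have "\<bar>action p \<omega> \<beta> N (\<lambda>j x. v j x + h j x) - action p \<omega> \<beta> N v - first_variation p \<omega> \<beta> N v h\<bar>
      \<le> K * (H1_norm N h)\<^sup>2"
    if h: "h \<in> H1_graph N" and h1: "H1_norm N h \<le> 1" for h
  proof -
    let ?n = "H1_norm N h"
    have vj: "v j \<in> H1_half_line" and hj: "h j \<in> H1_half_line" if "j < N" for j
      using v h that by (auto simp: H1_graph_def)
    define D where "D = (\<Sum>j<N. L2_sq (H1_deriv (h j)))"
    define M where "M = (\<Sum>j<N. L2_sq (h j))"
    define Rem where "Rem j = (\<integral>x. cmod (v j x + h j x) powr (p + 1) \<partial>half_line)
      - (\<integral>x. cmod (v j x) powr (p + 1) \<partial>half_line) - (p + 1) * L2_ip (\<lambda>x. power_nl p (v j x)) (h j)" for j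
    have DM: "D \<ge> 0" "M \<ge> 0" "D + M = ?n\<^sup>2"
      by (auto simp: D_def M_def H1_norm_sq sum_nonneg L2_sq_nonneg)
    have e1: "L2_sq (H1_deriv (\<lambda>x. v j x + h j x))
        = L2_sq (H1_deriv (v j)) + 2 * L2_ip (H1_deriv (v j)) (H1_deriv (h j)) + L2_sq (H1_deriv (h j))"
      if "j < N" for j
    proof -
      have "L2_sq (H1_deriv (\<lambda>x. v j x + h j x)) = L2_sq (\<lambda>x. H1_deriv (v j) x + H1_deriv (h j) x)"
        using vj[OF that] hj[OF that] by (intro L2_sq_cong_AE H1_L2 H1_add L2_add)
      then show ?thesis using vj[OF that] hj[OF that] by (simp add: L2_sq_add H1_L2)
    qed
    have e2: "L2_sq (\<lambda>x. v j x + h j x) = L2_sq (v j) + 2 * L2_ip (v j) (h j) + L2_sq (h j)"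
      if "j < N" for j
      using vj[OF that] hj[OF that] by (simp add: L2_sq_add H1_L2)
    have e3: "(\<integral>x. cmod (v j x + h j x) powr (p + 1) \<partial>half_line) = (\<integral>x. cmod (v j x) powr (p + 1) \<partial>half_line)
        + (p + 1) * L2_ip (\<lambda>x. power_nl p (v j x)) (h j) + Rem j" for j
      by (simp add: Rem_def)
    have e4: "(cmod (\<Sum>j<N. v j 0 + h j 0))\<^sup>2 = (cmod (\<Sum>j<N. v j 0))\<^sup>2
        + 2 * ((\<Sum>j<N. v j 0) \<bullet> (\<Sum>j<N. h j 0)) + (cmod (\<Sum>j<N. h j 0))\<^sup>2"
      unfolding sum.distrib by (rule cmod_add_sq)
    have alg: "1/2 * ((a + 2 * b + D) + 1/\<beta> * (s + 2 * t + u)) + \<omega>/2 * (m + 2 * k + M)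
        - 1/(p+1) * (q + (p+1) * r + R) - (1/2 * (a + 1/\<beta> * s) + \<omega>/2 * m - 1/(p+1) * q)
        - (b + \<omega> * k - r + 1/\<beta> * t) = 1/2 * D + 1/2 * (1/\<beta> * u) + \<omega>/2 * M - 1/(p+1) * R"
      for a b D s t u m k M q r R
    proof -
      have "1/(p+1) * (q + (p+1) * r + R) = 1/(p+1) * q + r + 1/(p+1) * R"
        using p by (simp add: distrib_left)
      then show ?thesis by (simp add: algebra_simps)
    qed
    have eq: "action p \<omega> \<beta> N (\<lambda>j x. v j x + h j x) - action p \<omega> \<beta> N v - first_variation p \<omega> \<beta> N v h
      = 1/2 * D + 1/2 * (1/\<beta> * (cmod (\<Sum>j<N. h j 0))\<^sup>2) + \<omega>/2 * M - 1/(p+1) * (\<Sum>j<N. Rem j)"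
    proof -
      have "(\<Sum>j<N. L2_sq (H1_deriv (\<lambda>x. v j x + h j x))) = (\<Sum>j<N. L2_sq (H1_deriv (v j)))
          + 2 * (\<Sum>j<N. L2_ip (H1_deriv (v j)) (H1_deriv (h j))) + D"
        by (simp add: e1 D_def sum.distrib sum_distrib_left)
      moreover have "(\<Sum>j<N. L2_sq (\<lambda>x. v j x + h j x)) = (\<Sum>j<N. L2_sq (v j))
          + 2 * (\<Sum>j<N. L2_ip (v j) (h j)) + M"
        by (simp add: e2 M_def sum.distrib sum_distrib_left)
      moreover have "(\<Sum>j<N. \<integral>x. cmod (v j x + h j x) powr (p + 1) \<partial>half_line)
          = (\<Sum>j<N. \<integral>x. cmod (v j x) powr (p + 1) \<partial>half_line)
          + (p + 1) * (\<Sum>j<N. L2_ip (\<lambda>x. power_nl p (v j x)) (h j)) + (\<Sum>j<N. Rem j)"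
        by (simp add: e3 sum.distrib sum_distrib_left)
      moreover have "first_variation p \<omega> \<beta> N v h = (\<Sum>j<N. L2_ip (H1_deriv (v j)) (H1_deriv (h j)))
          + \<omega> * (\<Sum>j<N. L2_ip (v j) (h j)) - (\<Sum>j<N. L2_ip (\<lambda>x. power_nl p (v j x)) (h j))
          + 1 / \<beta> * ((\<Sum>j<N. v j 0) \<bullet> (\<Sum>j<N. h j 0))"
        by (simp add: first_variation_def sum.distrib sum_subtractf sum_distrib_left)
      ultimately show ?thesis
        unfolding action_def Lq_norm_pow_two unfolding Lq_norm_pow_half_line e4
        by (simp only: alg)
    qed
    have "\<bar>1/2 * D + 1/2 * (1/\<beta> * (cmod (\<Sum>j<N. h j 0))\<^sup>2) + \<omega>/2 * M - 1/(p+1) * (\<Sum>j<N. Rem j)\<bar>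
      \<le> 1/2 * D + 1/2 * (1/\<bar>\<beta>\<bar> * (cmod (\<Sum>j<N. h j 0))\<^sup>2) + \<bar>\<omega>\<bar>/2 * M + 1/(p+1) * (\<Sum>j<N. \<bar>Rem j\<bar>)"
    proof -
      have "\<bar>1/2 * D\<bar> = 1/2 * D" using DM by simp
      moreover have "\<bar>1/2 * (1/\<beta> * (cmod (\<Sum>j<N. h j 0))\<^sup>2)\<bar> = 1/2 * (1/\<bar>\<beta>\<bar> * (cmod (\<Sum>j<N. h j 0))\<^sup>2)"
        by (simp add: abs_mult)
      moreover have "\<bar>\<omega>/2 * M\<bar> = \<bar>\<omega>\<bar>/2 * M" using DM by (simp add: abs_mult)
      moreover have "\<bar>1/(p+1) * (\<Sum>j<N. Rem j)\<bar> \<le> 1/(p+1) * (\<Sum>j<N. \<bar>Rem j\<bar>)"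
        using p sum_abs[of Rem "{..<N}"] by (simp add: abs_mult divide_right_mono)
      ultimately show ?thesis by linarith
    qed
    also have "\<dots> \<le> 1/2 * ?n\<^sup>2 + 1/2 * (1/\<bar>\<beta>\<bar> * (2 * real N * ?n)\<^sup>2) + \<bar>\<omega>\<bar>/2 * ?n\<^sup>2
        + 1/(p+1) * ((p + 1)\<^sup>2 * (B + 2) powr (p - 1) * ?n\<^sup>2)"
    proof (intro add_mono mult_left_mono)
      show "D \<le> ?n\<^sup>2" "M \<le> ?n\<^sup>2" using DM by auto
      have "cmod (\<Sum>j<N. h j 0) \<le> (\<Sum>j<N. cmod (h j 0))" by (rule norm_sum)
      also have "\<dots> \<le> (\<Sum>j<N. 2 * ?n)" using H1_graph_pointwise_bound[OF h] by (intro sum_mono) auto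
      finally have "cmod (\<Sum>j<N. h j 0) \<le> 2 * real N * ?n" by simp
      then show "(cmod (\<Sum>j<N. h j 0))\<^sup>2 \<le> (2 * real N * ?n)\<^sup>2" by (rule power_mono) simp
      have "\<bar>Rem j\<bar> \<le> (p + 1)\<^sup>2 * (B + 2) powr (p - 1) * L2_sq (h j)" if j: "j < N" for j
        unfolding Rem_def
      proof (rule potential_remainder[OF p])
        show "L2 (v j)" "L2 (h j)" using vj[OF j] hj[OF j] by (auto intro: H1_L2)
        show "cmod (v j x) \<le> B" if "x > 0" for x
          using H1_graph_pointwise_bound[OF v j, of x] that by (simp add: B_def)
        show "cmod (h j x) \<le> 2" if "x > 0" for x
          using H1_graph_pointwise_bound[OF h j, of x] that h1 by simp
      qed
      then have "(\<Sum>j<N. \<bar>Rem j\<bar>) \<le> (\<Sum>j<N. (p + 1)\<^sup>2 * (B + 2) powr (p - 1) * L2_sq (h j))"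
        by (intro sum_mono) auto
      also have "\<dots> = (p + 1)\<^sup>2 * (B + 2) powr (p - 1) * M" by (simp add: M_def sum_distrib_left)
      also have "\<dots> \<le> (p + 1)\<^sup>2 * (B + 2) powr (p - 1) * ?n\<^sup>2"
        using DM by (intro mult_left_mono) auto
      finally show "(\<Sum>j<N. \<bar>Rem j\<bar>) \<le> (p + 1)\<^sup>2 * (B + 2) powr (p - 1) * ?n\<^sup>2" .
    qed (use p in auto)
    also have "\<dots> = K * ?n\<^sup>2"
    proof -
      have "1/(p+1) * ((p + 1)\<^sup>2 * (B + 2) powr (p - 1) * ?n\<^sup>2) = (p + 1) * (B + 2) powr (p - 1) * ?n\<^sup>2"
        using p by (simp add: power2_eq_square)
      then show ?thesis by (simp add: K_def power_mult_distrib distrib_right)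
    qed
    finally show ?thesis unfolding eq .
  qed
  ultimately show ?thesis by blast
qed

text \<open>A quadratic remainder is negligible against the norm. Conversely, along \<open>c h\<close> with small \<open>c\<close> the
  linear term would dominate the increment of the action if it did not vanish.\<close>

lemma critical_point_iff_first_variation:
  assumes p: "p > 1" and v: "v \<in> H1_graph N"
  shows "critical_point p \<omega> \<beta> N v \<longleftrightarrow> (\<forall>h\<in>H1_graph N. first_variation p \<omega> \<beta> N v h = 0)"
proof -
  let ?A = "\<lambda>h. action p \<omega> \<beta> N (\<lambda>j x. v j x + h j x) - action p \<omega> \<beta> N v"
  let ?L = "first_variation p \<omega> \<beta> N v" and ?n = "H1_norm N"
  obtain K where K: "K \<ge> 0" "\<And>h. h \<in> H1_graph N \<Longrightarrow> ?n h \<le> 1 \<Longrightarrow> \<bar>?A h - ?L h\<bar> \<le> K * (?n h)\<^sup>2"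
    using action_expansion[OF p v, of \<omega> \<beta>] by blast
  have n0: "?n h \<ge> 0" for h by (rule H1_norm_nonneg)
  show ?thesis
  proof
    assume crit: "critical_point p \<omega> \<beta> N v"
    show "\<forall>h\<in>H1_graph N. ?L h = 0"
    proof
      fix h assume h: "h \<in> H1_graph N"
      have "\<bar>?L h\<bar> \<le> 0 + e" if e: "e > 0" for e
      proof -
        define e' where "e' = e / (?n h + 1)"
        have e': "e' > 0" using e n0[of h] by (simp add: e'_def)
        obtain d where d: "d > 0" "\<And>g. g \<in> H1_graph N \<Longrightarrow> ?n g < d \<Longrightarrow> \<bar>?A g\<bar> \<le> e' / 2 * ?n g"
          using crit e' half_gt_zero[OF e'] unfolding critical_point_def by blast
        \<comment> \<open>Small enough for the criticality estimate, for the expansion, and for the quadratic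
          remainder to be at most \<open>e' / 2\<close> times the norm.\<close>
        define c where "c = min (d / 2) (min 1 (e' / (2 * K + 1))) / (?n h + 1)"
        have c: "c > 0" using d e' K n0[of h] by (simp add: c_def)
        let ?g = "\<lambda>j x. of_real c * h j x"
        have g: "?g \<in> H1_graph N" by (rule H1_graph_mult[OF h])
        have ng: "?n ?g = c * ?n h" using H1_norm_mult[OF h, of "of_real c"] c by simp
        have "c * ?n h \<le> c * (?n h + 1)" using c by (intro mult_left_mono) auto
        also have "\<dots> = min (d / 2) (min 1 (e' / (2 * K + 1)))" using n0[of h] by (simp add: c_def)
        finally have le: "?n ?g \<le> d / 2" "?n ?g \<le> 1" "?n ?g \<le> e' / (2 * K + 1)" by (auto simp: ng)
        have "K * ?n ?g \<le> e' / 2"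
        proof -
          have "(2 * K + 1) * ?n ?g \<le> e'" using le(3) K(1) by (simp add: field_simps)
          then show ?thesis using n0[of ?g] by (simp add: algebra_simps)
        qed
        then have "K * (?n ?g)\<^sup>2 \<le> e' / 2 * ?n ?g"
          using mult_right_mono[OF _ n0[of ?g]] by (fastforce simp: power2_eq_square mult.assoc)
        moreover have "\<bar>?A ?g\<bar> \<le> e' / 2 * ?n ?g" using d(2)[OF g] le(1) d(1) by simp
        moreover have "\<bar>?A ?g - ?L ?g\<bar> \<le> K * (?n ?g)\<^sup>2" by (rule K(2)[OF g le(2)])
        moreover have "\<bar>?L ?g\<bar> \<le> \<bar>?A ?g\<bar> + \<bar>?A ?g - ?L ?g\<bar>" by linarith
        ultimately have "\<bar>?L ?g\<bar> \<le> e' / 2 * ?n ?g + e' / 2 * ?n ?g" by linarith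
        then have "\<bar>?L ?g\<bar> \<le> e' * ?n ?g" by simp
        then have "c * \<bar>?L h\<bar> \<le> c * (e' * ?n h)"
          unfolding first_variation_scale[OF v h] ng using c by (simp add: abs_mult mult_ac)
        then have "\<bar>?L h\<bar> \<le> e' * ?n h" using c by simp
        also have "\<dots> \<le> e" using e n0[of h] by (simp add: e'_def field_simps)
        finally show ?thesis by simp
      qed
      then have "\<bar>?L h\<bar> \<le> 0" by (rule field_le_epsilon)
      then show "?L h = 0" by simp
    qed
  next
    assume L: "\<forall>h\<in>H1_graph N. ?L h = 0"
    show "critical_point p \<omega> \<beta> N v"
      unfolding critical_point_def
    proof (intro conjI allI impI v)
      fix e :: real assume e: "e > 0"
      have "\<bar>?A h\<bar> \<le> e * ?n h" if h: "h \<in> H1_graph N" "?n h < min 1 (e / (K + 1))" for h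
      proof -
        have "(K + 1) * ?n h \<le> e" using h(2) K(1) by (simp add: field_simps)
        then have "K * ?n h \<le> e" using n0[of h] by (simp add: algebra_simps)
        then have "K * ?n h * ?n h \<le> e * ?n h" by (rule mult_right_mono) (rule n0)
        moreover have "\<bar>?A h - ?L h\<bar> \<le> K * (?n h)\<^sup>2" using h by (intro K(2)) auto
        ultimately show ?thesis using L h(1) by (simp add: power2_eq_square mult.assoc)
      qed
      moreover have "min 1 (e / (K + 1)) > 0" using e K by simp
      ultimately show "\<exists>d>0. \<forall>h\<in>H1_graph N. ?n h < d \<longrightarrow> \<bar>?A h\<bar> \<le> e * ?n h" by blast
    qed
  qed
qed

section \<open>The Euler-Lagrange equation\<close>

lemma set_integral_Ioc_eq_integral:
  fixes f :: "real \<Rightarrow> 'a :: euclidean_space"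
  assumes f: "continuous_on {0..} f" and x: "0 \<le> x"
  shows "(LBINT t:{x<..y}. f t) = integral {x..y} f"
proof -
  have i: "set_integrable lborel {x..y} f"
    unfolding set_integrable_def
    by (rule borel_integrable_compact[OF compact_Icc continuous_on_subset[OF f]]) (use x in auto)
  have "(LBINT t:{x<..y}. f t) = (LBINT t:{x..y}. f t)"
  proof (rule set_integral_cong_set)
    show "set_borel_measurable lborel {x..y} f"
      using i by (auto simp: set_borel_measurable_def set_integrable_def)
    show "set_borel_measurable lborel {x<..y} f"
      using continuous_set_integrable[OF f x] by (auto simp: set_borel_measurable_def set_integrable_def)
    show "AE t in lborel. t \<in> {x..y} \<longleftrightarrow> t \<in> {x<..y}"
      using AE_lborel_singleton[of x] by eventually_elim auto
  qed
  also have "\<dots> = integral {x..y} f" by (rule set_borel_integral_eq_integral(2)[OF i])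
  finally show ?thesis .
qed

lemma half_line_FTC:
  fixes f :: "real \<Rightarrow> 'a :: euclidean_space"
  assumes f: "continuous_on {0..} f" and x: "0 \<le> x"
  shows "((\<lambda>y. LBINT t:{0<..y}. f t) has_vector_derivative f x) (at x within {0..})"
proof -
  have "((\<lambda>y. integral {0..y} f) has_vector_derivative f x) (at x within {0..x+1})"
    using x by (intro integral_has_vector_derivative continuous_on_subset[OF f]) auto
  moreover have "at x within {0..x+1} = at x within {0..}"
    by (rule at_within_nhd[of _ "{..<x+1}"]) auto
  ultimately show ?thesis using f by (simp add: set_integral_Ioc_eq_integral)
qed

lemma set_integral_Ioc_derivative:
  fixes u :: "real \<Rightarrow> 'a :: euclidean_space"
  assumes u: "\<And>x. x \<ge> 0 \<Longrightarrow> (u has_vector_derivative u' x) (at x within {0..})"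
    and c: "continuous_on {0..} u'" and xy: "0 \<le> x" "x \<le> y"
  shows "(LBINT t:{x<..y}. u' t) = u y - u x"
proof -
  have "(u' has_integral (u y - u x)) {x..y}"
    using xy by (intro fundamental_theorem_of_calculus has_vector_derivative_within_subset[OF u]) auto
  then show ?thesis using set_integral_Ioc_eq_integral[OF c xy(1), of y] by (simp add: integral_unique)
qed

text \<open>For test functions with a constant complex direction \<open>c\<close> the direction comes out of the integral,
  so that letting \<open>c\<close> vary yields identities between complex numbers.\<close>

lemma L2_ip_cutoff:
  assumes f: "L2 f" and w: "w \<in> borel_measurable borel" "\<And>x. \<bar>w x\<bar> \<le> W" "\<And>x. x > X \<Longrightarrow> w x = 0"
  shows "L2_ip f (\<lambda>x. c * complex_of_real (w x)) = (LBINT x:{0<..X}. w x *\<^sub>R f x) \<bullet> c"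
proof -
  have i: "set_integrable lborel {0<..X} (\<lambda>x. w x *\<^sub>R f x)"
  proof (rule set_integrable_bound)
    have fi: "set_integrable lborel {0<..X} f" by (rule L2_set_integrable_Ioc[OF f]) simp
    show "set_integrable lborel {0<..X} (\<lambda>x. W *\<^sub>R f x)" using fi by (rule set_integrable_scaleR_right)
    have "(\<lambda>x. w x *\<^sub>R (indicator {0<..X} x *\<^sub>R f x)) \<in> borel_measurable lborel"
      using w(1) by (intro borel_measurable_scaleR[OF _ borel_measurable_integrable[OF fi[unfolded set_integrable_def]]]) simp
    then show "set_borel_measurable lborel {0<..X} (\<lambda>x. w x *\<^sub>R f x)"
      by (simp add: set_borel_measurable_def mult.commute)
    have "W \<ge> 0" using w(2)[of 0] by linarith
    then show "AE x in lborel. x \<in> {0<..X} \<longrightarrow> norm (w x *\<^sub>R f x) \<le> norm (W *\<^sub>R f x)"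
      using w(2) by (auto intro!: mult_right_mono)
  qed
  have eq: "indicator {0<..X} x *\<^sub>R (w x *\<^sub>R f x) = indicator {0<..} x *\<^sub>R (w x *\<^sub>R f x)" for x
    using w(3)[of x] by (cases "x > X") (auto simp: indicator_def)
  have "set_integrable lborel {0<..} (\<lambda>x. w x *\<^sub>R f x)"
    using i unfolding set_integrable_def eq .
  then have "integrable half_line (\<lambda>x. w x *\<^sub>R f x)" by (simp add: set_integrable_eq)
  then have "(\<integral>x. w x *\<^sub>R f x \<partial>half_line) \<bullet> c = (\<integral>x. (w x *\<^sub>R f x) \<bullet> c \<partial>half_line)"
    by (intro integral_inner_left[symmetric])
  also have "\<dots> = L2_ip f (\<lambda>x. c * complex_of_real (w x))"
    unfolding L2_ip_def
    by (intro Bochner_Integration.integral_cong) (auto simp: inner_complex_def algebra_simps)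
  also have "(\<integral>x. w x *\<^sub>R f x \<partial>half_line) = (LBINT x:{0<..X}. w x *\<^sub>R f x)"
    unfolding set_integral_half_line[symmetric] set_lebesgue_integral_def eq ..
  finally show ?thesis ..
qed

text \<open>On \<open>[0, \<infinity>)\<close> this decreases with slope \<open>-1\<close> from \<open>X\<close> to \<open>0\<close>; the inner minimum only keeps it
  bounded at negative arguments.\<close>

definition tent :: "real \<Rightarrow> real \<Rightarrow> real" where
  "tent X x = max 0 (min X (X - x))"

lemma tent_H1:
  assumes X: "X \<ge> 0"
  shows "(\<lambda>x. c * complex_of_real (tent X x)) \<in> H1_half_line"
    and "has_L2_deriv (\<lambda>x. c * complex_of_real (tent X x)) (\<lambda>x. c * complex_of_real (- indicator {0<..X} x))"
proof -
  have L2_bounded: "L2 (\<lambda>x. complex_of_real (w x))"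
    if w: "w \<in> borel_measurable borel" "\<And>x. \<bar>w x\<bar> \<le> W" "\<And>x. x > X \<Longrightarrow> w x = 0" for w W
  proof -
    have wm: "w \<in> borel_measurable half_line" using w(1) by (intro measurable_restrict_space1) simp
    have "integrable half_line (\<lambda>x. (w x)\<^sup>2)"
    proof (rule Bochner_Integration.integrable_bound)
      have "set_integrable lborel {0<..} (\<lambda>x. W\<^sup>2 * indicator {0<..X} x)"
        unfolding set_integrable_def by (intro integrable_mult_indicator integrable_mult_right integrable_real_indicator) (use X in auto)
      then show "integrable half_line (\<lambda>x. W\<^sup>2 * indicator {0<..X} x)" by (simp add: set_integrable_eq)
      show "(\<lambda>x. (w x)\<^sup>2) \<in> borel_measurable half_line" using wm by measurable
      have "(w x)\<^sup>2 \<le> W\<^sup>2" for x using power_mono[OF w(2)[of x], of 2] by simp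
      then show "AE x in half_line. norm ((w x)\<^sup>2) \<le> norm (W\<^sup>2 * indicator {0<..X} x)"
        using w(3) by (intro AE_half_lineI) (auto simp: indicator_def not_le)
    qed
    then show ?thesis using wm by (simp add: L2_def)
  qed
  have "has_L2_deriv (\<lambda>x. complex_of_real (tent X x)) (\<lambda>x. complex_of_real (- indicator {0<..X} x))"
    unfolding has_L2_deriv_iff
  proof (intro conjI allI impI)
    show "L2 (\<lambda>x. complex_of_real (- indicator {0<..X} x))"
      by (rule L2_bounded[where W=1]) (auto simp: indicator_def)
    fix x :: real assume x: "x \<ge> 0"
    have "(LBINT t:{0<..x}. complex_of_real (- indicator {0<..X} t)) = (\<integral>t. indicator {0<..min x X} t *\<^sub>R (-1) \<partial>lborel)"
      unfolding set_lebesgue_integral_def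
      by (intro Bochner_Integration.integral_cong) (auto simp: indicator_def)
    also have "\<dots> = - complex_of_real (min x X)"
      using x X by (simp add: measure_def scaleR_conv_of_real)
    finally show "complex_of_real (tent X x) = complex_of_real (tent X 0) + (LBINT t:{0<..x}. complex_of_real (- indicator {0<..X} t))"
      using x X by (simp add: tent_def min_def max_def)
  qed
  from has_L2_deriv_mult[OF this, of c]
  show d: "has_L2_deriv (\<lambda>x. c * complex_of_real (tent X x)) (\<lambda>x. c * complex_of_real (- indicator {0<..X} x))" .
  have "L2 (\<lambda>x. c * complex_of_real (tent X x))"
    by (rule L2_mult[OF L2_bounded[where W=X]]) (use X in \<open>auto simp: tent_def\<close>)
  then show "(\<lambda>x. c * complex_of_real (tent X x)) \<in> H1_half_line"
    by (intro H1_half_lineI[OF d]) (simp add: L2_def)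
qed

lemma first_variation_single_edge:
  assumes v: "v \<in> H1_graph N" and j: "j < N" and g: "g \<in> H1_half_line"
  shows "first_variation p \<omega> \<beta> N v (\<lambda>i. if i = j then g else (\<lambda>x. 0)) =
    L2_ip (H1_deriv (v j)) (H1_deriv g) + \<omega> * L2_ip (v j) g - L2_ip (\<lambda>x. power_nl p (v j x)) g
     + 1 / \<beta> * ((\<Sum>i<N. v i 0) \<bullet> g 0)"
proof -
  have z: "L2_ip f (\<lambda>x. 0) = 0" for f by (simp add: L2_ip_def)
  have dz: "L2_ip (H1_deriv (v i)) (H1_deriv (\<lambda>x. 0)) = 0" if "i < N" for i
  proof -
    have "v i \<in> H1_half_line" using v that by (simp add: H1_graph_def)
    then have "L2_ip (H1_deriv (v i)) (H1_deriv (\<lambda>x. 0)) = L2_ip (H1_deriv (v i)) (\<lambda>x. 0)"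
      by (intro L2_ip_cong_AE(1) H1_L2 H1_zero L2_zero)
    then show ?thesis by (simp add: z)
  qed
  let ?h = "\<lambda>i. if i = j then g else (\<lambda>x. 0)"
  have "(\<Sum>i<N. L2_ip (H1_deriv (v i)) (H1_deriv (?h i)) + \<omega> * L2_ip (v i) (?h i) - L2_ip (\<lambda>x. power_nl p (v i x)) (?h i))
    = (\<Sum>i<N. if i = j then L2_ip (H1_deriv (v j)) (H1_deriv g) + \<omega> * L2_ip (v j) g - L2_ip (\<lambda>x. power_nl p (v j x)) g else 0)"
    by (intro sum.cong) (auto simp: z dz)
  also have "\<dots> = L2_ip (H1_deriv (v j)) (H1_deriv g) + \<omega> * L2_ip (v j) g - L2_ip (\<lambda>x. power_nl p (v j x)) g"
    using j by simp
  finally have 1: "(\<Sum>i<N. L2_ip (H1_deriv (v i)) (H1_deriv (?h i)) + \<omega> * L2_ip (v i) (?h i) - L2_ip (\<lambda>x. power_nl p (v i x)) (?h i))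
    = L2_ip (H1_deriv (v j)) (H1_deriv g) + \<omega> * L2_ip (v j) g - L2_ip (\<lambda>x. power_nl p (v j x)) g" .
  have "(\<Sum>i<N. ?h i 0) = (\<Sum>i<N. if i = j then g 0 else 0)" by (intro sum.cong) auto
  also have "\<dots> = g 0" using j by simp
  finally show ?thesis unfolding first_variation_def 1 by simp
qed

lemma edge_continuous:
  assumes "v \<in> H1_half_line"
  shows "continuous_on {0..} v"
  by (rule has_L2_deriv_continuous[OF H1_deriv_props[OF assms]])

lemma continuous_on_power_nl_compose:
  assumes "p > 1" "continuous_on {0..} v"
  shows "continuous_on {0..} (\<lambda>x. power_nl p (v x))"
  by (rule continuous_on_compose2[OF continuous_on_power_nl[OF assms(1)] assms(2) subset_UNIV])

definition el_field :: "real \<Rightarrow> real \<Rightarrow> complex \<Rightarrow> complex" where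
  "el_field p \<omega> z = \<omega> *\<^sub>R z - power_nl p z"

text \<open>For the test function \<open>c * tent X\<close> on one edge, the derivative is \<open>-c\<close> on \<open>(0, X]\<close>, which pairs with
  the weak derivative of \<open>v j\<close> to the increment of \<open>v j\<close>. So this is the Euler-Lagrange equation
  integrated twice, obtained without smooth test functions or approximation.\<close>

lemma critical_point_integrated_equation:
  assumes p: "p > 1" and crit: "critical_point p \<omega> \<beta> N v" and j: "j < N" and X: "X \<ge> 0"
  shows "v j X - v j 0 = (LBINT x:{0<..X}. (X - x) *\<^sub>R el_field p \<omega> (v j x)) + (X / \<beta>) *\<^sub>R (\<Sum>i<N. v i 0)"
proof -
  have v: "v \<in> H1_graph N" using crit by (simp add: critical_point_def)
  have vj: "v j \<in> H1_half_line" using v j by (simp add: H1_graph_def)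
  note vL = H1_L2[OF vj]
  have nlL: "L2 (\<lambda>x. power_nl p (v j x))"
    by (rule L2_power_nl[OF p vL(1), of "2 * H1_norm N v"]) (use H1_graph_pointwise_bound[OF v j] in auto)
  let ?nl = "\<lambda>x. power_nl p (v j x)" and ?S = "\<Sum>i<N. v i 0"
  have tentb: "tent X \<in> borel_measurable borel" "\<bar>tent X x\<bar> \<le> X" "x > X \<Longrightarrow> tent X x = 0" for x
    using X by (auto simp: tent_def[abs_def])
  have ind: "(\<lambda>x. - indicator {0<..X} x :: real) \<in> borel_measurable borel" "\<bar>- indicator {0<..X} x :: real\<bar> \<le> 1"
     "x > X \<Longrightarrow> - indicator {0<..X} x = (0::real)" for x
    by (auto simp: indicator_def)
  have tent_int: "(LBINT x:{0<..X}. tent X x *\<^sub>R f x) = (LBINT x:{0<..X}. (X - x) *\<^sub>R f x)" for f :: "real \<Rightarrow> complex"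
    by (intro set_lebesgue_integral_cong) (auto simp: tent_def)
  \<comment> \<open>The first variation in the direction \<open>c * tent X\<close> is the inner product of this number with \<open>c\<close>.\<close>
  let ?V = "- (v j X - v j 0) + \<omega> *\<^sub>R (LBINT x:{0<..X}. (X - x) *\<^sub>R v j x) - (LBINT x:{0<..X}. (X - x) *\<^sub>R ?nl x) + (X / \<beta>) *\<^sub>R ?S"
  have orth: "?V \<bullet> c = 0" for c
  proof -
    let ?g = "\<lambda>x. c * complex_of_real (tent X x)"
    let ?h = "\<lambda>i. if i = j then ?g else (\<lambda>x. 0)"
    note g = tent_H1[OF X, of c]
    have "?h \<in> H1_graph N" using g(1) H1_zero(1) by (simp add: H1_graph_def)
    then have "first_variation p \<omega> \<beta> N v ?h = 0"
      using crit critical_point_iff_first_variation[OF p v] by blast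
    then have eq: "L2_ip (H1_deriv (v j)) (H1_deriv ?g) + \<omega> * L2_ip (v j) ?g - L2_ip ?nl ?g + 1 / \<beta> * (?S \<bullet> ?g 0) = 0"
      unfolding first_variation_single_edge[OF v j g(1)] .
    have "L2_ip (H1_deriv (v j)) (H1_deriv ?g) = L2_ip (H1_deriv (v j)) (\<lambda>x. c * complex_of_real (- indicator {0<..X} x))"
      by (rule L2_ip_cong_AE(1)[OF H1_L2(2)[OF g(1)] has_L2_derivD(1)[OF g(2)] H1_deriv_AE[OF g(2)] vL(2)])
    also have "\<dots> = (LBINT x:{0<..X}. (- indicator {0<..X} x) *\<^sub>R H1_deriv (v j) x) \<bullet> c"
      by (rule L2_ip_cutoff[OF vL(2) ind])
    also have "(LBINT x:{0<..X}. (- indicator {0<..X} x) *\<^sub>R H1_deriv (v j) x) = (LBINT x:{0<..X}. (-1) *\<^sub>R H1_deriv (v j) x)"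
      by (rule set_lebesgue_integral_cong) auto
    also have "\<dots> = - (v j X - v j 0)"
      unfolding set_integral_scaleR_right has_L2_deriv_increment[OF H1_deriv_props[OF vj] order_refl X] by simp
    finally have 1: "L2_ip (H1_deriv (v j)) (H1_deriv ?g) = - (v j X - v j 0) \<bullet> c" .
    have 2: "L2_ip (v j) ?g = (LBINT x:{0<..X}. (X - x) *\<^sub>R v j x) \<bullet> c"
      using L2_ip_cutoff[OF vL(1) tentb, where c=c] by (simp add: tent_int)
    have 3: "L2_ip ?nl ?g = (LBINT x:{0<..X}. (X - x) *\<^sub>R ?nl x) \<bullet> c"
      using L2_ip_cutoff[OF nlL tentb, where c=c] by (simp add: tent_int)
    have "?g 0 = X *\<^sub>R c" using X by (simp add: tent_def scaleR_conv_of_real mult.commute)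
    then have 4: "1 / \<beta> * (?S \<bullet> ?g 0) = (X / \<beta>) * (?S \<bullet> c)" by (simp only: inner_scaleR_right) simp
    show ?thesis
      using eq unfolding 1 2 3 4 by (simp add: inner_add_left inner_diff_left inner_minus_left)
  qed
  have V0: "?V = 0" using orth[of ?V] by (simp only: inner_eq_zero_iff)
  have cont: "continuous_on {0..} (v j)" by (rule edge_continuous[OF vj])
  have "(LBINT x:{0<..X}. (X - x) *\<^sub>R el_field p \<omega> (v j x))
      = (LBINT x:{0<..X}. \<omega> *\<^sub>R ((X - x) *\<^sub>R v j x) - (X - x) *\<^sub>R ?nl x)"
    by (intro set_lebesgue_integral_cong) (auto simp: el_field_def scaleR_diff_right)
  also have "\<dots> = (LBINT x:{0<..X}. \<omega> *\<^sub>R ((X - x) *\<^sub>R v j x)) - (LBINT x:{0<..X}. (X - x) *\<^sub>R ?nl x)"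
    by (intro set_integral_diff continuous_set_integrable)
       (auto intro!: continuous_intros cont continuous_on_power_nl_compose[OF p])
  also have "(LBINT x:{0<..X}. \<omega> *\<^sub>R ((X - x) *\<^sub>R v j x)) = \<omega> *\<^sub>R (LBINT x:{0<..X}. (X - x) *\<^sub>R v j x)"
    by (rule set_integral_scaleR_right)
  finally have E: "(LBINT x:{0<..X}. (X - x) *\<^sub>R el_field p \<omega> (v j x))
      = \<omega> *\<^sub>R (LBINT x:{0<..X}. (X - x) *\<^sub>R v j x) - (LBINT x:{0<..X}. (X - x) *\<^sub>R ?nl x)" .
  have "a = b - c + d" if "- a + b - c + d = 0" for a b c d :: complex
    using that by algebra
  from this[OF V0] show ?thesis unfolding E .
qed

text \<open>The profile \<open>u\<close>, with derivative \<open>u'\<close>, solves \<open>u'' = \<omega> u - \<bar>u\<bar>\<^sup>p\<^sup>-\<^sup>1 u\<close> on \<open>[0, \<infinity>)\<close>, with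
  one-sided derivatives at the vertex.\<close>

definition edge_solution :: "real \<Rightarrow> real \<Rightarrow> (real \<Rightarrow> complex) \<Rightarrow> (real \<Rightarrow> complex) \<Rightarrow> bool" where
  "edge_solution p \<omega> u u' \<longleftrightarrow> (\<forall>x\<ge>0. (u has_vector_derivative u' x) (at x within {0..}) \<and>
     (u' has_vector_derivative el_field p \<omega> (u x)) (at x within {0..}))"

text \<open>The integrated equation shows that \<open>v j\<close> is twice differentiable; its linear term carries the
  vertex condition.\<close>

lemma critical_point_edge_solution:
  assumes p: "p > 1" and crit: "critical_point p \<omega> \<beta> N v" and j: "j < N"
  shows "\<exists>v'. edge_solution p \<omega> (v j) v' \<and> v' 0 = (1 / \<beta>) *\<^sub>R (\<Sum>i<N. v i 0)"
proof -
  have vj: "v j \<in> H1_half_line" using crit j by (simp add: critical_point_def H1_graph_def)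
  let ?F = "\<lambda>x. el_field p \<omega> (v j x)" and ?S = "\<Sum>i<N. v i 0"
  have cont: "continuous_on {0..} (v j)" by (rule edge_continuous[OF vj])
  have F: "continuous_on {0..} ?F"
    unfolding el_field_def by (intro continuous_intros cont continuous_on_power_nl_compose[OF p])
  have xF: "continuous_on {0..} (\<lambda>x. x *\<^sub>R ?F x)" by (intro continuous_intros F)
  let ?I = "\<lambda>X. LBINT x:{0<..X}. ?F x" and ?J = "\<lambda>X. LBINT x:{0<..X}. x *\<^sub>R ?F x"
  define v' where "v' X = ?I X + (1 / \<beta>) *\<^sub>R ?S" for X
  have form: "v j X = v j 0 + (X *\<^sub>R ?I X - ?J X) + X *\<^sub>R ((1 / \<beta>) *\<^sub>R ?S)" if X: "X \<ge> 0" for X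
  proof -
    have "(LBINT x:{0<..X}. (X - x) *\<^sub>R ?F x) = (LBINT x:{0<..X}. X *\<^sub>R ?F x - x *\<^sub>R ?F x)"
      by (simp add: scaleR_diff_left)
    also have "\<dots> = (LBINT x:{0<..X}. X *\<^sub>R ?F x) - ?J X"
      by (intro set_integral_diff continuous_set_integrable xF continuous_intros F) auto
    finally show ?thesis
      using critical_point_integrated_equation[OF p crit j X] by (simp add: algebra_simps)
  qed
  have d: "((\<lambda>X. v j 0 + (X *\<^sub>R ?I X - ?J X) + X *\<^sub>R ((1 / \<beta>) *\<^sub>R ?S)) has_vector_derivative v' x) (at x within {0..})"
    if x: "x \<ge> 0" for x
  proof -
    have "((\<lambda>X. v j 0 + (X *\<^sub>R ?I X - ?J X) + X *\<^sub>R ((1 / \<beta>) *\<^sub>R ?S)) has_vector_derivative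
       0 + ((x *\<^sub>R ?F x + 1 *\<^sub>R ?I x) - x *\<^sub>R ?F x) + (x *\<^sub>R 0 + 1 *\<^sub>R ((1 / \<beta>) *\<^sub>R ?S))) (at x within {0..})"
      by (intro has_vector_derivative_add has_vector_derivative_diff has_vector_derivative_const
          has_vector_derivative_scaleR half_line_FTC[OF F x] half_line_FTC[OF xF x] DERIV_ident)
    then show ?thesis by (simp add: v'_def)
  qed
  have "(v j has_vector_derivative v' x) (at x within {0..})" if x: "x \<ge> 0" for x
    by (rule has_vector_derivative_transform[OF _ form[OF atLeast_iff[THEN iffD1]] d[OF x]]) (simp add: x)
  moreover have "(v' has_vector_derivative ?F x) (at x within {0..})" if x: "x \<ge> 0" for x
    unfolding v'_def using half_line_FTC[OF F x] has_vector_derivative_add[OF half_line_FTC[OF F x] has_vector_derivative_const, of "(1 / \<beta>) *\<^sub>R ?S"] by simp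
  moreover have "v' 0 = (1 / \<beta>) *\<^sub>R ?S" by (simp add: v'_def set_lebesgue_integral_def)
  ultimately show ?thesis unfolding edge_solution_def by blast
qed

section \<open>Solutions of the edge equation\<close>

lemma has_real_derivative_norm_sq:
  fixes f :: "real \<Rightarrow> complex"
  assumes "(f has_vector_derivative f') (at x within S)"
  shows "((\<lambda>x. (cmod (f x))\<^sup>2) has_real_derivative 2 * (f x \<bullet> f')) (at x within S)"
proof -
  have "((\<lambda>x. f x \<bullet> f x) has_vector_derivative f x \<bullet> f' + f' \<bullet> f x) (at x within S)"
    by (rule bounded_bilinear.has_vector_derivative[OF bounded_bilinear_inner assms assms])
  then show ?thesis
    by (simp add: has_real_derivative_iff_has_vector_derivative power2_norm_eq_inner inner_commute)
qed

lemma el_field_lipschitz: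
  assumes "p > 1" "cmod z \<le> M" "cmod w \<le> M"
  shows "cmod (el_field p \<omega> z - el_field p \<omega> w) \<le> (\<bar>\<omega>\<bar> + (p + 1) * M powr (p - 1)) * cmod (z - w)"
proof -
  have "el_field p \<omega> z - el_field p \<omega> w = \<omega> *\<^sub>R (z - w) - (power_nl p z - power_nl p w)"
    by (simp add: el_field_def scaleR_diff_right)
  then have "cmod (el_field p \<omega> z - el_field p \<omega> w) \<le> \<bar>\<omega>\<bar> * cmod (z - w) + cmod (power_nl p z - power_nl p w)"
    by (metis norm_scaleR norm_triangle_ineq4)
  then show ?thesis using power_nl_lipschitz[OF assms] by (simp add: distrib_right)
qed

lemma edge_solution_continuous:
  assumes "edge_solution p \<omega> u u'"
  shows "continuous_on {0..} u" "continuous_on {0..} u'"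
  using assms unfolding edge_solution_def continuous_on_eq_continuous_within
  by (auto intro: has_vector_derivative_continuous)

text \<open>Gronwall's argument for \<open>\<bar>d\<bar>\<^sup>2 + \<bar>d'\<bar>\<^sup>2\<close>, where \<open>d\<close> is the difference of two solutions.\<close>

lemma edge_solution_unique:
  assumes p: "p > 1" and u: "edge_solution p \<omega> u u'" and w: "edge_solution p \<omega> w w'"
    and init: "u 0 = w 0" "u' 0 = w' 0" and X: "X \<ge> 0"
  shows "u X = w X"
proof -
  have "compact (u ` {0..X})" "compact (w ` {0..X})"
    by (intro compact_continuous_image compact_Icc
        continuous_on_subset[OF edge_solution_continuous(1)[OF u]]
        continuous_on_subset[OF edge_solution_continuous(1)[OF w]]; auto)+
  then have "bounded (u ` {0..X} \<union> w ` {0..X})" by (simp add: compact_imp_bounded)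
  then obtain M where M: "\<And>x. x \<in> {0..X} \<Longrightarrow> cmod (u x) \<le> M" "\<And>x. x \<in> {0..X} \<Longrightarrow> cmod (w x) \<le> M"
    unfolding bounded_iff by blast
  define L where "L = \<bar>\<omega>\<bar> + (p + 1) * M powr (p - 1)"
  have L: "L \<ge> 0" using p by (simp add: L_def)
  let ?d = "\<lambda>x. u x - w x" and ?d' = "\<lambda>x. u' x - w' x"
  let ?F = "\<lambda>x. el_field p \<omega> (u x) - el_field p \<omega> (w x)"
  define D where "D x = (cmod (?d x))\<^sup>2 + (cmod (?d' x))\<^sup>2" for x
  \<comment> \<open>The derivative of \<open>D\<close> is at most \<open>(1 + L) D\<close>, so \<open>E\<close> does not increase.\<close>
  define E where "E x = D x * exp (- (1 + L) * x)" for x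
  define E' where "E' x = (2 * (?d x \<bullet> ?d' x) + 2 * (?d' x \<bullet> ?F x) - (1 + L) * D x) * exp (- (1 + L) * x)" for x
  have dE: "(E has_real_derivative E' x) (at x within {0..})" if "x \<ge> 0" for x
  proof -
    have "(?d has_vector_derivative ?d' x) (at x within {0..})"
      "(?d' has_vector_derivative ?F x) (at x within {0..})"
      using u w that by (auto simp: edge_solution_def intro: has_vector_derivative_diff)
    then have "(D has_real_derivative 2 * (?d x \<bullet> ?d' x) + 2 * (?d' x \<bullet> ?F x)) (at x within {0..})"
      unfolding D_def by (intro DERIV_add has_real_derivative_norm_sq)
    moreover have "((\<lambda>x. exp (- (1 + L) * x)) has_real_derivative exp (- (1 + L) * x) * (- (1 + L))) (at x within {0..})"
      by (auto intro!: derivative_eq_intros)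
    ultimately have "((\<lambda>x. D x * exp (- (1 + L) * x)) has_real_derivative
        (2 * (?d x \<bullet> ?d' x) + 2 * (?d' x \<bullet> ?F x)) * exp (- (1 + L) * x)
        + exp (- (1 + L) * x) * (- (1 + L)) * D x) (at x within {0..})"
      by (rule DERIV_mult)
    moreover have "(2 * (?d x \<bullet> ?d' x) + 2 * (?d' x \<bullet> ?F x)) * exp (- (1 + L) * x)
        + exp (- (1 + L) * x) * (- (1 + L)) * D x = E' x"
      unfolding E'_def by (simp add: algebra_simps del: exp_minus_inverse)
    ultimately show ?thesis unfolding E_def[abs_def] by simp
  qed
  have neg: "E' x \<le> 0" if "x \<in> {0..X}" for x
  proof -
    have "2 * (?d x \<bullet> ?d' x) \<le> D x"
      using norm_cauchy_schwarz[of "?d x" "?d' x"] sum_squares_bound[of "cmod (?d x)" "cmod (?d' x)"]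
      unfolding D_def by linarith
    moreover have "2 * (?d' x \<bullet> ?F x) \<le> L * D x"
    proof -
      have "?d' x \<bullet> ?F x \<le> cmod (?d' x) * cmod (?F x)" by (rule norm_cauchy_schwarz)
      also have "\<dots> \<le> cmod (?d' x) * (L * cmod (?d x))"
        unfolding L_def by (intro mult_left_mono el_field_lipschitz[OF p] M that) auto
      finally have "2 * (?d' x \<bullet> ?F x) \<le> L * (2 * cmod (?d x) * cmod (?d' x))" by (simp add: mult_ac)
      also have "\<dots> \<le> L * D x" unfolding D_def by (intro mult_left_mono sum_squares_bound L)
      finally show ?thesis .
    qed
    ultimately have "2 * (?d x \<bullet> ?d' x) + 2 * (?d' x \<bullet> ?F x) - (1 + L) * D x \<le> 0"
      by (simp add: distrib_right)
    then show ?thesis unfolding E'_def by (intro mult_nonpos_nonneg) auto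
  qed
  have "E X \<le> E 0"
  proof (rule DERIV_nonpos_imp_decreasing_open[OF X])
    fix x assume x: "0 < x" "x < X"
    have "at x within {0..} = at x" by (rule at_within_interior) (use x in \<open>simp add: interior_real_atLeast\<close>)
    then show "\<exists>y. (E has_real_derivative y) (at x) \<and> y \<le> 0"
      using dE[of x] neg[of x] x by auto
  next
    have "continuous_on {0..} E"
      unfolding continuous_on_eq_continuous_within using dE by (auto intro: DERIV_continuous)
    then show "continuous_on {0..X} E" by (rule continuous_on_subset) auto
  qed
  also have "E 0 = 0" using init by (simp add: E_def D_def)
  finally have "D X \<le> 0" by (simp add: E_def mult_le_0_iff not_le[symmetric])
  then have "(cmod (?d X))\<^sup>2 \<le> 0" unfolding D_def by (smt (verit) zero_le_power2)
  then show ?thesis by simp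
qed

text \<open>The first integral of the edge equation, as a function of the value and the derivative.\<close>

definition edge_energy :: "real \<Rightarrow> real \<Rightarrow> complex \<Rightarrow> complex \<Rightarrow> real" where
  "edge_energy p \<omega> z z' = (cmod z')\<^sup>2 - \<omega> * (cmod z)\<^sup>2 + 2 / (p + 1) * cmod z powr (p + 1)"

lemma edge_energy_constant:
  assumes p: "p > 1" and u: "edge_solution p \<omega> u u'"
  shows "\<exists>c. \<forall>x\<ge>0. edge_energy p \<omega> (u x) (u' x) = c"
proof -
  have "((\<lambda>x. edge_energy p \<omega> (u x) (u' x)) has_real_derivative 0) (at x within {0..})" if "x \<ge> 0" for x
  proof -
    have d: "(u has_vector_derivative u' x) (at x within {0..})"
      "(u' has_vector_derivative el_field p \<omega> (u x)) (at x within {0..})"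
      using u that by (auto simp: edge_solution_def)
    have "((\<lambda>x. edge_energy p \<omega> (u x) (u' x)) has_real_derivative
        2 * (u' x \<bullet> el_field p \<omega> (u x)) - \<omega> * (2 * (u x \<bullet> u' x)) + 2 / (p + 1) * ((p + 1) * (power_nl p (u x) \<bullet> u' x)))
        (at x within {0..})"
      unfolding edge_energy_def
      by (intro DERIV_add DERIV_diff DERIV_cmult has_real_derivative_norm_sq d
          has_real_derivative_norm_powr[OF p d(1)])
    moreover have cancel: "2 / (p + 1) * ((p + 1) * a) = 2 * a" for a using p by simp
    have "2 * (u' x \<bullet> el_field p \<omega> (u x)) - \<omega> * (2 * (u x \<bullet> u' x)) + 2 / (p + 1) * ((p + 1) * (power_nl p (u x) \<bullet> u' x)) = 0"
      unfolding cancel by (simp add: el_field_def inner_diff_right inner_commute algebra_simps)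
    ultimately show ?thesis by simp
  qed
  then have "\<exists>c. \<forall>x\<in>{0..}. edge_energy p \<omega> (u x) (u' x) = c"
    by (intro has_field_derivative_zero_constant) auto
  then show ?thesis unfolding Ball_def atLeast_iff by blast
qed

lemma integrable_half_line_const:
  assumes "integrable half_line (\<lambda>x. c :: real)"
  shows "c = 0"
proof (rule ccontr)
  assume c: "c \<noteq> 0"
  let ?I = "\<integral>x. \<bar>c\<bar> \<partial>half_line"
  have i: "integrable half_line (\<lambda>x. \<bar>c\<bar>)" using assms by (rule integrable_abs)
  have "real n * \<bar>c\<bar> \<le> ?I" for n
  proof -
    have "real n * \<bar>c\<bar> = (\<integral>x. indicator {0<..real n} x *\<^sub>R \<bar>c\<bar> \<partial>lborel)" by (simp add: measure_def)
    also have "\<dots> \<le> (\<integral>x. indicator {0::real<..} x *\<^sub>R \<bar>c\<bar> \<partial>lborel)"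
    proof (rule Bochner_Integration.integral_mono)
      show "integrable lborel (\<lambda>x. indicator {0<..real n} x *\<^sub>R \<bar>c\<bar>)"
        by (intro integrable_scaleR_left integrable_real_indicator) auto
      show "integrable lborel (\<lambda>x. indicator {0::real<..} x *\<^sub>R \<bar>c\<bar>)"
        using i set_integrable_eq[of "{0::real<..}" lborel "\<lambda>x. \<bar>c\<bar>"] unfolding set_integrable_def by simp
    qed (auto simp: indicator_def)
    also have "\<dots> = ?I" by (rule integral_restrict_space[symmetric]) simp
    finally show ?thesis .
  qed
  moreover obtain n :: nat where "?I / \<bar>c\<bar> < real n" using reals_Archimedean2 by blast
  ultimately show False using c by (simp add: field_simps not_le[symmetric])
qed

text \<open>All three terms of the energy are integrable over the half-line, and only the constant \<open>0\<close> is.\<close>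

lemma edge_energy_zero:
  assumes p: "p > 1" and u: "edge_solution p \<omega> u u'" and H: "u \<in> H1_half_line" and x: "x \<ge> 0"
  shows "edge_energy p \<omega> (u x) (u' x) = 0"
proof -
  obtain c where c: "\<And>x. x \<ge> 0 \<Longrightarrow> edge_energy p \<omega> (u x) (u' x) = c"
    using edge_energy_constant[OF p u] by blast
  note uL = H1_L2[OF H] and cont = edge_solution_continuous[OF u]
  have du: "\<And>x. x \<ge> 0 \<Longrightarrow> (u has_vector_derivative u' x) (at x within {0..})"
    using u by (simp add: edge_solution_def)
  have "AE x in half_line. H1_deriv u x = u' x"
  proof (rule AE_eq_half_lineI)
    show "set_integrable lborel {x<..y} (H1_deriv u)" if "0 \<le> x" for x y
      using that uL(2) by (rule_tac L2_set_integrable_Ioc)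
    show "set_integrable lborel {x<..y} u'" if "0 \<le> x" for x y
      by (rule continuous_set_integrable[OF cont(2) that])
    show "(LBINT t:{x<..y}. H1_deriv u t) = (LBINT t:{x<..y}. u' t)" if "0 \<le> x" "x \<le> y" for x y
      using has_L2_deriv_increment[OF H1_deriv_props[OF H] that] set_integral_Ioc_derivative[OF du cont(2) that] by simp
  qed
  then have u'L: "L2 u'"
    by (rule L2_cong_AE[OF _ uL(2) continuous_measurable_half_line[OF cont(2)]])
  define B where "B = sqrt (2 * (L2_sq (H1_deriv u) + L2_sq u))"
  have B: "cmod (u x) \<le> B" if "x > 0" for x
    using real_le_rsqrt[OF sobolev_half_line[OF H, of x]] that by (simp add: B_def)
  have "integrable half_line (\<lambda>x. edge_energy p \<omega> (u x) (u' x))"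
    unfolding edge_energy_def
    by (intro Bochner_Integration.integrable_add Bochner_Integration.integrable_diff integrable_mult_right
        L2_integrable_sq uL u'L integrable_norm_powr[OF p uL(1) B])
  moreover have "integrable half_line (\<lambda>x. edge_energy p \<omega> (u x) (u' x)) \<longleftrightarrow> integrable half_line (\<lambda>x. c)"
    by (rule Bochner_Integration.integrable_cong) (auto simp: space_restrict_space c)
  ultimately have "integrable half_line (\<lambda>x. c)" by blast
  then have "c = 0" by (rule integrable_half_line_const)
  then show ?thesis using c[OF x] by simp
qed

section \<open>The soliton profile\<close>

definition soliton_rate :: "real \<Rightarrow> real \<Rightarrow> real" where
  "soliton_rate p \<omega> = (p - 1) * sqrt \<omega> / 2"

definition soliton_slope :: "real \<Rightarrow> real \<Rightarrow> real \<Rightarrow> real \<Rightarrow> real" where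
  "soliton_slope p \<omega> a x = - sqrt \<omega> * tanh (soliton_rate p \<omega> * (x + a)) * shifted_soliton p \<omega> a x"

lemma sech_sq: "(sech y)\<^sup>2 = 1 - (tanh y)\<^sup>2"
proof -
  have "1 - (tanh y)\<^sup>2 = ((cosh y)\<^sup>2 - (sinh y)\<^sup>2) / (cosh y)\<^sup>2"
    by (simp add: tanh_def power_divide diff_divide_distrib)
  also have "(cosh y)\<^sup>2 - (sinh y)\<^sup>2 = 1" using cosh_square_eq[of y] by simp
  finally show ?thesis by (simp add: sech_def power_divide)
qed

lemma shifted_soliton_pos:
  assumes "p > 1" "\<omega> > 0"
  shows "shifted_soliton p \<omega> a x > 0"
proof -
  have "cosh (soliton_rate p \<omega> * (x + a)) \<noteq> 0" by simp
  then show ?thesis using assms by (simp add: shifted_soliton_def sech_def)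
qed

lemma shifted_soliton_powr:
  assumes "p > 1" "\<omega> > 0"
  shows "shifted_soliton p \<omega> a x powr p = (p + 1) * \<omega> / 2 * (1 - (tanh (soliton_rate p \<omega> * (x + a)))\<^sup>2) * shifted_soliton p \<omega> a x"
proof -
  let ?B = "(p + 1) * \<omega> / 2 * (sech (soliton_rate p \<omega> * (x + a)))\<^sup>2"
  have B: "?B > 0" using assms by (simp add: sech_def)
  have s: "shifted_soliton p \<omega> a x = ?B powr (1 / (p - 1))"
    by (simp add: shifted_soliton_def soliton_rate_def)
  have "1 / (p - 1) * p = 1 + 1 / (p - 1)" using assms by (simp add: field_simps)
  then have "shifted_soliton p \<omega> a x powr p = ?B powr (1 + 1 / (p - 1))"
    unfolding s powr_powr by simp
  also have "\<dots> = ?B * shifted_soliton p \<omega> a x" using B by (simp add: s powr_add)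
  finally show ?thesis by (simp add: sech_sq)
qed

lemma shifted_soliton_deriv:
  assumes "p > 1" "\<omega> > 0"
  shows "((\<lambda>x. shifted_soliton p \<omega> a x) has_real_derivative soliton_slope p \<omega> a x) (at x)"
proof -
  let ?y = "\<lambda>x. soliton_rate p \<omega> * (x + a)" and ?C = "(p + 1) * \<omega> / 2"
  have C: "?C > 0" using assms by simp
  \<comment> \<open>In this form the chain rule produces the hyperbolic tangent directly.\<close>
  have eq: "shifted_soliton p \<omega> a x = exp (1 / (p - 1) * (ln ?C - 2 * ln (cosh (?y x))))" for x
  proof -
    have c: "cosh (?y x) > 0" by (rule cosh_real_pos)
    have "sech (?y x) > 0" using c by (simp add: sech_def)
    then have "?C * (sech (?y x))\<^sup>2 > 0" using C by (intro mult_pos_pos zero_less_power)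
    then have "?C * (sech (?y x))\<^sup>2 \<noteq> 0" by linarith
    then have "(?C * (sech (?y x))\<^sup>2) powr (1 / (p - 1)) = exp (1 / (p - 1) * ln (?C * (sech (?y x))\<^sup>2))"
      by (simp only: powr_def if_False)
    then have "shifted_soliton p \<omega> a x = exp (1 / (p - 1) * ln (?C * (sech (?y x))\<^sup>2))"
      by (simp only: shifted_soliton_def soliton_rate_def)
    also have "ln (?C * (sech (?y x))\<^sup>2) = ln ?C - 2 * ln (cosh (?y x))"
    proof -
      have "ln (b * (1 / k)\<^sup>2) = ln b - 2 * ln k" if "b > 0" "k > 0" for b k :: real
        using that by (simp add: power_divide ln_div ln_realpow)
      from this[OF C c] show ?thesis unfolding sech_def .
    qed
    finally show ?thesis .
  qed
  have der: "((\<lambda>x. exp (1 / (p - 1) * (ln ?C - 2 * ln (cosh (?y x))))) has_real_derivative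
      exp (1 / (p - 1) * (ln ?C - 2 * ln (cosh (?y x)))) * (1 / (p - 1) * (- 2 * (sinh (?y x) * soliton_rate p \<omega> / cosh (?y x))))) (at x)"
    using cosh_real_pos[of "?y x"] assms
    by (auto intro!: derivative_eq_intros simp: mult_ac)
  have slope: "1 / (p - 1) * (- 2 * (sinh (?y x) * soliton_rate p \<omega> / cosh (?y x))) = - sqrt \<omega> * tanh (?y x)"
    using assms by (simp add: tanh_def soliton_rate_def)
  show ?thesis
    using der unfolding slope eq[symmetric] soliton_slope_def by (simp only: mult.commute)
qed

lemma soliton_slope_deriv:
  assumes "p > 1" "\<omega> > 0"
  shows "((\<lambda>x. soliton_slope p \<omega> a x) has_real_derivative
    \<omega> * shifted_soliton p \<omega> a x - shifted_soliton p \<omega> a x powr p) (at x)"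
proof -
  let ?T = "\<lambda>x. tanh (soliton_rate p \<omega> * (x + a))" and ?s = "shifted_soliton p \<omega> a"
  have t: "(?T has_real_derivative (1 - (?T x)\<^sup>2) * soliton_rate p \<omega>) (at x)"
    by (auto intro!: derivative_eq_intros)
  have "((\<lambda>x. (- sqrt \<omega> * ?T x) * ?s x) has_real_derivative
      (- sqrt \<omega> * ((1 - (?T x)\<^sup>2) * soliton_rate p \<omega>)) * ?s x + soliton_slope p \<omega> a x * (- sqrt \<omega> * ?T x)) (at x)"
    by (intro DERIV_mult DERIV_cmult t shifted_soliton_deriv assms)
  moreover have "(- sqrt \<omega> * ((1 - (?T x)\<^sup>2) * soliton_rate p \<omega>)) * ?s x + soliton_slope p \<omega> a x * (- sqrt \<omega> * ?T x)
     = \<omega> * ?s x - ?s x powr p"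
  proof -
    have "(- r * ((1 - T\<^sup>2) * ((p - 1) * r / 2))) * s + (- r * T * s) * (- r * T)
      = (r * r) * s - (p + 1) * (r * r) / 2 * (1 - T\<^sup>2) * s" for r T s
      by (simp add: field_simps power2_eq_square)
    from this[of "sqrt \<omega>"] have "(- sqrt \<omega> * ((1 - T\<^sup>2) * soliton_rate p \<omega>)) * s + (- sqrt \<omega> * T * s) * (- sqrt \<omega> * T)
      = \<omega> * s - (p + 1) * \<omega> / 2 * (1 - T\<^sup>2) * s" for T s
      unfolding soliton_rate_def using assms by simp
    then show ?thesis unfolding soliton_slope_def shifted_soliton_powr[OF assms] .
  qed
  ultimately show ?thesis unfolding soliton_slope_def by simp
qed

text \<open>The rate \<open>sqrt \<omega>\<close> comes from \<open>sech y \<le> 2 exp (- y)\<close>, since \<open>2 / (p - 1)\<close> times the rescaling factor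
  is \<open>sqrt \<omega>\<close>.\<close>

lemma shifted_soliton_decay:
  assumes p: "p > 1" and \<omega>: "\<omega> > 0"
  shows "\<exists>K\<ge>0. \<forall>x. shifted_soliton p \<omega> a x \<le> K * exp (- sqrt \<omega> * x)"
proof -
  let ?C = "(p + 1) * \<omega> / 2" and ?q = "1 / (p - 1)"
  let ?K = "(4 * ?C) powr ?q * exp (- sqrt \<omega> * a)"
  have "shifted_soliton p \<omega> a x \<le> ?K * exp (- sqrt \<omega> * x)" for x
  proof -
    let ?y = "soliton_rate p \<omega> * (x + a)"
    have sech_le: "sech y \<le> 2 * exp (- y)" for y :: real
    proof -
      have "exp (- y) * exp y \<le> exp (- y) * (2 * cosh y)"
        by (intro mult_left_mono) (simp_all add: cosh_field_def)
      then have "1 \<le> 2 * exp (- y) * cosh y" by (simp add: mult_ac flip: exp_add)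
      then show ?thesis using cosh_real_pos[of y] by (simp add: sech_def pos_divide_le_eq)
    qed
    have "(sech ?y)\<^sup>2 \<le> (2 * exp (- ?y))\<^sup>2"
      by (intro power_mono sech_le) (simp_all add: sech_def less_imp_le[OF cosh_real_pos])
    then have "?C * (sech ?y)\<^sup>2 \<le> ?C * (2 * exp (- ?y))\<^sup>2"
      using p \<omega> by (intro mult_left_mono) auto
    also have "\<dots> = 4 * ?C * exp (- 2 * ?y)"
      by (simp add: power_mult_distrib exp_double[symmetric])
    finally have le: "?C * (sech ?y)\<^sup>2 \<le> 4 * ?C * exp (- 2 * ?y)" .
    have "(?C * (sech ?y)\<^sup>2) powr ?q \<le> (4 * ?C * exp (- 2 * ?y)) powr ?q"
      by (rule powr_mono2[OF _ _ le]) (use p \<omega> in auto)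
    also have "\<dots> = (4 * ?C) powr ?q * exp (- 2 * ?y) powr ?q" using p \<omega> by (intro powr_mult)
    also have "exp (- 2 * ?y) powr ?q = exp (- sqrt \<omega> * a) * exp (- sqrt \<omega> * x)"
      using p by (simp add: powr_def soliton_rate_def exp_add[symmetric] field_simps)
    finally show ?thesis by (simp add: shifted_soliton_def soliton_rate_def mult_ac)
  qed
  then show ?thesis by (intro exI[of _ ?K]) auto
qed

lemma integrable_half_line_exp:
  assumes "c > 0"
  shows "integrable half_line (\<lambda>x. exp (- c * x))"
proof -
  have "(\<lambda>x. exp (- c * x)) absolutely_integrable_on {0..}"
    by (intro nonnegative_absolutely_integrable_1 integrable_on_exp_minus_to_infinity assms) auto
  then have "integrable lborel (\<lambda>x. indicator {0..} x *\<^sub>R exp (- c * x))"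
    unfolding set_integrable_def by (subst (asm) integrable_completion) auto
  then have "set_integrable lborel {0..} (\<lambda>x. exp (- c * x))" by (simp add: set_integrable_def)
  then have "set_integrable lborel {0<..} (\<lambda>x. exp (- c * x))" by (rule set_integrable_subset) auto
  then show ?thesis by (simp add: set_integrable_eq)
qed

lemma L2_exp_decay:
  assumes m: "f \<in> borel_measurable half_line" and c: "c > 0" and f: "\<And>x. x > 0 \<Longrightarrow> cmod (f x) \<le> K * exp (- c * x)"
  shows "L2 f"
proof -
  have "integrable half_line (\<lambda>x. (cmod (f x))\<^sup>2)"
  proof (rule Bochner_Integration.integrable_bound)
    show "integrable half_line (\<lambda>x. K\<^sup>2 * exp (- (2 * c) * x))"
      using integrable_half_line_exp[of "2 * c"] c by (intro integrable_mult_right) auto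
    show "(\<lambda>x. (cmod (f x))\<^sup>2) \<in> borel_measurable half_line" using m by measurable
    show "AE x in half_line. norm ((cmod (f x))\<^sup>2) \<le> norm (K\<^sup>2 * exp (- (2 * c) * x))"
    proof (rule AE_half_lineI)
      fix x :: real assume "x > 0"
      then have "(cmod (f x))\<^sup>2 \<le> (K * exp (- c * x))\<^sup>2" by (intro power_mono f) auto
      also have "\<dots> = K\<^sup>2 * exp (- (2 * c) * x)"
        by (simp add: power_mult_distrib power2_eq_square[of "exp _"] mult_exp_exp)
      finally show "norm ((cmod (f x))\<^sup>2) \<le> norm (K\<^sup>2 * exp (- (2 * c) * x))" by simp
    qed
  qed
  then show ?thesis using m by (simp add: L2_def)
qed

lemma power_nl_rotated:
  assumes "p > 1" "s > 0"
  shows "power_nl p (cis \<theta> * of_real s) = cis \<theta> * of_real (s powr p)"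
  using assms by (simp add: power_nl_def norm_mult powr_diff)

lemma soliton_edge_solution:
  assumes "p > 1" "\<omega> > 0"
  shows "edge_solution p \<omega> (\<lambda>x. cis \<theta> * of_real (shifted_soliton p \<omega> a x)) (\<lambda>x. cis \<theta> * of_real (soliton_slope p \<omega> a x))"
proof -
  have lift: "((\<lambda>x. cis \<theta> * complex_of_real (f x)) has_vector_derivative cis \<theta> * of_real f') (at x within {0..})"
    if "(f has_real_derivative f') (at x)" for f f' x
    using has_vector_derivative_mult_right[OF has_vector_derivative_of_real[OF that[THEN DERIV_subset, of "{0..}"]], of "cis \<theta>"] by simp
  show ?thesis
    unfolding edge_solution_def
  proof (intro allI impI conjI)
    fix x :: real
    show "((\<lambda>x. cis \<theta> * of_real (shifted_soliton p \<omega> a x)) has_vector_derivative cis \<theta> * of_real (soliton_slope p \<omega> a x)) (at x within {0..})"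
      by (rule lift[OF shifted_soliton_deriv[OF assms]])
    have "el_field p \<omega> (cis \<theta> * of_real (shifted_soliton p \<omega> a x))
        = cis \<theta> * of_real (\<omega> * shifted_soliton p \<omega> a x - shifted_soliton p \<omega> a x powr p)"
      by (simp add: el_field_def power_nl_rotated[OF assms(1) shifted_soliton_pos[OF assms]] scaleR_conv_of_real algebra_simps)
    then show "((\<lambda>x. cis \<theta> * of_real (soliton_slope p \<omega> a x)) has_vector_derivative
        el_field p \<omega> (cis \<theta> * of_real (shifted_soliton p \<omega> a x))) (at x within {0..})"
      using lift[OF soliton_slope_deriv[OF assms], of a x] by simp
  qed
qed

lemma soliton_slope_bound:
  assumes "p > 1" "\<omega> > 0"
  shows "\<bar>soliton_slope p \<omega> a x\<bar> \<le> sqrt \<omega> * shifted_soliton p \<omega> a x"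
proof -
  have "\<bar>tanh (soliton_rate p \<omega> * (x + a))\<bar> \<le> 1"
    using tanh_real_lt_1 tanh_real_gt_neg1 by (simp add: abs_le_iff less_imp_le minus_le_iff)
  then show ?thesis
    using shifted_soliton_pos[OF assms, of a x] assms
    by (simp add: soliton_slope_def abs_mult mult_left_le_one_le mult_left_mono mult_right_mono)
qed

lemma edge_solution_L2_deriv:
  assumes u: "edge_solution p \<omega> u u'" and "L2 u'"
  shows "has_L2_deriv u u'"
  unfolding has_L2_deriv_iff
proof (intro conjI allI impI assms(2))
  fix x :: real assume "x \<ge> 0"
  then have "(LBINT t:{0<..x}. u' t) = u x - u 0"
    using u by (intro set_integral_Ioc_derivative edge_solution_continuous(2)[OF u]) (auto simp: edge_solution_def)
  then show "u x = u 0 + (LBINT t:{0<..x}. u' t)" by simp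
qed

lemma soliton_H1:
  assumes p: "p > 1" and \<omega>: "\<omega> > 0"
  defines "u \<equiv> (\<lambda>a \<theta> x. cis \<theta> * complex_of_real (shifted_soliton p \<omega> a x))"
    and "u' \<equiv> (\<lambda>a \<theta> x. cis \<theta> * complex_of_real (soliton_slope p \<omega> a x))"
  shows "u a \<theta> \<in> H1_half_line" "L2 (u' a \<theta>)" "has_L2_deriv (u a \<theta>) (u' a \<theta>)" "(u' a \<theta> \<longlongrightarrow> 0) at_top"
proof -
  have sol: "edge_solution p \<omega> (u a \<theta>) (u' a \<theta>)"
    unfolding u_def u'_def by (rule soliton_edge_solution[OF p \<omega>])
  obtain K where K: "K \<ge> 0" "\<And>x. shifted_soliton p \<omega> a x \<le> K * exp (- sqrt \<omega> * x)"
    using shifted_soliton_decay[OF p \<omega>] by blast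
  have b: "cmod (u a \<theta> x) \<le> K * exp (- sqrt \<omega> * x)" for x
    using K(2)[of x] shifted_soliton_pos[OF p \<omega>, of a x] by (simp add: u_def norm_mult)
  have b': "cmod (u' a \<theta> x) \<le> (sqrt \<omega> * K) * exp (- sqrt \<omega> * x)" for x
  proof -
    have "sqrt \<omega> * shifted_soliton p \<omega> a x \<le> sqrt \<omega> * (K * exp (- sqrt \<omega> * x))"
      using \<omega> by (intro mult_left_mono K(2)) auto
    then show ?thesis
      using soliton_slope_bound[OF p \<omega>, of a x] by (simp add: u'_def norm_mult mult.assoc)
  qed
  have "sqrt \<omega> > 0" using \<omega> by simp
  have uL: "L2 (u a \<theta>)"
    by (rule L2_exp_decay[OF continuous_measurable_half_line[OF edge_solution_continuous(1)[OF sol]] \<open>sqrt \<omega> > 0\<close> b])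
  show u'L: "L2 (u' a \<theta>)"
    by (rule L2_exp_decay[OF continuous_measurable_half_line[OF edge_solution_continuous(2)[OF sol]] \<open>sqrt \<omega> > 0\<close> b'])
  show d: "has_L2_deriv (u a \<theta>) (u' a \<theta>)" by (rule edge_solution_L2_deriv[OF sol u'L])
  show "u a \<theta> \<in> H1_half_line" using uL by (intro H1_half_lineI[OF d]) (simp add: L2_def)
  have "LIM x at_top. sqrt \<omega> * x :> at_top"
    using \<open>sqrt \<omega> > 0\<close> by (intro filterlim_tendsto_pos_mult_at_top[OF tendsto_const]) (auto intro: filterlim_ident)
  then have "((\<lambda>x. exp (- (sqrt \<omega> * x))) \<longlongrightarrow> 0) at_top"
    by (intro filterlim_compose[OF exp_at_bot] filterlim_compose[OF filterlim_uminus_at_bot_at_top])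
  then have "((\<lambda>x. (sqrt \<omega> * K) * exp (- sqrt \<omega> * x)) \<longlongrightarrow> 0) at_top"
    using tendsto_mult_right_zero by simp
  then show "(u' a \<theta> \<longlongrightarrow> 0) at_top"
    by (rule Lim_null_comparison[rotated]) (intro always_eventually allI b')
qed

section \<open>Integration by parts\<close>

text \<open>The function \<open>h\<close> need not be differentiable at any given point, so the product rule is replaced by
  Fubini's theorem for \<open>g x \<bullet> U' y\<close> on the triangle \<open>0 < x \<le> y \<le> X\<close>.\<close>

lemma integration_by_parts_interval:
  fixes U U' :: "real \<Rightarrow> complex"
  assumes U: "\<And>x. x \<ge> 0 \<Longrightarrow> (U has_vector_derivative U' x) (at x within {0..})" "continuous_on {0..} U'"
    and h: "has_L2_deriv h g" and X: "X \<ge> 0"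
  shows "(LBINT x:{0<..X}. U x \<bullet> g x) = U X \<bullet> h X - U 0 \<bullet> h 0 - (LBINT x:{0<..X}. U' x \<bullet> h x)"
proof -
  define G where "G x = indicator {0<..X} x *\<^sub>R g x" for x
  define V where "V x = indicator {0<..X} x *\<^sub>R U' x" for x
  have cU: "continuous_on {0..} U"
    unfolding continuous_on_eq_continuous_within using U(1) by (auto intro: has_vector_derivative_continuous)
  have ch: "continuous_on {0..} h" by (rule has_L2_deriv_continuous[OF h])
  have gi: "set_integrable lborel {0<..X} g" by (rule L2_set_integrable_Ioc[OF has_L2_derivD(1)[OF h]]) simp
  have U'i: "set_integrable lborel {0<..X} U'" by (rule continuous_set_integrable[OF U(2)]) simp
  have Gi: "integrable lborel G" using gi by (simp add: G_def[abs_def] set_integrable_def)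
  have Vi: "integrable lborel V" using U'i by (simp add: V_def[abs_def] set_integrable_def)
  have [measurable]: "G \<in> borel_measurable borel" "V \<in> borel_measurable borel" using Gi Vi by auto
  define f where "f x y = (if x \<le> y then G x \<bullet> V y else 0)" for x y
  have fi: "integrable (lborel \<Otimes>\<^sub>M lborel) (\<lambda>(x, y). f x y)"
  proof (rule Bochner_Integration.integrable_bound)
    show "integrable (lborel \<Otimes>\<^sub>M lborel) (\<lambda>(x, y). cmod (G x) * cmod (V y))"
    proof (rule lborel_pair.Fubini_integrable)
      show "integrable lborel (\<lambda>x. \<integral>y. norm (case (x, y) of (x, y) \<Rightarrow> cmod (G x) * cmod (V y)) \<partial>lborel)"
        using Gi by simp
      show "AE x in lborel. integrable lborel (\<lambda>y. case (x, y) of (x, y) \<Rightarrow> cmod (G x) * cmod (V y))"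
        using Vi by simp
    qed measurable
    show "(\<lambda>(x, y). f x y) \<in> borel_measurable (lborel \<Otimes>\<^sub>M lborel)" unfolding f_def by measurable
    show "AE z in lborel \<Otimes>\<^sub>M lborel. norm (case z of (x, y) \<Rightarrow> f x y) \<le> norm (case z of (x, y) \<Rightarrow> cmod (G x) * cmod (V y))"
      by (auto simp: f_def Cauchy_Schwarz_ineq2)
  qed
  have inner_y: "(\<integral>y. f x y \<partial>lborel) = indicator {0<..X} x *\<^sub>R (g x \<bullet> (U X - U x))" for x
  proof (cases "x \<in> {0<..X}")
    case True
    have "(\<integral>y. f x y \<partial>lborel) = (\<integral>y. G x \<bullet> (indicator {x<..X} y *\<^sub>R U' y) \<partial>lborel)"
    proof (rule integral_cong_AE)
      show "AE y in lborel. f x y = G x \<bullet> (indicator {x<..X} y *\<^sub>R U' y)"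
        using AE_lborel_singleton[of x] by eventually_elim (use True in \<open>auto simp: f_def V_def indicator_def\<close>)
      show "f x \<in> borel_measurable lborel" unfolding f_def[abs_def] by measurable
      have "set_integrable lborel {x<..X} U'" by (rule continuous_set_integrable[OF U(2)]) (use True in auto)
      then show "(\<lambda>y. G x \<bullet> (indicator {x<..X} y *\<^sub>R U' y)) \<in> borel_measurable lborel"
        unfolding set_integrable_def
        by (intro borel_measurable_inner borel_measurable_const borel_measurable_integrable)
    qed
    also have "\<dots> = G x \<bullet> (LBINT y:{x<..X}. U' y)"
      unfolding set_lebesgue_integral_def
      using continuous_set_integrable[OF U(2), of x X] True
      by (intro integral_inner_right[where c="G x" and f="\<lambda>y. indicator {x<..X} y *\<^sub>R U' y"]) (auto simp: set_integrable_def)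
    also have "(LBINT y:{x<..X}. U' y) = U X - U x"
      using True by (intro set_integral_Ioc_derivative U) auto
    finally show ?thesis using True by (simp add: G_def)
  next
    case False
    then have "f x y = 0" for y by (auto simp: f_def G_def)
    then show ?thesis using False by simp
  qed
  have inner_x: "(\<integral>x. f x y \<partial>lborel) = indicator {0<..X} y *\<^sub>R ((h y - h 0) \<bullet> U' y)" for y
  proof (cases "y \<in> {0<..X}")
    case True
    have "f x y = (indicator {0<..y} x *\<^sub>R g x) \<bullet> V y" for x
      using True by (auto simp: f_def G_def indicator_def)
    then have "(\<integral>x. f x y \<partial>lborel) = (\<integral>x. (indicator {0<..y} x *\<^sub>R g x) \<bullet> V y \<partial>lborel)" by simp
    also have "\<dots> = (LBINT x:{0<..y}. g x) \<bullet> V y"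
      unfolding set_lebesgue_integral_def
      using L2_set_integrable_Ioc[OF has_L2_derivD(1)[OF h], of 0 y]
      by (intro integral_inner_left[where c="V y" and f="\<lambda>x. indicator {0<..y} x *\<^sub>R g x"]) (auto simp: set_integrable_def)
    also have "(LBINT x:{0<..y}. g x) = h y - h 0"
      using has_L2_deriv_increment[OF h, of 0 y] True by simp
    finally show ?thesis using True by (simp add: V_def)
  next
    case False
    then have "f x y = 0" for x by (auto simp: f_def V_def)
    then show ?thesis using False by simp
  qed
  have "(LBINT y:{0<..X}. (h y - h 0) \<bullet> U' y) = (LBINT x:{0<..X}. g x \<bullet> (U X - U x))"
    using lborel_pair.Fubini_integral[of f] fi
    unfolding inner_x inner_y set_lebesgue_integral_def by simp
  moreover have "(LBINT y:{0<..X}. (h y - h 0) \<bullet> U' y) = (LBINT y:{0<..X}. U' y \<bullet> h y) - (U X - U 0) \<bullet> h 0"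
  proof -
    have "(LBINT y:{0<..X}. (h y - h 0) \<bullet> U' y) = (LBINT y:{0<..X}. U' y \<bullet> h y - U' y \<bullet> h 0)"
      by (simp only: inner_diff_left inner_commute[of "U' _"])
    also have "\<dots> = (LBINT y:{0<..X}. U' y \<bullet> h y) - (LBINT y:{0<..X}. U' y \<bullet> h 0)"
      by (intro set_integral_diff continuous_set_integrable continuous_on_inner ch U(2) continuous_on_const) auto
    also have "(LBINT y:{0<..X}. U' y \<bullet> h 0) = (LBINT y:{0<..X}. U' y) \<bullet> h 0"
      using U'i unfolding set_lebesgue_integral_def set_integrable_def
      by (subst integral_inner_left[where c="h 0" and M=lborel and f="\<lambda>x. indicator {0<..X} x *\<^sub>R U' x", symmetric]) auto
    also have "(LBINT y:{0<..X}. U' y) = U X - U 0"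
      using X by (intro set_integral_Ioc_derivative U) auto
    finally show ?thesis .
  qed
  moreover have "(LBINT x:{0<..X}. g x \<bullet> (U X - U x)) = U X \<bullet> (h X - h 0) - (LBINT x:{0<..X}. U x \<bullet> g x)"
  proof -
    have Ug: "set_integrable lborel {0<..X} (\<lambda>x. U x \<bullet> g x)"
    proof -
      have "bounded (U ` {0..X})"
        by (intro compact_imp_bounded compact_continuous_image continuous_on_subset[OF cU]) auto
      then obtain M where M: "\<And>x. x \<in> {0..X} \<Longrightarrow> cmod (U x) \<le> M" unfolding bounded_iff by blast
      have Um: "(\<lambda>x. indicator {0<..X} x *\<^sub>R U x) \<in> borel_measurable lborel"
        using continuous_set_integrable[OF cU, of 0 X] by (auto simp: set_integrable_def)
      have eq: "indicator {0<..X} x *\<^sub>R (U x \<bullet> g x) = (indicator {0<..X} x *\<^sub>R U x) \<bullet> G x" for x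
        by (simp add: G_def indicator_def)
      show ?thesis unfolding set_integrable_def eq
      proof (rule Bochner_Integration.integrable_bound)
        show "integrable lborel (\<lambda>x. M * norm (G x))" using Gi by simp
        show "(\<lambda>x. (indicator {0<..X} x *\<^sub>R U x) \<bullet> G x) \<in> borel_measurable lborel"
          using Um Gi by (intro borel_measurable_inner) auto
        have "\<bar>(indicator {0<..X} x *\<^sub>R U x) \<bullet> G x\<bar> \<le> M * norm (G x)" for x
        proof (cases "x \<in> {0<..X}")
          case True
          have "\<bar>U x \<bullet> G x\<bar> \<le> cmod (U x) * norm (G x)" by (rule Cauchy_Schwarz_ineq2)
          also have "\<dots> \<le> M * norm (G x)" using M[of x] True by (intro mult_right_mono) auto
          finally show ?thesis using True by simp
        qed (simp add: G_def)
        then show "AE x in lborel. norm ((indicator {0<..X} x *\<^sub>R U x) \<bullet> G x) \<le> norm (M * norm (G x))"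
          by (intro always_eventually allI) (metis abs_ge_self order_trans real_norm_def)
      qed
    qed
    have Xg: "set_integrable lborel {0<..X} (\<lambda>x. U X \<bullet> g x)"
      using integrable_inner_right[of "U X" lborel G] Gi by (simp add: set_integrable_def G_def)
    have "(LBINT x:{0<..X}. g x \<bullet> (U X - U x)) = (LBINT x:{0<..X}. U X \<bullet> g x - U x \<bullet> g x)"
      by (simp only: inner_diff_right inner_commute[of "g _"])
    also have "\<dots> = (LBINT x:{0<..X}. U X \<bullet> g x) - (LBINT x:{0<..X}. U x \<bullet> g x)"
      by (rule set_integral_diff(2)[OF Xg Ug])
    also have "(LBINT x:{0<..X}. U X \<bullet> g x) = U X \<bullet> (LBINT x:{0<..X}. g x)"
      using gi unfolding set_lebesgue_integral_def set_integrable_def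
      by (subst integral_inner_right[where c="U X" and M=lborel and f="\<lambda>x. indicator {0<..X} x *\<^sub>R g x", symmetric]) auto
    also have "(LBINT x:{0<..X}. g x) = h X - h 0"
      using has_L2_deriv_increment[OF h order_refl X] by simp
    finally show ?thesis .
  qed
  ultimately show ?thesis by (simp add: inner_diff_left inner_diff_right)
qed

lemma set_integral_Ioc_tendsto:
  fixes f :: "real \<Rightarrow> real"
  assumes "integrable half_line f"
  shows "(\<lambda>n. LBINT x:{0<..real n}. f x) \<longlonglongrightarrow> (\<integral>x. f x \<partial>half_line)"
  unfolding set_integral_half_line[symmetric] set_lebesgue_integral_def
proof (rule integral_dominated_convergence)
  have i: "integrable lborel (\<lambda>x. indicator {0<..} x *\<^sub>R f x)"
    using assms set_integrable_eq[of "{0::real<..}" lborel f] unfolding set_integrable_def by simp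
  show "integrable lborel (\<lambda>x. norm (indicator {0<..} x *\<^sub>R f x))" by (rule integrable_norm[OF i])
  show "(\<lambda>x. indicator {0<..} x *\<^sub>R f x) \<in> borel_measurable lborel" using i by (rule borel_measurable_integrable)
  have "set_integrable lborel {0<..real n} f" for n
    by (rule set_integrable_subset[of _ "{0<..}"]) (use i in \<open>auto simp: set_integrable_def\<close>)
  then show "(\<lambda>x. indicator {0<..real n} x *\<^sub>R f x) \<in> borel_measurable lborel" for n
    unfolding set_integrable_def by (rule borel_measurable_integrable)
  show "AE x in lborel. norm (indicator {0<..real n} x *\<^sub>R f x) \<le> norm (indicator {0<..} x *\<^sub>R f x)" for n
    by (auto simp: indicator_def)
  show "AE x in lborel. (\<lambda>n. indicator {0<..real n} x *\<^sub>R f x) \<longlonglongrightarrow> indicator {0<..} x *\<^sub>R f x"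
  proof (intro always_eventually allI)
    fix x :: real
    obtain m :: nat where m: "x \<le> real m" using real_arch_simple by blast
    have "\<forall>\<^sub>F n in sequentially. indicator {0<..real n} x *\<^sub>R f x = indicator {0<..} x *\<^sub>R f x"
      using eventually_ge_at_top[of m] by eventually_elim (use m in \<open>auto simp: indicator_def\<close>)
    then show "(\<lambda>n. indicator {0<..real n} x *\<^sub>R f x) \<longlonglongrightarrow> indicator {0<..} x *\<^sub>R f x"
      by (rule tendsto_eventually)
  qed
qed

text \<open>The boundary term at infinity vanishes because \<open>h\<close> is bounded and \<open>U\<close> tends to \<open>0\<close>.\<close>

lemma integration_by_parts_half_line:
  fixes U U' :: "real \<Rightarrow> complex"
  assumes U: "\<And>x. x \<ge> 0 \<Longrightarrow> (U has_vector_derivative U' x) (at x within {0..})" "continuous_on {0..} U'"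
    and L: "L2 U" "L2 U'" and lim: "(U \<longlongrightarrow> 0) at_top" and h: "h \<in> H1_half_line"
  shows "L2_ip U (H1_deriv h) = - (U 0 \<bullet> h 0) - L2_ip U' h"
proof -
  note hd = H1_deriv_props[OF h] and hL = H1_L2[OF h]
  define B where "B = sqrt (2 * (L2_sq (H1_deriv h) + L2_sq h))"
  have B: "cmod (h x) \<le> B" if "x \<ge> 0" for x
    using real_le_rsqrt[OF sobolev_half_line[OF h that]] by (simp add: B_def)
  have "(\<lambda>n. U (real n) \<bullet> h (real n)) \<longlonglongrightarrow> 0"
  proof (rule Lim_null_comparison)
    have "(\<lambda>n. U (real n)) \<longlonglongrightarrow> 0"
      by (rule filterlim_compose[OF lim filterlim_real_sequentially])
    then show "(\<lambda>n. cmod (U (real n)) * B) \<longlonglongrightarrow> 0"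
      using tendsto_mult_left_zero tendsto_norm_zero by blast
    show "\<forall>\<^sub>F n in sequentially. norm (U (real n) \<bullet> h (real n)) \<le> cmod (U (real n)) * B"
    proof (intro always_eventually allI)
      fix n
      have "\<bar>U (real n) \<bullet> h (real n)\<bar> \<le> cmod (U (real n)) * cmod (h (real n))" by (rule Cauchy_Schwarz_ineq2)
      also have "\<dots> \<le> cmod (U (real n)) * B" by (intro mult_left_mono B) auto
      finally show "norm (U (real n) \<bullet> h (real n)) \<le> cmod (U (real n)) * B" by simp
    qed
  qed
  then have "(\<lambda>n. U (real n) \<bullet> h (real n) - U 0 \<bullet> h 0 - (LBINT x:{0<..real n}. U' x \<bullet> h x))
      \<longlonglongrightarrow> 0 - U 0 \<bullet> h 0 - L2_ip U' h"
    unfolding L2_ip_def by (intro tendsto_diff tendsto_const set_integral_Ioc_tendsto L2_integrable_ip L(2) hL(1))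
  moreover have "(\<lambda>n. LBINT x:{0<..real n}. U x \<bullet> H1_deriv h x) \<longlonglongrightarrow> L2_ip U (H1_deriv h)"
    unfolding L2_ip_def by (intro set_integral_Ioc_tendsto L2_integrable_ip L(1) hL(2))
  ultimately show ?thesis
    using integration_by_parts_interval[OF U hd] LIMSEQ_unique by (simp add: LIMSEQ_unique)
qed

section \<open>The system for the two shift parameters\<close>

definition level :: "real \<Rightarrow> real \<Rightarrow> real" where
  "level p t = t powr (p - 1) - t powr (p + 1)"

text \<open>The curve \<open>level p a = level p b\<close> with \<open>a < b\<close> is parametrised by \<open>s = ln (b / a)\<close>, because for given
  \<open>b / a\<close> its equation is linear in \<open>b\<^sup>2\<close>: the solution is \<open>b\<^sup>2 = 1 / level_ratio p s\<close>.\<close>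

definition level_ratio :: "real \<Rightarrow> real \<Rightarrow> real" where
  "level_ratio p s = (1 - exp (- (p + 1) * s)) / (1 - exp (- (p - 1) * s))"

lemma level_set_parametrisation:
  assumes p: "p > 1" and ab: "0 < a" "a < b"
  shows "level p a = level p b \<longleftrightarrow> (inverse b)\<^sup>2 = level_ratio p (ln (b / a))"
proof -
  let ?l = "b / a"
  have l: "?l > 1" using ab by simp
  have e: "exp (- c * ln ?l) = a powr c / b powr c" for c
    using ab by (simp add: powr_def ln_div exp_diff[symmetric] algebra_simps)
  have lt: "a powr (p - 1) < b powr (p - 1)" using p ab by (intro powr_less_mono2) auto
  have sq: "b powr (p + 1) = b powr (p - 1) * b\<^sup>2"
    using ab by (simp add: powr_add[symmetric] add.commute flip: powr_numeral)
  have bpos: "b powr (p - 1) > 0" using ab by simp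
  have "level_ratio p (ln ?l) = (1 - a powr (p + 1) / b powr (p + 1)) / (1 - a powr (p - 1) / b powr (p - 1))"
    unfolding level_ratio_def e ..
  also have "\<dots> = (b powr (p + 1) - a powr (p + 1)) / (b\<^sup>2 * (b powr (p - 1) - a powr (p - 1)))"
    unfolding sq using ab lt bpos by (simp add: field_simps)
  finally have r: "level_ratio p (ln ?l)
    = (b powr (p + 1) - a powr (p + 1)) / (b\<^sup>2 * (b powr (p - 1) - a powr (p - 1)))" .
  have "(inverse b)\<^sup>2 = level_ratio p (ln ?l) \<longleftrightarrow> b powr (p - 1) - a powr (p - 1) = b powr (p + 1) - a powr (p + 1)"
    unfolding r using ab lt by (simp add: power_inverse inverse_eq_divide divide_eq_eq eq_divide_eq power_divide)
  then show ?thesis unfolding level_def by argo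
qed

lemma level_ratio_gt_one:
  assumes "p > 1" "s > 0"
  shows "level_ratio p s > 1"
proof -
  have "exp (- (p + 1) * s) < exp (- (p - 1) * s)" "exp (- (p - 1) * s) < 1"
    using assms by (auto simp: mult_neg_pos)
  then show ?thesis by (simp add: level_ratio_def)
qed

text \<open>At \<open>s = 0\<close> the two branches of the curve meet, at the maximum point \<open>sqrt ((p - 1) / (p + 1))\<close> of
  \<open>level p\<close>.\<close>

lemma level_ratio_at_zero:
  assumes "p > 1"
  shows "((\<lambda>s. level_ratio p s) \<longlongrightarrow> (p + 1) / (p - 1)) (at_right 0)"
proof -
  have d: "((\<lambda>s. (1 - exp (- c * s)) / s) \<longlongrightarrow> c) (at_right 0)" for c :: real
  proof -
    have "((\<lambda>s. 1 - exp (- c * s)) has_real_derivative c) (at 0)"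
      by (auto intro!: derivative_eq_intros)
    then have "((\<lambda>s. (1 - exp (- c * s)) / s) \<longlongrightarrow> c) (at 0)"
      by (simp add: has_field_derivative_iff)
    then show ?thesis by (rule filterlim_mono) (auto simp: at_le)
  qed
  have "((\<lambda>s. ((1 - exp (- (p + 1) * s)) / s) / ((1 - exp (- (p - 1) * s)) / s)) \<longlongrightarrow> (p + 1) / (p - 1)) (at_right 0)"
    using assms by (intro tendsto_divide d) auto
  moreover have "\<forall>\<^sub>F s in at_right 0. ((1 - exp (- (p + 1) * s)) / s) / ((1 - exp (- (p - 1) * s)) / s) = level_ratio p s"
    unfolding level_ratio_def by (auto simp: eventually_at_filter)
  ultimately show ?thesis by (rule Lim_transform_eventually)
qed

lemma has_derivative_ln_level_ratio:
  assumes "p > 1" "s > 0"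
  shows "((\<lambda>s. ln (level_ratio p s)) has_real_derivative
      (p + 1) / (exp ((p + 1) * s) - 1) - (p - 1) / (exp ((p - 1) * s) - 1)) (at s)"
proof -
  have pos: "1 - exp (- c * x) > 0" if "c > 0" "x > 0" for c x :: real using that by simp
  have d: "((\<lambda>s. ln (1 - exp (- c * s))) has_real_derivative c / (exp (c * s) - 1)) (at s)"
    if "c > 0" for c
  proof -
    have "((\<lambda>s. ln (1 - exp (- c * s))) has_real_derivative c * exp (- c * s) / (1 - exp (- c * s))) (at s)"
      using pos[OF that assms(2)] by (auto intro!: derivative_eq_intros simp: field_simps)
    moreover have "c * exp (- c * s) / (1 - exp (- c * s)) = c / (exp (c * s) - 1)"
      using pos[OF that assms(2)] by (simp add: exp_minus field_simps)
    ultimately show ?thesis by simp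
  qed
  have "((\<lambda>s. ln (1 - exp (- (p + 1) * s)) - ln (1 - exp (- (p - 1) * s))) has_real_derivative
      (p + 1) / (exp ((p + 1) * s) - 1) - (p - 1) / (exp ((p - 1) * s) - 1)) (at s)"
    using assms by (intro derivative_intros d) auto
  moreover have "\<forall>\<^sub>F x in nhds s. ln (1 - exp (- (p + 1) * x)) - ln (1 - exp (- (p - 1) * x)) = ln (level_ratio p x)"
  proof -
    have "\<forall>\<^sub>F x in nhds s. x > 0" using assms(2) by (rule eventually_gt_at_top[THEN eventually_mono, rotated] | rule order_tendstoD(1)[OF filterlim_ident])
    then show ?thesis
    proof eventually_elim
      case (elim x)
      then show ?case using pos[of "p + 1" x] pos[of "p - 1" x] assms
        by (simp add: level_ratio_def ln_div)
    qed
  qed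
  ultimately show ?thesis by (subst (asm) DERIV_cong_ev[OF refl _ refl]) auto
qed

text \<open>The second derivative of \<open>ln (level_ratio p s)\<close> is a difference of two squares of the form
  \<open>(c / (2 sinh (c s / 2)))\<^sup>2\<close>, with \<open>c = p - 1\<close> and \<open>c = p + 1\<close>. Its sign is a matter of \<open>sinh x / x\<close> being
  increasing.\<close>

lemma sinh_ratio_less:
  fixes a b :: real
  assumes "0 < a" "a < b"
  shows "b * sinh a < a * sinh b"
proof -
  have "(\<lambda>x. sinh x / x) a < (\<lambda>x. sinh x / x) b"
  proof (rule DERIV_pos_imp_increasing[OF assms(2)])
    fix x assume x: "a \<le> x" "x \<le> b"
    then have x0: "x > 0" using assms by simp
    have "(\<lambda>x::real. x * cosh x - sinh x) 0 < (\<lambda>x. x * cosh x - sinh x) x"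
    proof (rule DERIV_pos_imp_increasing_open[OF x0])
      fix y :: real assume y: "0 < y" "y < x"
      then show "\<exists>d. ((\<lambda>x. x * cosh x - sinh x) has_real_derivative d) (at y) \<and> 0 < d"
        by (intro exI[of _ "y * sinh y"]) (auto intro!: derivative_eq_intros)
    qed (intro continuous_intros)
    then have "x * cosh x - sinh x > 0" by simp
    then show "\<exists>d. ((\<lambda>x. sinh x / x) has_real_derivative d) (at x) \<and> 0 < d"
      using x0 by (intro exI[of _ "(x * cosh x - sinh x) / x\<^sup>2"])
        (auto intro!: derivative_eq_intros simp: power2_eq_square field_simps)
  qed
  then show ?thesis using assms by (simp add: field_simps)
qed

lemma deriv_level_ratio_mono:
  fixes p s t :: real
  assumes p: "p > 1" and st: "0 < s" "s < t"
  defines "D \<equiv> (\<lambda>s. (p + 1) / (exp ((p + 1) * s) - 1) - (p - 1) / (exp ((p - 1) * s) - 1))"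
  shows "D s < D t"
proof (rule DERIV_pos_imp_increasing[OF st(2)])
  fix x assume x: "s \<le> x" "x \<le> t"
  then have x0: "x > 0" using st by simp
  let ?E = "\<lambda>c. c\<^sup>2 * exp (c * x) / (exp (c * x) - 1)\<^sup>2"
  have d: "((\<lambda>s. c / (exp (c * s) - 1)) has_real_derivative - ?E c) (at x)" if "c > 0" for c
    using that x0 by (auto intro!: derivative_eq_intros simp: power2_eq_square)
  have E: "?E c = (c / (2 * sinh (c * x / 2)))\<^sup>2" if "c > 0" for c
  proof -
    have "exp (c * x) - 1 = 2 * exp (c * x / 2) * sinh (c * x / 2)"
      by (simp add: sinh_field_def right_diff_distrib mult.assoc flip: exp_add)
    moreover have "exp (c * x) = (exp (c * x / 2))\<^sup>2" by (simp add: power2_eq_square flip: exp_add)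
    ultimately show ?thesis by (simp add: power_divide power_mult_distrib)
  qed
  have pos: "sinh ((p - 1) * x / 2) > 0" "sinh ((p + 1) * x / 2) > 0" using p x0 by auto
  have "((p + 1) * x / 2) * sinh ((p - 1) * x / 2) < ((p - 1) * x / 2) * sinh ((p + 1) * x / 2)"
    using p x0 by (intro sinh_ratio_less) auto
  then have "(p + 1) * sinh ((p - 1) * x / 2) < (p - 1) * sinh ((p + 1) * x / 2)"
    using x0 mult_less_cancel_left_pos[of "x / 2" "(p + 1) * sinh ((p - 1) * x / 2)" "(p - 1) * sinh ((p + 1) * x / 2)"]
    by (simp add: mult_ac)
  then have "(p + 1) / (2 * sinh ((p + 1) * x / 2)) < (p - 1) / (2 * sinh ((p - 1) * x / 2))"
    using pos by (simp add: field_simps)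
  then have "?E (p + 1) < ?E (p - 1)"
    using p pos by (simp only: E) (intro power_strict_mono, auto)
  moreover have "(D has_real_derivative - ?E (p + 1) - (- ?E (p - 1))) (at x)"
    unfolding D_def using p by (intro derivative_intros d) auto
  ultimately show "\<exists>d. (D has_real_derivative d) (at x) \<and> 0 < d" by (intro exI) auto
qed

text \<open>On the level curve, \<open>k / a + m / b\<close> equals \<open>(k exp s + m) sqrt (level_ratio p s)\<close>; this is the
  logarithm of its square.\<close>

definition log_balance :: "real \<Rightarrow> real \<Rightarrow> real \<Rightarrow> real \<Rightarrow> real" where
  "log_balance p k m s = 2 * ln (k * exp s + m) + ln (level_ratio p s)"

text \<open>Between the start, where \<open>f < c\<close>, and a first point at level \<open>c\<close> the derivative is positive
  somewhere; since it increases, \<open>f\<close> cannot return to level \<open>c\<close>.\<close>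

lemma strictly_convex_level_unique:
  fixes f f' :: "real \<Rightarrow> real"
  assumes der: "\<And>x. x > 0 \<Longrightarrow> (f has_real_derivative f' x) (at x)"
    and mono: "\<And>x y. 0 < x \<Longrightarrow> x < y \<Longrightarrow> f' x < f' y"
    and lim: "(f \<longlongrightarrow> l) (at_right 0)" "l < c"
    and st: "0 < s" "s < t" "f s = c" 
  shows "f t \<noteq> c"
proof
  assume ft: "f t = c"
  have "\<forall>\<^sub>F x in at_right 0. f x < c" using lim by (rule order_tendstoD)
  moreover have "\<forall>\<^sub>F x in at_right 0. x < s" "\<forall>\<^sub>F x in at_right (0::real). 0 < x"
    using st(1) by (auto simp: eventually_at_right)
  ultimately have "\<forall>\<^sub>F x in at_right 0. f x < c \<and> x < s \<and> 0 < x" by eventually_elim auto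
  then obtain r where r: "f r < c" "r < s" "0 < r"
    using eventually_happens trivial_limit_at_right_real by fastforce
  obtain y where y: "r < y" "y < s" "f s - f r = (s - r) * f' y"
    using MVT2[OF r(2), of f f'] der r by force
  obtain z where z: "s < z" "z < t" "f t - f s = (t - s) * f' z"
    using MVT2[OF st(2), of f f'] der st by force
  have "f' z = 0" using z st ft by simp
  moreover have "f' y > 0" using y r st by (metis diff_gt_0_iff_gt zero_less_mult_pos)
  moreover have "f' y < f' z" using mono y z r by auto
  ultimately show False by simp
qed

text \<open>The hypothesis on \<open>A\<close> says that the limit at \<open>0\<close> lies below \<open>ln A\<close>. The function is convex with
  strictly increasing derivative and unbounded, so it takes the value \<open>ln A\<close> exactly once.\<close>

lemma log_balance_solution:
  fixes k m :: real
  assumes p: "p > 1" and km: "k > 0" "m > 0"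
    and A: "(k + m)\<^sup>2 * ((p + 1) / (p - 1)) < A"
  shows "\<exists>!s. s > 0 \<and> log_balance p k m s = ln A"
proof -
  let ?f = "log_balance p k m"
  let ?f' = "\<lambda>s. 2 * (k * exp s / (k * exp s + m))
    + ((p + 1) / (exp ((p + 1) * s) - 1) - (p - 1) / (exp ((p - 1) * s) - 1))"
  have pos: "k * exp s + m > 0" for s using km by (simp add: add_pos_pos)
  have der: "(?f has_real_derivative ?f' x) (at x)" if "x > 0" for x
    unfolding log_balance_def using pos[of x]
    by (intro derivative_intros has_derivative_ln_level_ratio p that)
       (auto intro!: derivative_eq_intros simp: field_simps)
  have mono: "?f' x < ?f' y" if "0 < x" "x < y" for x y
  proof -
    have "k * exp x / (k * exp x + m) \<le> k * exp y / (k * exp y + m)"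
      using that km pos[of x] pos[of y] by (simp add: field_simps)
    then show ?thesis using deriv_level_ratio_mono[OF p that] by simp
  qed
  let ?l = "2 * ln (k * exp 0 + m) + ln ((p + 1) / (p - 1))"
  have lim: "(?f \<longlongrightarrow> ?l) (at_right 0)"
    unfolding log_balance_def using pos[of 0] p
    by (intro tendsto_intros level_ratio_at_zero) auto
  have l: "?l = ln ((k + m)\<^sup>2 * ((p + 1) / (p - 1)))"
    using km p by (simp add: ln_mult ln_div ln_realpow)
  have A0: "(k + m)\<^sup>2 * ((p + 1) / (p - 1)) > 0" using km p by simp
  have lA: "?l < ln A" unfolding l using A A0 by (subst ln_less_cancel_iff) auto 
  obtain r where r: "0 < r" "?f r < ln A"
  proof -
    have "\<forall>\<^sub>F x in at_right 0. ?f x < ln A" using lim lA by (rule order_tendstoD)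
    moreover have "\<forall>\<^sub>F x in at_right (0::real). 0 < x"
      by (auto simp: eventually_at_right_field intro: exI[of _ 1])
    ultimately have "\<forall>\<^sub>F x in at_right 0. ?f x < ln A \<and> 0 < x" by eventually_elim auto
    then show ?thesis
      using eventually_happens'[OF trivial_limit_at_right_real] that by blast
  qed
  obtain b where b: "r \<le> b" "?f b \<ge> ln A"
  proof -
    \<comment> \<open>Chosen so that \<open>k exp b\<close> alone exceeds \<open>sqrt A\<close>.\<close>
    define b where "b = max r (ln ((sqrt A + 1) / k))"
    have A': "A > 0" using A A0 by simp
    have "r \<le> b" "ln ((sqrt A + 1) / k) \<le> b" by (auto simp: b_def)
    have "sqrt A + 1 > 0" using A' by (simp add: add_pos_pos)
    then have "(sqrt A + 1) / k \<le> exp b"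
      using \<open>ln ((sqrt A + 1) / k) \<le> b\<close> km by (metis divide_pos_pos exp_le_cancel_iff exp_ln)
    then have "sqrt A \<le> k * exp b + m" using km by (simp add: field_simps)
    then have "ln (sqrt A) \<le> ln (k * exp b + m)" using A' by (subst ln_le_cancel_iff) (auto intro: pos)
    moreover have "ln (level_ratio p b) > 0" using level_ratio_gt_one[OF p, of b] r \<open>r \<le> b\<close> by simp
    ultimately have "ln A \<le> ?f b" using A' by (simp add: log_balance_def ln_sqrt)
    then show ?thesis using that \<open>r \<le> b\<close> by blast
  qed
  have "\<exists>x\<ge>r. x \<le> b \<and> ?f x = ln A"
    using r b by (intro IVT) (auto intro!: DERIV_isCont[OF der])
  then obtain s where s: "s > 0" "?f s = ln A" using r by (metis less_le_trans)
  moreover have "s' = s" if s': "s' > 0" "?f s' = ln A" for s'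
  proof (cases s s' rule: linorder_cases)
    case less
    show ?thesis
      using strictly_convex_level_unique[where f="?f" and f'="?f'", OF der mono lim lA s(1) less s(2)] s'(2)
      by blast
  next
    case greater
    show ?thesis
      using strictly_convex_level_unique[where f="?f" and f'="?f'", OF der mono lim lA s'(1) greater s'(2)] s(2)
      by blast
  qed simp
  ultimately show ?thesis by blast
qed

text \<open>On the level curve the second equation becomes \<open>log_balance p k m s = ln (\<beta>\<^sup>2 \<omega>)\<close> with
  \<open>s = ln (t\<^sub>N / t\<^sub>1)\<close> and \<open>m = N - k\<close>. As \<open>k + m = N\<close>, the bound on \<open>\<omega>\<close> is the
  hypothesis of \<open>log_balance_solution\<close>.\<close>

theorem t_system_unique_solution:
  assumes p: "p > 1" and \<beta>: "\<beta> \<noteq> 0" and k: "1 \<le> k" "k < N"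
    and \<omega>: "\<omega> > (p + 1) / (p - 1) * ((real N)\<^sup>2 / \<beta>\<^sup>2)"
  shows "\<exists>!t. t_system p \<omega> \<beta> N k (fst t) (snd t)"
proof -
  define m where "m = real N - real k"
  have km: "real k > 0" "m > 0" "real k + m = real N" using k by (auto simp: m_def)
  have \<omega>0: "\<omega> > 0" using \<omega> p by (smt (verit) divide_nonneg_pos mult_nonneg_nonneg zero_le_power2 zero_le_divide_iff)
  have "(real N)\<^sup>2 * ((p + 1) / (p - 1)) < \<beta>\<^sup>2 * \<omega>"
  proof -
    have "(p + 1) / (p - 1) * ((real N)\<^sup>2 / \<beta>\<^sup>2) * \<beta>\<^sup>2 < \<omega> * \<beta>\<^sup>2"
      using \<omega> \<beta> by (intro mult_strict_right_mono) auto
    then show ?thesis using \<beta> by (simp add: mult.commute)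
  qed
  then obtain s where s: "s > 0" "log_balance p k m s = ln (\<beta>\<^sup>2 * \<omega>)"
    and s_unique: "\<And>s'. s' > 0 \<Longrightarrow> log_balance p k m s' = ln (\<beta>\<^sup>2 * \<omega>) \<Longrightarrow> s' = s"
    using log_balance_solution[OF p km(1,2)] km(3) by metis
  have balance: "real k * inverse a + m * inverse b = \<bar>\<beta>\<bar> * sqrt \<omega>
      \<longleftrightarrow> log_balance p k m r = ln (\<beta>\<^sup>2 * \<omega>)"
    if r: "r > 0" and b: "b > 0" "inverse b = sqrt (level_ratio p r)" and a: "a = b * exp (- r)" for a b r
  proof -
    let ?L = "k * exp r + m"
    have L: "?L > 0" using km by (simp add: add_pos_pos)
    have V: "level_ratio p r > 0" using level_ratio_gt_one[OF p r] by simp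
    have eq: "real k * inverse a + m * inverse b = ?L * sqrt (level_ratio p r)"
      by (simp add: a b exp_minus algebra_simps)
    have "real k * inverse a + m * inverse b = \<bar>\<beta>\<bar> * sqrt \<omega> \<longleftrightarrow> (?L * sqrt (level_ratio p r))\<^sup>2 = (\<bar>\<beta>\<bar> * sqrt \<omega>)\<^sup>2"
      unfolding eq using L V \<omega>0 by (subst power2_eq_iff_nonneg) auto
    also have "\<dots> \<longleftrightarrow> ?L\<^sup>2 * level_ratio p r = \<beta>\<^sup>2 * \<omega>"
      using V \<omega>0 by (simp add: power_mult_distrib)
    also have "\<dots> \<longleftrightarrow> ln (?L\<^sup>2 * level_ratio p r) = ln (\<beta>\<^sup>2 * \<omega>)"
      using L V \<omega>0 \<beta> by (subst ln_inj_iff) auto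
    also have "ln (?L\<^sup>2 * level_ratio p r) = log_balance p k m r"
      using L V by (simp add: log_balance_def ln_mult ln_realpow)
    finally show ?thesis .
  qed
  define b where "b = inverse (sqrt (level_ratio p s))"
  define a where "a = b * exp (- s)"
  have V: "level_ratio p s > 1" by (rule level_ratio_gt_one[OF p s(1)])
  have b: "0 < b" "b < 1" "inverse b = sqrt (level_ratio p s)"
    using V by (auto simp: b_def inverse_less_1_iff)
  have a: "0 < a" "a < b" using b s(1) by (auto simp: a_def)
  have "b / a = exp s" using b(1) by (simp add: a_def exp_minus divide_inverse)
  then have "ln (b / a) = s" by simp
  then have lev: "level p a = level p b"
    using level_set_parametrisation[OF p a] b(3) V by simp
  have sol: "t_system p \<omega> \<beta> N k a b"
    using a b lev balance[OF s(1) b(1,3) a_def] s(2) by (simp add: t_system_def m_def level_def)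
  have unique: "x = a \<and> y = b" if xy: "t_system p \<omega> \<beta> N k x y" for x y
  proof -
    have x: "0 < x" "x < y" "y > 0" using xy by (auto simp: t_system_def)
    define r where "r = ln (y / x)"
    have r: "r > 0" using x by (simp add: r_def)
    have V: "level_ratio p r > 1" by (rule level_ratio_gt_one[OF p r])
    have "(inverse y)\<^sup>2 = level_ratio p r"
      using level_set_parametrisation[OF p x(1,2)] xy by (simp add: t_system_def r_def level_def)
    then have y: "inverse y = sqrt (level_ratio p r)"
      using x(3) by (metis inverse_nonnegative_iff_nonnegative less_imp_le real_sqrt_unique)
    have xr: "x = y * exp (- r)" using x by (simp add: r_def exp_minus)
    have "log_balance p k m r = ln (\<beta>\<^sup>2 * \<omega>)"
      using balance[OF r x(3) y xr] xy by (simp add: t_system_def m_def)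
    then have "r = s" by (rule s_unique[OF r])
    then have "y = b" using y by (simp add: b_def) (metis inverse_inverse_eq)
    then show ?thesis using xr \<open>r = s\<close> by (simp add: a_def)
  qed
  show ?thesis
  proof (rule ex1I[of _ "(a, b)"])
    show "t_system p \<omega> \<beta> N k (fst (a, b)) (snd (a, b))" using sol by simp
    show "t = (a, b)" if "t_system p \<omega> \<beta> N k (fst t) (snd t)" for t
      using unique[OF that] by (simp add: prod_eq_iff)
  qed
qed

text \<open>The function \<open>level p\<close> increases up to \<open>sqrt ((p - 1) / (p + 1))\<close> and decreases afterwards. In
  particular its level sets have at most two points.\<close>

lemma level_set_separated:
  assumes p: "p > 1" and ab: "0 < a" "a < b"
    and eq: "level p a = level p b"
  shows "a < sqrt ((p - 1) / (p + 1))" "sqrt ((p - 1) / (p + 1)) < b"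
proof -
  let ?q = "\<lambda>t::real. t powr (p - 1) - t powr (p + 1)" and ?c = "sqrt ((p - 1) / (p + 1))"
  have der: "(?q has_real_derivative t powr (p - 2) * ((p - 1) - (p + 1) * t\<^sup>2)) (at t)" if "t > 0" for t
  proof -
    have "t powr (p - 2) * t\<^sup>2 = t powr p" using that by (simp add: powr_add[symmetric] flip: powr_numeral)
    then show ?thesis using that
      by (auto intro!: derivative_eq_intros simp: algebra_simps)
  qed
  have c: "?c > 0" "?c\<^sup>2 = (p - 1) / (p + 1)" using p by auto
  show "a < ?c"
  proof (rule ccontr)
    assume "\<not> a < ?c"
    have "?q b < ?q a"
    proof (rule DERIV_neg_imp_decreasing_open[OF ab(2)])
      fix t assume t: "a < t" "t < b"
      have "?c\<^sup>2 < t\<^sup>2" using \<open>\<not> a < ?c\<close> t c(1) by (intro power_strict_mono) auto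
      then have "(p - 1) - (p + 1) * t\<^sup>2 < 0" using p unfolding c(2) by (simp add: field_simps)
      then have "t powr (p - 2) * ((p - 1) - (p + 1) * t\<^sup>2) < 0" using t ab by (simp add: mult_pos_neg)
      then show "\<exists>d. (?q has_real_derivative d) (at t) \<and> d < 0" using der[of t] t ab by auto
    qed (use ab in \<open>auto intro!: continuous_intros\<close>)
    then show False using eq by (simp add: level_def)
  qed
  show "?c < b"
  proof (rule ccontr)
    assume "\<not> ?c < b"
    have "?q a < ?q b"
    proof (rule DERIV_pos_imp_increasing_open[OF ab(2)])
      fix t assume t: "a < t" "t < b"
      have "t\<^sup>2 < ?c\<^sup>2" using \<open>\<not> ?c < b\<close> t ab c(1) by (intro power_strict_mono) auto
      then have "(p - 1) - (p + 1) * t\<^sup>2 > 0" using p unfolding c(2) by (simp add: field_simps)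
      then have "t powr (p - 2) * ((p - 1) - (p + 1) * t\<^sup>2) > 0" using t ab by simp
      then show "\<exists>d. (?q has_real_derivative d) (at t) \<and> 0 < d" using der[of t] t ab by auto
    qed (use ab in \<open>auto intro!: continuous_intros\<close>)
    then show False using eq by (simp add: level_def)
  qed
qed

section \<open>Sufficiency of the edge equation and the vertex condition\<close>

text \<open>Integration by parts and the edge equation reduce the first variation to boundary terms at the
  vertex, and these cancel by the vertex condition.\<close>

lemma edge_solutions_critical:
  assumes p: "p > 1"
    and sol: "\<And>j. j < N \<Longrightarrow> edge_solution p \<omega> (v j) (v' j)"
    and L: "\<And>j. j < N \<Longrightarrow> L2 (v j)" "\<And>j. j < N \<Longrightarrow> L2 (v' j)"
    and lim: "\<And>j. j < N \<Longrightarrow> (v' j \<longlongrightarrow> 0) at_top"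
    and vertex: "\<And>j. j < N \<Longrightarrow> v' j 0 = (1 / \<beta>) *\<^sub>R (\<Sum>i<N. v i 0)"
  shows "critical_point p \<omega> \<beta> N v"
proof -
  have d: "has_L2_deriv (v j) (v' j)" if "j < N" for j
    by (rule edge_solution_L2_deriv[OF sol[OF that] L(2)[OF that]])
  have vH: "v j \<in> H1_half_line" if "j < N" for j
    using L(1)[OF that] by (intro H1_half_lineI[OF d[OF that]]) (simp add: L2_def)
  then have v: "v \<in> H1_graph N" by (simp add: H1_graph_def)
  let ?S = "\<Sum>i<N. v i 0"
  have "first_variation p \<omega> \<beta> N v h = 0" if h: "h \<in> H1_graph N" for h
  proof -
    have edge: "L2_ip (H1_deriv (v j)) (H1_deriv (h j)) + \<omega> * L2_ip (v j) (h j)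
        - L2_ip (\<lambda>x. power_nl p (v j x)) (h j) = - (1 / \<beta>) * (?S \<bullet> h j 0)" if j: "j < N" for j
    proof -
      have hj: "h j \<in> H1_half_line" using h j by (simp add: H1_graph_def)
      have nl: "L2 (\<lambda>x. power_nl p (v j x))"
        by (rule L2_power_nl[OF p L(1)[OF j], of "2 * H1_norm N v"]) (use H1_graph_pointwise_bound[OF v j] in auto)
      have el: "L2 (\<lambda>x. el_field p \<omega> (v j x))"
        using L2_add[OF L2_mult[OF L(1)[OF j], of "of_real \<omega>"] L2_mult[OF nl, of "-1"]]
        by (simp add: el_field_def scaleR_conv_of_real)
      have cel: "continuous_on {0..} (\<lambda>x. el_field p \<omega> (v j x))"
        unfolding el_field_def
        by (intro continuous_intros continuous_on_power_nl_compose[OF p] edge_solution_continuous(1)[OF sol[OF j]])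
      have "L2_ip (H1_deriv (v j)) (H1_deriv (h j)) = L2_ip (v' j) (H1_deriv (h j))"
        by (rule L2_ip_cong_AE(2)[OF H1_L2(2)[OF vH[OF j]] L(2)[OF j] H1_deriv_AE[OF d[OF j]] H1_L2(2)[OF hj]])
      also have "\<dots> = - (v' j 0 \<bullet> h j 0) - L2_ip (\<lambda>x. el_field p \<omega> (v j x)) (h j)"
        by (rule integration_by_parts_half_line[OF _ cel L(2)[OF j] el lim[OF j] hj])
           (use sol[OF j] in \<open>simp add: edge_solution_def\<close>)
      also have "v' j 0 \<bullet> h j 0 = 1 / \<beta> * (?S \<bullet> h j 0)" unfolding vertex[OF j] by simp
      also have "L2_ip (\<lambda>x. el_field p \<omega> (v j x)) (h j) = \<omega> * L2_ip (v j) (h j) - L2_ip (\<lambda>x. power_nl p (v j x)) (h j)"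
      proof -
        have "L2_ip (\<lambda>x. el_field p \<omega> (v j x)) (h j)
            = (\<integral>x. \<omega> * (v j x \<bullet> h j x) - power_nl p (v j x) \<bullet> h j x \<partial>half_line)"
          unfolding L2_ip_def el_field_def by (simp add: inner_diff_left)
        also have "\<dots> = \<omega> * L2_ip (v j) (h j) - L2_ip (\<lambda>x. power_nl p (v j x)) (h j)"
          using L2_integrable_ip[OF L(1)[OF j] H1_L2(1)[OF hj]] L2_integrable_ip[OF nl H1_L2(1)[OF hj]]
          by (simp add: L2_ip_def)
        finally show ?thesis .
      qed
      finally show ?thesis by simp
    qed
    have "first_variation p \<omega> \<beta> N v h = (\<Sum>j<N. - (1 / \<beta>) * (?S \<bullet> h j 0)) + 1 / \<beta> * (?S \<bullet> (\<Sum>j<N. h j 0))"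
      unfolding first_variation_def by (intro arg_cong2[where f="(+)"] sum.cong) (auto simp: edge)
    also have "(\<Sum>j<N. - (1 / \<beta>) * (?S \<bullet> h j 0)) = - (1 / \<beta>) * (?S \<bullet> (\<Sum>j<N. h j 0))"
      by (simp only: inner_sum_right sum_distrib_left)
    finally show ?thesis by simp
  qed
  then show ?thesis using critical_point_iff_first_variation[OF p v] by blast
qed

section \<open>Vertex values of the shifted solitons\<close>

lemma tanh_artanh_real:
  fixes t :: real
  assumes "\<bar>t\<bar> < 1"
  shows "tanh (artanh t) = t"
proof -
  have t: "1 + t > 0" "1 - t > 0" using assms by (auto simp: abs_less_iff)
  have "exp (- 2 * artanh t) = exp (- ln ((1 + t) / (1 - t)))" by (simp add: artanh_def)
  also have "\<dots> = (1 - t) / (1 + t)" using t by (simp add: exp_minus)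
  finally have e: "exp (- 2 * artanh t) = (1 - t) / (1 + t)" .
  have "tanh (artanh t) = (1 - (1 - t) / (1 + t)) / (1 + (1 - t) / (1 + t))"
    unfolding tanh_real_altdef e ..
  also have "\<dots> = t" using t by (simp add: field_simps)
  finally show ?thesis .
qed

text \<open>The vertex value of the soliton with shift parameter \<open>t\<close>, that is, with \<open>sech\<^sup>2 = 1 - t\<^sup>2\<close> at the
  vertex.\<close>

definition amplitude :: "real \<Rightarrow> real \<Rightarrow> real \<Rightarrow> real" where
  "amplitude p \<omega> t = ((p + 1) * \<omega> / 2 * (1 - t\<^sup>2)) powr (1 / (p - 1))"

lemma amplitude_pos:
  assumes "p > 1" "\<omega> > 0" "0 < t" "t < 1"
  shows "amplitude p \<omega> t > 0"
proof -
  have "t\<^sup>2 < 1" using assms by (simp add: abs_square_less_1)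
  then show ?thesis using assms by (simp add: amplitude_def)
qed

lemma rate_times_shift:
  assumes "p > 1" "\<omega> > 0"
  shows "soliton_rate p \<omega> * shift p \<omega> \<beta> t = - sgn \<beta> * artanh t"
  using assms by (simp add: soliton_rate_def shift_def)

lemma shifted_soliton_at_vertex:
  assumes "p > 1" "\<omega> > 0" "\<beta> \<noteq> 0" "0 < t" "t < 1"
  shows "shifted_soliton p \<omega> (shift p \<omega> \<beta> t) 0 = amplitude p \<omega> t"
    and "soliton_slope p \<omega> (shift p \<omega> \<beta> t) 0 = sgn \<beta> * sqrt \<omega> * (t * amplitude p \<omega> t)"
proof -
  have T: "tanh (soliton_rate p \<omega> * (0 + shift p \<omega> \<beta> t)) = - sgn \<beta> * t"
  proof -
    have "soliton_rate p \<omega> * (0 + shift p \<omega> \<beta> t) = - sgn \<beta> * artanh t"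
      by (simp only: add_0_left rate_times_shift[OF assms(1,2)])
    moreover have "tanh (- sgn \<beta> * artanh t) = - sgn \<beta> * t"
      using tanh_artanh_real[of t] assms by (cases "\<beta> > 0") (auto simp: sgn_if)
    ultimately show ?thesis by simp
  qed
  have "(sech (soliton_rate p \<omega> * (0 + shift p \<omega> \<beta> t)))\<^sup>2 = 1 - t\<^sup>2"
    unfolding sech_sq T using assms by (simp add: power_mult_distrib sgn_if)
  then show 1: "shifted_soliton p \<omega> (shift p \<omega> \<beta> t) 0 = amplitude p \<omega> t"
    by (simp only: shifted_soliton_def amplitude_def soliton_rate_def[symmetric])
  show "soliton_slope p \<omega> (shift p \<omega> \<beta> t) 0 = sgn \<beta> * sqrt \<omega> * (t * amplitude p \<omega> t)"
    unfolding soliton_slope_def T 1 by simp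
qed

text \<open>The slope at the vertex is a fixed multiple of \<open>t * amplitude p \<omega> t\<close>, so equal slopes mean equal
  levels.\<close>

lemma level_amplitude:
  assumes "p > 1" "\<omega> > 0" "0 < t" "t < 1"
  shows "(t * amplitude p \<omega> t) powr (p - 1) = (p + 1) * \<omega> / 2 * level p t"
proof -
  have sq: "t\<^sup>2 < 1" using assms by (simp add: abs_square_less_1)
  have 1: "(t * amplitude p \<omega> t) powr (p - 1) = t powr (p - 1) * ((p + 1) * \<omega> / 2 * (1 - t\<^sup>2))"
    using assms sq amplitude_pos[OF assms] by (simp add: powr_mult amplitude_def powr_powr)
  have 2: "t powr (p + 1) = t powr (p - 1) * t\<^sup>2"
    using assms by (simp add: powr_add[symmetric] add.commute flip: powr_numeral)
  show ?thesis unfolding 1 level_def 2 by (simp add: field_simps)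
qed

lemma powr_base_inj:
  fixes x y a :: real
  assumes "x powr a = y powr a" "x > 0" "y > 0" "a \<noteq> 0"
  shows "x = y"
proof -
  have "x = (x powr a) powr (1 / a)" using assms(2,4) by (simp add: powr_powr)
  also have "\<dots> = y" unfolding assms(1) using assms(3,4) by (simp add: powr_powr)
  finally show ?thesis .
qed

lemma level_eq_iff:
  assumes "p > 1" "\<omega> > 0" "0 < s" "s < 1" "0 < t" "t < 1"
  shows "level p s = level p t \<longleftrightarrow> s * amplitude p \<omega> s = t * amplitude p \<omega> t"
proof
  assume "s * amplitude p \<omega> s = t * amplitude p \<omega> t"
  then show "level p s = level p t"
    using level_amplitude[OF assms(1,2,3,4)] level_amplitude[OF assms(1,2,5,6)] assms(1,2) by simp
next
  assume "level p s = level p t"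
  then have "(s * amplitude p \<omega> s) powr (p - 1) = (t * amplitude p \<omega> t) powr (p - 1)"
    using level_amplitude[OF assms(1,2,3,4)] level_amplitude[OF assms(1,2,5,6)] by simp
  then show "s * amplitude p \<omega> s = t * amplitude p \<omega> t"
    by (rule powr_base_inj)
       (use assms amplitude_pos[OF assms(1,2,3,4)] amplitude_pos[OF assms(1,2,5,6)] in auto)
qed

section \<open>The shift parameters of a critical point\<close>

text \<open>The condition that all derivatives at the vertex equal \<open>1 / \<beta>\<close> times the sum of the vertex values,
  expressed by the shift parameters: their levels agree because the derivatives do, and if \<open>\<kappa>\<close> is
  the common value of \<open>t * amplitude p \<omega> t\<close>, then the vertex values are \<open>\<kappa> / t\<close>.\<close>

definition vertex_condition :: "real \<Rightarrow> real \<Rightarrow> real \<Rightarrow> nat \<Rightarrow> (nat \<Rightarrow> real) \<Rightarrow> bool" where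
  "vertex_condition p \<omega> \<beta> N \<tau> \<longleftrightarrow>
     (\<forall>j<N. 0 < \<tau> j \<and> \<tau> j < 1) \<and> (\<forall>i<N. \<forall>j<N. level p (\<tau> i) = level p (\<tau> j)) \<and>
     (\<Sum>j<N. inverse (\<tau> j)) = \<bar>\<beta>\<bar> * sqrt \<omega>"

lemma vertex_conditionD:
  assumes "vertex_condition p \<omega> \<beta> N \<tau>"
  shows "j < N \<Longrightarrow> 0 < \<tau> j" "j < N \<Longrightarrow> \<tau> j < 1"
    and "i < N \<Longrightarrow> j < N \<Longrightarrow> level p (\<tau> i) = level p (\<tau> j)"
    and "(\<Sum>j<N. inverse (\<tau> j)) = \<bar>\<beta>\<bar> * sqrt \<omega>"
  using assms unfolding vertex_condition_def by blast+

definition soliton_family :: "real \<Rightarrow> real \<Rightarrow> real \<Rightarrow> nat \<Rightarrow> real \<Rightarrow> (nat \<Rightarrow> real) \<Rightarrow> graph_fun \<Rightarrow> bool" where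
  "soliton_family p \<omega> \<beta> N \<theta> \<tau> v \<longleftrightarrow>
     (\<forall>j<N. \<forall>x\<ge>0. v j x = cis \<theta> * complex_of_real (shifted_soliton p \<omega> (shift p \<omega> \<beta> (\<tau> j)) x))"

lemma edge_solution_cong:
  assumes "edge_solution p \<omega> u u'" "\<And>x. x \<ge> 0 \<Longrightarrow> v x = u x"
  shows "edge_solution p \<omega> v u'"
  unfolding edge_solution_def
proof (intro allI impI conjI)
  fix x :: real assume x: "x \<ge> 0"
  show "(v has_vector_derivative u' x) (at x within {0..})"
    by (rule has_vector_derivative_transform[of _ _ _ u]) (use assms x in \<open>auto simp: edge_solution_def\<close>)
  show "(u' has_vector_derivative el_field p \<omega> (v x)) (at x within {0..})"
    using assms x by (simp add: edge_solution_def)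
qed

lemma soliton_family_critical:
  assumes p: "p > 1" and \<omega>: "\<omega> > 0" and \<beta>: "\<beta> \<noteq> 0" and N: "N \<ge> 1"
    and \<tau>: "vertex_condition p \<omega> \<beta> N \<tau>" and v: "soliton_family p \<omega> \<beta> N \<theta> \<tau> v"
  shows "critical_point p \<omega> \<beta> N v" "nontrivial N v" "aligned_at_vertex N v"
proof -
  let ?a = "\<lambda>j. shift p \<omega> \<beta> (\<tau> j)"
  let ?u = "\<lambda>j x. cis \<theta> * complex_of_real (shifted_soliton p \<omega> (?a j) x)"
  let ?u' = "\<lambda>j x. cis \<theta> * complex_of_real (soliton_slope p \<omega> (?a j) x)"
  have t: "0 < \<tau> j" "\<tau> j < 1" if "j < N" for j using vertex_conditionD(1,2)[OF \<tau> that] .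
  have vu: "v j x = ?u j x" if "j < N" "x \<ge> 0" for j x using v that by (simp add: soliton_family_def)
  have v0: "v j 0 = cis \<theta> * of_real (amplitude p \<omega> (\<tau> j))" if "j < N" for j
    using vu[OF that, of 0] shifted_soliton_at_vertex(1)[OF p \<omega> \<beta> t[OF that]] by simp
  define \<kappa> where "\<kappa> = \<tau> 0 * amplitude p \<omega> (\<tau> 0)"
  have \<kappa>: "\<tau> j * amplitude p \<omega> (\<tau> j) = \<kappa>" if "j < N" for j
  proof -
    have "level p (\<tau> j) = level p (\<tau> 0)" by (rule vertex_conditionD(3)[OF \<tau> that]) (use N in simp)
    then show ?thesis using level_eq_iff[OF p \<omega> t[OF that] t[of 0]] N by (simp add: \<kappa>_def)
  qed
  have "amplitude p \<omega> (\<tau> j) = \<kappa> * inverse (\<tau> j)" if "j < N" for j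
    unfolding \<kappa>[OF that, symmetric] using t[OF that] by simp
  then have "(\<Sum>j<N. amplitude p \<omega> (\<tau> j)) = (\<Sum>j<N. \<kappa> * inverse (\<tau> j))"
    by (intro sum.cong) auto
  also have "\<dots> = \<kappa> * (\<bar>\<beta>\<bar> * sqrt \<omega>)"
    unfolding vertex_conditionD(4)[OF \<tau>, symmetric] by (simp add: sum_distrib_left)
  finally have sum: "(\<Sum>j<N. amplitude p \<omega> (\<tau> j)) = \<kappa> * (\<bar>\<beta>\<bar> * sqrt \<omega>)" .
  show "critical_point p \<omega> \<beta> N v"
  proof (rule edge_solutions_critical[OF p, where v'="?u'"])
    fix j assume j: "j < N"
    show "edge_solution p \<omega> (v j) (?u' j)"
      by (rule edge_solution_cong[OF soliton_edge_solution[OF p \<omega>]]) (rule vu[OF j])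
    have uL: "L2 (?u j)" by (rule H1_L2(1)[OF soliton_H1(1)[OF p \<omega>]])
    show "L2 (v j)"
    proof (rule L2_cong_AE[OF _ uL])
      show "AE x in half_line. ?u j x = v j x" by (rule AE_half_lineI) (simp add: vu[OF j])
      show "v j \<in> borel_measurable half_line"
        by (rule continuous_measurable_half_line[OF edge_solution_continuous(1)[OF \<open>edge_solution p \<omega> (v j) (?u' j)\<close>]])
    qed
    show "L2 (?u' j)" by (rule soliton_H1(2)[OF p \<omega>])
    show "(?u' j \<longlongrightarrow> 0) at_top" by (rule soliton_H1(4)[OF p \<omega>])
    have "(\<Sum>i<N. v i 0) = (\<Sum>i<N. cis \<theta> * of_real (amplitude p \<omega> (\<tau> i)))"
      by (intro sum.cong) (auto simp: v0)
    also have "\<dots> = cis \<theta> * of_real (\<kappa> * (\<bar>\<beta>\<bar> * sqrt \<omega>))"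
      unfolding sum[symmetric] by (simp add: sum_distrib_left)
    finally have S: "(\<Sum>i<N. v i 0) = cis \<theta> * of_real (\<kappa> * (\<bar>\<beta>\<bar> * sqrt \<omega>))" .
    have "soliton_slope p \<omega> (?a j) 0 = sgn \<beta> * sqrt \<omega> * \<kappa>"
      using shifted_soliton_at_vertex(2)[OF p \<omega> \<beta> t[OF j]] \<kappa>[OF j] by simp
    also have "\<dots> = 1 / \<beta> * (\<kappa> * (\<bar>\<beta>\<bar> * sqrt \<omega>))"
      using \<beta> by (simp add: sgn_if)
    finally show "?u' j 0 = (1 / \<beta>) *\<^sub>R (\<Sum>i<N. v i 0)"
      unfolding S scaleR_conv_of_real by (simp only: of_real_mult mult_ac)
  qed
  have "v 0 0 \<noteq> 0" using v0[of 0] N amplitude_pos[OF p \<omega> t[of 0]] by simp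
  then show "nontrivial N v" unfolding nontrivial_def using N by (intro exI[of _ 0]) auto
  show "aligned_at_vertex N v"
    unfolding aligned_at_vertex_def using v0 amplitude_pos[OF p \<omega> t]
    by (intro exI[of _ \<theta>]) (auto intro!: exI less_imp_le)
qed

text \<open>By alignment, the vertex values are \<open>r j\<close> times a common phase with \<open>r j \<ge> 0\<close>, and the derivatives
  there are \<open>R / \<beta>\<close> times that phase, where \<open>R\<close> is the sum of the \<open>r j\<close>. Uniqueness for the edge
  equation gives \<open>R > 0\<close>, since otherwise all edges vanish. Zero energy then relates \<open>r j\<close> and \<open>R\<close> exactly
  as for a soliton, and uniqueness applies once more.\<close>

lemma critical_point_is_soliton_family:
  assumes p: "p > 1" and \<omega>: "\<omega> > 0" and \<beta>: "\<beta> \<noteq> 0"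
    and crit: "critical_point p \<omega> \<beta> N v" and nt: "nontrivial N v" and al: "aligned_at_vertex N v"
  shows "\<exists>\<theta> \<tau>. vertex_condition p \<omega> \<beta> N \<tau> \<and> soliton_family p \<omega> \<beta> N \<theta> \<tau> v"
proof -
  have vH: "v j \<in> H1_half_line" if "j < N" for j using crit that by (simp add: critical_point_def H1_graph_def)
  obtain \<theta> where "\<forall>j<N. \<exists>r\<ge>0. v j 0 = cis \<theta> * complex_of_real r"
    using al unfolding aligned_at_vertex_def by blast
  then have "\<forall>j. \<exists>r. j < N \<longrightarrow> r \<ge> 0 \<and> v j 0 = cis \<theta> * complex_of_real r" by blast
  from choice[OF this] obtain r where
    r: "\<And>j. j < N \<Longrightarrow> r j \<ge> 0" "\<And>j. j < N \<Longrightarrow> v j 0 = cis \<theta> * complex_of_real (r j)"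
    by blast
  define R where "R = (\<Sum>j<N. r j)"
  have S: "(\<Sum>j<N. v j 0) = cis \<theta> * of_real R"
    by (simp add: R_def r(2) sum_distrib_left)
  have "\<forall>j. \<exists>v'. j < N \<longrightarrow> edge_solution p \<omega> (v j) v' \<and> v' 0 = (1 / \<beta>) *\<^sub>R (cis \<theta> * of_real R)"
    using critical_point_edge_solution[OF p crit] unfolding S by blast
  from choice[OF this] obtain v' where sol: "\<And>j. j < N \<Longrightarrow> edge_solution p \<omega> (v j) (v' j)"
    and v'0: "\<And>j. j < N \<Longrightarrow> v' j 0 = (1 / \<beta>) *\<^sub>R (cis \<theta> * of_real R)"
    by blast
  have Rpos: "R > 0"
  proof (rule ccontr)
    assume "\<not> R > 0"
    moreover have "R \<ge> 0" unfolding R_def using r(1) by (intro sum_nonneg) auto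
    ultimately have R0: "R = 0" by simp
    have zero: "edge_solution p \<omega> (\<lambda>x. 0) (\<lambda>x. 0)"
      by (simp add: edge_solution_def el_field_def power_nl_def)
    have "v j x = 0" if j: "j < N" and x: "x \<ge> 0" for j x
    proof (rule edge_solution_unique[OF p sol[OF j] zero _ _ x])
      have "r j = 0" using R0 r(1) j unfolding R_def by (subst (asm) sum_nonneg_eq_0_iff) auto
      then show "v j 0 = 0" using r(2)[OF j] by simp
      show "v' j 0 = 0" using v'0[OF j] R0 by simp
    qed
    then show False using nt by (auto simp: nontrivial_def)
  qed
  have edge: "\<exists>t. 0 < t \<and> t < 1 \<and> amplitude p \<omega> t = r j \<and> R = \<bar>\<beta>\<bar> * sqrt \<omega> * (t * r j)" if j: "j < N" for j
  proof -
    let ?r = "r j"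
    have "edge_energy p \<omega> (v j 0) (v' j 0) = 0"
      by (rule edge_energy_zero[OF p sol[OF j] vH[OF j] order_refl])
    then have E: "(R / \<beta>)\<^sup>2 - \<omega> * ?r\<^sup>2 + 2 / (p + 1) * ?r powr (p + 1) = 0"
      unfolding edge_energy_def v'0[OF j] r(2)[OF j] using r(1)[OF j] Rpos
      by (simp add: norm_mult power_mult_distrib power_divide)
    have rpos: "?r > 0"
    proof (rule ccontr)
      assume "\<not> ?r > 0"
      then have "?r = 0" using r(1)[OF j] by simp
      then show False using E Rpos \<beta> by simp
    qed
    define c where "c = 2 / ((p + 1) * \<omega>) * ?r powr (p - 1)"
    have c0: "c > 0" using p \<omega> rpos by (simp add: c_def)
    have "?r powr (p + 1) = ?r powr (p - 1) * ?r\<^sup>2"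
      using rpos by (simp add: powr_add[symmetric] add.commute flip: powr_numeral)
    then have "2 / (p + 1) * ?r powr (p + 1) = \<omega> * ?r\<^sup>2 * c" using \<omega> p by (simp add: c_def)
    then have E': "(R / \<beta>)\<^sup>2 = \<omega> * ?r\<^sup>2 * (1 - c)" using E by (simp add: algebra_simps)
    moreover have "(R / \<beta>)\<^sup>2 > 0" using Rpos \<beta> by simp
    moreover have "\<omega> * ?r\<^sup>2 > 0" using \<omega> rpos by simp
    ultimately have c1: "1 - c > 0" by (metis zero_less_mult_pos)
    \<comment> \<open>The soliton with this parameter has the vertex value \<open>r j\<close>.\<close>
    define t where "t = sqrt (1 - c)"
    have t: "0 < t" "t < 1" "t\<^sup>2 = 1 - c" using c0 c1 by (auto simp: t_def)
    have "(p + 1) * \<omega> / 2 * (1 - t\<^sup>2) = ?r powr (p - 1)" using p \<omega> by (simp add: t(3) c_def)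
    then have amp: "amplitude p \<omega> t = ?r"
      using p rpos by (simp add: amplitude_def powr_powr)
    have "R = \<bar>\<beta>\<bar> * sqrt \<omega> * (t * ?r)"
    proof (rule power2_eq_imp_eq)
      have "R\<^sup>2 = \<beta>\<^sup>2 * (R / \<beta>)\<^sup>2" using \<beta> by (simp add: power_divide)
      also have "\<dots> = \<beta>\<^sup>2 * (\<omega> * ?r\<^sup>2 * t\<^sup>2)" unfolding E' t(3) ..
      also have "\<dots> = (\<bar>\<beta>\<bar> * sqrt \<omega> * (t * ?r))\<^sup>2" using \<omega> by (simp add: power_mult_distrib mult_ac)
      finally show "R\<^sup>2 = (\<bar>\<beta>\<bar> * sqrt \<omega> * (t * ?r))\<^sup>2" .
      show "R \<ge> 0" using Rpos by simp
      show "\<bar>\<beta>\<bar> * sqrt \<omega> * (t * ?r) \<ge> 0" using t rpos \<omega> by simp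
    qed
    then show ?thesis using t amp by blast
  qed
  then have "\<forall>j. \<exists>t. j < N \<longrightarrow> 0 < t \<and> t < 1 \<and> amplitude p \<omega> t = r j \<and> R = \<bar>\<beta>\<bar> * sqrt \<omega> * (t * r j)"
    by blast
  from choice[OF this] obtain \<tau> where \<tau>: "\<And>j. j < N \<Longrightarrow> 0 < \<tau> j" "\<And>j. j < N \<Longrightarrow> \<tau> j < 1"
      "\<And>j. j < N \<Longrightarrow> amplitude p \<omega> (\<tau> j) = r j" "\<And>j. j < N \<Longrightarrow> R = \<bar>\<beta>\<bar> * sqrt \<omega> * (\<tau> j * r j)"
    by blast
  have bw: "\<bar>\<beta>\<bar> * sqrt \<omega> > 0" using \<beta> \<omega> by simp
  have "vertex_condition p \<omega> \<beta> N \<tau>"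
    unfolding vertex_condition_def
  proof (intro conjI allI impI)
    show "0 < \<tau> j" "\<tau> j < 1" if "j < N" for j using \<tau> that by auto
    show "level p (\<tau> i) = level p (\<tau> j)" if "i < N" "j < N" for i j
    proof -
      have "\<bar>\<beta>\<bar> * sqrt \<omega> * (\<tau> i * r i) = \<bar>\<beta>\<bar> * sqrt \<omega> * (\<tau> j * r j)"
        by (rule trans[OF \<tau>(4)[OF that(1), symmetric] \<tau>(4)[OF that(2)]])
      then have "\<tau> i * r i = \<tau> j * r j" using bw by (metis mult_cancel_left less_irrefl)
      then show ?thesis using level_eq_iff[OF p \<omega> \<tau>(1,2)[OF that(1)] \<tau>(1,2)[OF that(2)]] \<tau>(3) that by simp
    qed
    have "(\<Sum>j<N. inverse (\<tau> j)) = (\<Sum>j<N. \<bar>\<beta>\<bar> * sqrt \<omega> / R * r j)"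
    proof (rule sum.cong[OF refl])
      fix j assume "j \<in> {..<N}"
      then have j: "j < N" by simp
      have "\<bar>\<beta>\<bar> * sqrt \<omega> / R * r j * \<tau> j = \<bar>\<beta>\<bar> * sqrt \<omega> * (\<tau> j * r j) / R"
        by (simp add: mult_ac)
      also have "\<bar>\<beta>\<bar> * sqrt \<omega> * (\<tau> j * r j) = R" by (rule \<tau>(4)[OF j, symmetric])
      also have "R / R = 1" using Rpos by simp
      finally have "\<bar>\<beta>\<bar> * sqrt \<omega> / R * r j * \<tau> j = 1" .
      then show "inverse (\<tau> j) = \<bar>\<beta>\<bar> * sqrt \<omega> / R * r j"
        by (metis inverse_unique mult.commute)
    qed
    also have "\<dots> = \<bar>\<beta>\<bar> * sqrt \<omega> / R * R" by (simp add: R_def sum_distrib_left)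
    finally show "(\<Sum>j<N. inverse (\<tau> j)) = \<bar>\<beta>\<bar> * sqrt \<omega>" using Rpos by simp
  qed
  moreover have "soliton_family p \<omega> \<beta> N \<theta> \<tau> v"
    unfolding soliton_family_def
  proof (intro allI impI)
    fix j and x :: real assume j: "j < N" and x: "x \<ge> 0"
    note vals = shifted_soliton_at_vertex[OF p \<omega> \<beta> \<tau>(1,2)[OF j]]
    show "v j x = cis \<theta> * complex_of_real (shifted_soliton p \<omega> (shift p \<omega> \<beta> (\<tau> j)) x)"
    proof (rule edge_solution_unique[OF p sol[OF j] soliton_edge_solution[OF p \<omega>] _ _ x])
      show "v j 0 = cis \<theta> * complex_of_real (shifted_soliton p \<omega> (shift p \<omega> \<beta> (\<tau> j)) 0)"
        using r(2)[OF j] vals(1) \<tau>(3)[OF j] by simp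
      have "soliton_slope p \<omega> (shift p \<omega> \<beta> (\<tau> j)) 0 = 1 / \<beta> * R"
        unfolding vals(2) \<tau>(3)[OF j] \<tau>(4)[OF j] using \<beta> by (simp add: sgn_if)
      then show "v' j 0 = cis \<theta> * complex_of_real (soliton_slope p \<omega> (shift p \<omega> \<beta> (\<tau> j)) 0)"
        unfolding v'0[OF j] scaleR_conv_of_real by (simp only: of_real_mult mult_ac)
    qed
  qed
  ultimately show ?thesis by blast
qed

section \<open>Classification of the shift parameters\<close>

lemma permutation_onto_initial_segment:
  assumes A: "A \<subseteq> {..<N}" and k: "card A = k"
  shows "\<exists>\<pi>. \<pi> permutes {..<N} \<and> (\<forall>j<N. \<pi> j < k \<longleftrightarrow> j \<in> A)"
proof -
  have fA: "finite A" using A finite_subset by blast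
  have kN: "k \<le> N" using card_mono[OF _ A] k by simp
  obtain f where f: "bij_betw f A {..<k}"
    using finite_same_card_bij[OF fA, of "{..<k}"] k by auto
  have "card ({..<N} - A) = card {k..<N}" using A fA k by (simp add: card_Diff_subset)
  then obtain g where g: "bij_betw g ({..<N} - A) {k..<N}"
    using finite_same_card_bij[of "{..<N} - A" "{k..<N}"] by auto
  let ?h = "\<lambda>x. if x \<in> A then f x else g x"
  have "bij_betw ?h (A \<union> ({..<N} - A)) ({..<k} \<union> {k..<N})"
    by (rule bij_betw_disjoint_Un[OF f g]) auto
  moreover have "A \<union> ({..<N} - A) = {..<N}" "{..<k} \<union> {k..<N} = {..<N}" using A kN by auto
  ultimately have h: "bij_betw ?h {..<N} {..<N}" by simp
  define \<pi> where "\<pi> j = (if j < N then ?h j else j)" for j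
  have "bij_betw \<pi> {..<N} {..<N}"
    using h by (rule bij_betw_cong[THEN iffD1, rotated]) (simp add: \<pi>_def)
  then have "\<pi> permutes {..<N}" by (rule bij_imp_permutes) (simp add: \<pi>_def)
  moreover have "\<pi> j < k \<longleftrightarrow> j \<in> A" if j: "j < N" for j
  proof (cases "j \<in> A")
    case True
    then show ?thesis using f j by (auto simp: \<pi>_def bij_betw_def)
  next
    case False
    then have "g j \<in> {k..<N}" using g j by (auto simp: bij_betw_def)
    then show ?thesis using False j by (simp add: \<pi>_def)
  qed
  ultimately show ?thesis by blast
qed

text \<open>The parameters of the \<open>k\<close>-th profile; the case \<open>k = N\<close> is the symmetric one.\<close>

definition profile_param :: "real \<Rightarrow> nat \<Rightarrow> (nat \<Rightarrow> real) \<Rightarrow> (nat \<Rightarrow> real) \<Rightarrow> nat \<Rightarrow> nat \<Rightarrow> real" where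
  "profile_param A N t\<^sub>1 t\<^sub>N k j = (if k = N then real N / A else if j < k then t\<^sub>1 k else t\<^sub>N k)"

lemma sum_inverse_two_values:
  fixes a b :: real
  assumes "k \<le> N"
  shows "(\<Sum>j<N. inverse (if j < k then a else b)) = real k * inverse a + (real N - real k) * inverse b"
proof -
  have "(\<Sum>j<N. inverse (if j < k then a else b)) = (\<Sum>j<k. inverse (if j < k then a else b)) + (\<Sum>j\<in>{k..<N}. inverse (if j < k then a else b))"
    using assms by (subst sum.union_disjoint[symmetric]) (auto intro: sum.cong)
  also have "\<dots> = real k * inverse a + real (N - k) * inverse b" by simp
  finally show ?thesis using assms by (simp add: of_nat_diff)
qed

lemma profile_param_vertex_condition:
  assumes ts: "\<And>k. 1 \<le> k \<Longrightarrow> k < N \<Longrightarrow> t_system p \<omega> \<beta> N k (t\<^sub>1 k) (t\<^sub>N k)"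
    and A: "A = \<bar>\<beta>\<bar> * sqrt \<omega>" "A > 0" "real N / A < 1" and k: "1 \<le> k" "k \<le> N"
  shows "vertex_condition p \<omega> \<beta> N (profile_param A N t\<^sub>1 t\<^sub>N k)"
proof (cases "k = N")
  case True
  then show ?thesis using A k by (simp add: vertex_condition_def profile_param_def)
next
  case False
  then have t: "t_system p \<omega> \<beta> N k (t\<^sub>1 k) (t\<^sub>N k)" using ts k by simp
  then show ?thesis
    using False sum_inverse_two_values[OF k(2), of "t\<^sub>1 k" "t\<^sub>N k"]
    by (auto simp: vertex_condition_def profile_param_def t_system_def level_def)
qed

text \<open>The parameters lie on one level set, hence take at most two values. If they take two, sorting the
  edges by the value gives a solution of the system for the number \<open>k\<close> of edges with the smaller one.\<close>

lemma vertex_condition_classification: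
  assumes p: "p > 1" and N: "N \<ge> 1"
    and uniq: "\<And>k s\<^sub>1 s\<^sub>N. 1 \<le> k \<Longrightarrow> k < N \<Longrightarrow> t_system p \<omega> \<beta> N k s\<^sub>1 s\<^sub>N \<Longrightarrow> s\<^sub>1 = t\<^sub>1 k \<and> s\<^sub>N = t\<^sub>N k"
    and A: "A = \<bar>\<beta>\<bar> * sqrt \<omega>" "A > 0"
    and \<tau>: "vertex_condition p \<omega> \<beta> N \<tau>"
  shows "\<exists>k\<in>{1..N}. \<exists>\<pi>. \<pi> permutes {..<N} \<and> (\<forall>j<N. \<tau> j = profile_param A N t\<^sub>1 t\<^sub>N k (\<pi> j))"
proof -
  have t: "0 < \<tau> j" "\<tau> j < 1" if "j < N" for j using vertex_conditionD(1,2)[OF \<tau> that] .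
  have lev: "level p (\<tau> i) = level p (\<tau> j)" if "i < N" "j < N" for i j
    by (rule vertex_conditionD(3)[OF \<tau> that])
  have sum: "(\<Sum>j<N. inverse (\<tau> j)) = A" unfolding A(1) by (rule vertex_conditionD(4)[OF \<tau>])
  show ?thesis
  proof (cases "\<forall>j<N. \<tau> j = \<tau> 0")
    case True
    then have const: "\<tau> j = \<tau> 0" if "j < N" for j using that by blast
    have "(\<Sum>j<N. inverse (\<tau> j)) = (\<Sum>j<N. inverse (\<tau> 0))"
      by (intro sum.cong refl arg_cong[where f=inverse] const) simp
    then have "real N * inverse (\<tau> 0) = A" using sum by simp
    then have \<tau>0: "\<tau> 0 = real N / A" using t[of 0] N A(2) by (simp add: field_simps)
    have "profile_param A N t\<^sub>1 t\<^sub>N N j = \<tau> 0" for j by (simp add: profile_param_def \<tau>0)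
    then have "\<forall>j<N. \<tau> j = profile_param A N t\<^sub>1 t\<^sub>N N (id j)" using const by metis
    moreover have "N \<in> {1..N}" using N by simp
    ultimately show ?thesis using permutes_id by blast
  next
    case False
    then obtain l where l: "l < N" "\<tau> l \<noteq> \<tau> 0" by blast
    have "0 < N" using N by simp
    obtain i j where ij: "i < N" "j < N" "\<tau> i < \<tau> j"
      using l \<open>0 < N\<close> by (cases "\<tau> l < \<tau> 0") (auto simp: not_less order_le_less)
    define a b where "a = \<tau> i" and "b = \<tau> j"
    have ab: "0 < a" "a < b" "b < 1" using ij t by (auto simp: a_def b_def)
    have lab: "level p a = level p b" unfolding a_def b_def by (rule lev[OF ij(1,2)])
    note sep = level_set_separated[OF p ab(1,2) lab]
    have two: "\<tau> l = a \<or> \<tau> l = b" if l: "l < N" for l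
    proof (rule ccontr)
      assume ne: "\<not> (\<tau> l = a \<or> \<tau> l = b)"
      have la: "level p (\<tau> l) = level p a" unfolding a_def by (rule lev[OF l ij(1)])
      have lb: "level p (\<tau> l) = level p b" unfolding b_def by (rule lev[OF l ij(2)])
      show False
      proof (cases "\<tau> l < a")
        case True
        then show False using level_set_separated(2)[OF p t(1)[OF l] True la] sep by simp
      next
        case False
        then have al: "a < \<tau> l" using ne by auto
        have "sqrt ((p - 1) / (p + 1)) < \<tau> l" by (rule level_set_separated(2)[OF p ab(1) al la[symmetric]])
        moreover have "b < \<tau> l \<Longrightarrow> b < sqrt ((p - 1) / (p + 1))"
          using level_set_separated(1)[OF p _ _ lb[symmetric]] ab by simp
        moreover have "\<tau> l < b \<Longrightarrow> \<tau> l < sqrt ((p - 1) / (p + 1))"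
          using level_set_separated(1)[OF p t(1)[OF l] _ lb] by simp
        ultimately show False using sep ne by fastforce
      qed
    qed
    define B where "B = {l \<in> {..<N}. \<tau> l = a}"
    define k where "k = card B"
    have B: "B \<subseteq> {..<N}" by (auto simp: B_def)
    have "i \<in> B" using ij by (simp add: B_def a_def)
    then have "k \<noteq> 0" using finite_subset[OF B] by (auto simp: k_def)
    moreover have "j \<notin> B" using ab by (simp add: B_def b_def)
    then have "B \<subset> {..<N}" using B ij(2) by blast
    then have "k < N" using psubset_card_mono[of "{..<N}" B] by (simp add: k_def)
    ultimately have k: "1 \<le> k" "k < N" by auto
    obtain \<pi> where \<pi>: "\<pi> permutes {..<N}" "\<And>j. j < N \<Longrightarrow> \<pi> j < k \<longleftrightarrow> j \<in> B"
      using permutation_onto_initial_segment[OF B k_def[symmetric]] by blast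
    have \<tau>\<pi>: "\<tau> l = (if \<pi> l < k then a else b)" if "l < N" for l
      using two[OF that] \<pi>(2)[OF that] that ab by (auto simp: B_def)
    have "(\<Sum>l<N. inverse (\<tau> l)) = (\<Sum>l<N. inverse (if \<pi> l < k then a else b))"
      by (intro sum.cong) (auto simp: \<tau>\<pi>)
    also have "\<dots> = (\<Sum>l<N. inverse (if l < k then a else b))"
      using sum.permute[OF \<pi>(1), of "\<lambda>l. inverse (if l < k then a else b)"] by (simp add: comp_def)
    also have "\<dots> = real k * inverse a + (real N - real k) * inverse b"
      using k by (intro sum_inverse_two_values) simp
    finally have "t_system p \<omega> \<beta> N k a b"
      using ab lab sum by (simp add: t_system_def level_def A)
    then have "a = t\<^sub>1 k" "b = t\<^sub>N k" using uniq[OF k] by auto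
    then have "\<forall>l<N. \<tau> l = profile_param A N t\<^sub>1 t\<^sub>N k (\<pi> l)"
      using \<tau>\<pi> k by (simp add: profile_param_def)
    moreover have "k \<in> {1..N}" using k by simp
    ultimately show ?thesis using \<pi>(1) by blast
  qed
qed

text \<open>This recovers \<open>k\<close> from the profile: the symmetries preserve the number of edges whose parameter lies
  below the maximum point of \<open>level p\<close>. For the symmetric profile all \<open>N\<close> edges count, by the bound on
  \<open>N / A\<close>.\<close>

lemma profile_param_count:
  assumes ts: "\<And>k. 1 \<le> k \<Longrightarrow> k < N \<Longrightarrow> t_system p \<omega> \<beta> N k (t\<^sub>1 k) (t\<^sub>N k)"
    and p: "p > 1" and A: "real N / A < sqrt ((p - 1) / (p + 1))" and k: "1 \<le> k" "k \<le> N"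
  shows "card {j \<in> {..<N}. profile_param A N t\<^sub>1 t\<^sub>N k j < sqrt ((p - 1) / (p + 1))} = k"
proof (cases "k = N")
  case True
  then show ?thesis using A by (simp add: profile_param_def)
next
  case False
  then have t: "t_system p \<omega> \<beta> N k (t\<^sub>1 k) (t\<^sub>N k)" using ts k by simp
  then have "t\<^sub>1 k < sqrt ((p - 1) / (p + 1))" "sqrt ((p - 1) / (p + 1)) < t\<^sub>N k"
    using level_set_separated[OF p, of "t\<^sub>1 k" "t\<^sub>N k"] by (auto simp: t_system_def level_def)
  then have "{j \<in> {..<N}. profile_param A N t\<^sub>1 t\<^sub>N k j < sqrt ((p - 1) / (p + 1))} = {..<k}"
    using False k by (auto simp: profile_param_def split: if_splits)
  then show ?thesis by simp
qed

lemma amplitude_inj: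
  assumes "p > 1" "\<omega> > 0" "0 < s" "s < 1" "0 < t" "t < 1" "amplitude p \<omega> s = amplitude p \<omega> t"
  shows "s = t"
proof -
  have "s\<^sup>2 < 1" "t\<^sup>2 < 1" using assms by (auto simp: abs_square_less_1)
  then have "(p + 1) * \<omega> / 2 * (1 - s\<^sup>2) = (p + 1) * \<omega> / 2 * (1 - t\<^sup>2)"
    by (intro powr_base_inj[OF assms(7)[unfolded amplitude_def]]) (use assms(1,2) in auto)
  then have "s\<^sup>2 = t\<^sup>2" using assms(1,2) by simp
  then show ?thesis using assms by (simp add: power2_eq_iff_nonneg)
qed

lemma symmetric_profile_eq_soliton:
  assumes p: "p > 1" and \<omega>: "\<omega> > 0" and \<beta>: "\<beta> \<noteq> 0" and A: "A = \<bar>\<beta>\<bar> * sqrt \<omega>" "real N / A < 1"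
  shows "symmetric_profile p \<omega> \<beta> N = (\<lambda>j x. complex_of_real (shifted_soliton p \<omega> (shift p \<omega> \<beta> (real N / A)) x))"
proof -
  have Apos: "A > 0" using A \<beta> \<omega> by simp
  have "artanh (real N / (\<beta> * sqrt \<omega>)) = sgn \<beta> * artanh (real N / A)"
  proof (cases "\<beta> > 0")
    case True
    then show ?thesis by (simp add: A(1))
  next
    case False
    then have "real N / (\<beta> * sqrt \<omega>) = - (real N / A)" "sgn \<beta> = -1" using \<beta> by (auto simp: A(1))
    moreover have "\<bar>real N / A\<bar> < 1" using A(2) Apos by simp
    ultimately show ?thesis by (simp only: artanh_minus_real)
  qed
  then have eq: "(p - 1) * sqrt \<omega> / 2 * x - artanh (real N / (\<beta> * sqrt \<omega>))
      = (p - 1) * sqrt \<omega> / 2 * (x + shift p \<omega> \<beta> (real N / A))" for x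
    using rate_times_shift[OF p \<omega>, of \<beta> "real N / A"] by (simp add: soliton_rate_def distrib_left)
  show ?thesis by (simp only: eq symmetric_profile_def shifted_soliton_def)
qed

theorem theorem4p2:
  fixes p \<omega> \<beta> :: real and N :: nat
  assumes "p > 1" and "N \<ge> 2" and "\<beta> \<noteq> 0"
    and "\<omega> > (p + 1) / (p - 1) * ((real N)\<^sup>2 / \<beta>\<^sup>2)"
  shows "\<exists>t\<^sub>1 t\<^sub>N :: nat \<Rightarrow> real. \<exists>\<Phi> :: nat \<Rightarrow> graph_fun.
    (\<forall>k\<in>{1..N - 1}. \<forall>s\<^sub>1 s\<^sub>N. t_system p \<omega> \<beta> N k s\<^sub>1 s\<^sub>N \<longleftrightarrow> s\<^sub>1 = t\<^sub>1 k \<and> s\<^sub>N = t\<^sub>N k) \<and>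
    (\<forall>k\<in>{1..N - 1}. \<Phi> k = asymmetric_profile p \<omega> \<beta> k (t\<^sub>1 k) (t\<^sub>N k)) \<and>
    \<Phi> N = symmetric_profile p \<omega> \<beta> N \<and>
    (\<forall>k\<in>{1..N}. critical_point p \<omega> \<beta> N (\<Phi> k)) \<and>
    (\<forall>k\<in>{1..N}. \<forall>l\<in>{1..N}. equal_up_to_symmetry N (\<Phi> k) (\<Phi> l) \<longrightarrow> k = l) \<and>
    (\<forall>\<phi>. critical_point p \<omega> \<beta> N \<phi> \<and> nontrivial N \<phi> \<and> aligned_at_vertex N \<phi> \<longleftrightarrow>
         (\<exists>k\<in>{1..N}. equal_up_to_symmetry N \<phi> (\<Phi> k)))"
proof -
  note p = assms(1) and N = assms(2) and \<beta> = assms(3)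
  have \<omega>: "\<omega> > 0"
  proof -
    have "(p + 1) / (p - 1) * ((real N)\<^sup>2 / \<beta>\<^sup>2) \<ge> 0" using p by (intro mult_nonneg_nonneg) auto
    then show ?thesis using assms(4) by linarith
  qed
  define A where "A = \<bar>\<beta>\<bar> * sqrt \<omega>"
  have A: "A > 0" using \<beta> \<omega> by (simp add: A_def)
  have NA: "real N / A < sqrt ((p - 1) / (p + 1))"
  proof (rule real_less_rsqrt)
    have "(p + 1) / (p - 1) * ((real N)\<^sup>2 / \<beta>\<^sup>2) * ((p - 1) / (p + 1)) < \<omega> * ((p - 1) / (p + 1))"
      using assms(4) p by (intro mult_strict_right_mono) auto
    then have "(real N)\<^sup>2 / \<beta>\<^sup>2 < \<omega> * ((p - 1) / (p + 1))" using p by (simp add: mult.commute)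
    then have "(real N)\<^sup>2 / \<beta>\<^sup>2 / \<omega> < (p - 1) / (p + 1)"
      unfolding pos_divide_less_eq[OF \<omega>] by (simp only: mult.commute)
    moreover have "(real N / A)\<^sup>2 = (real N)\<^sup>2 / \<beta>\<^sup>2 / \<omega>"
      using \<omega> by (simp add: A_def power_divide power_mult_distrib)
    ultimately show "(real N / A)\<^sup>2 < (p - 1) / (p + 1)" by simp
  qed
  have "sqrt ((p - 1) / (p + 1)) < 1" using p by simp
  with NA have NA1: "real N / A < 1" by (rule order.strict_trans)
  have ex1: "\<exists>!t. t_system p \<omega> \<beta> N k (fst t) (snd t)" if "1 \<le> k" "k < N" for k
    by (rule t_system_unique_solution[OF p \<beta> that assms(4)])
  define T where "T k = (THE t. t_system p \<omega> \<beta> N k (fst t) (snd t))" for k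
  define t\<^sub>1 where "t\<^sub>1 k = fst (T k)" for k
  define t\<^sub>N where "t\<^sub>N k = snd (T k)" for k
  have ts: "t_system p \<omega> \<beta> N k (t\<^sub>1 k) (t\<^sub>N k)" if "1 \<le> k" "k < N" for k
    unfolding t\<^sub>1_def t\<^sub>N_def T_def by (rule theI'[OF ex1[OF that]])
  have uniq: "s\<^sub>1 = t\<^sub>1 k \<and> s\<^sub>N = t\<^sub>N k" if k: "1 \<le> k" "k < N" and "t_system p \<omega> \<beta> N k s\<^sub>1 s\<^sub>N" for k s\<^sub>1 s\<^sub>N
  proof -
    have "(s\<^sub>1, s\<^sub>N) = T k"
      unfolding T_def by (rule the1_equality[OF ex1[OF k], symmetric]) (simp add: that)
    then show ?thesis unfolding t\<^sub>1_def t\<^sub>N_def by (metis fst_conv snd_conv)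
  qed
  define \<Phi> where "\<Phi> k = (if k = N then symmetric_profile p \<omega> \<beta> N
    else asymmetric_profile p \<omega> \<beta> k (t\<^sub>1 k) (t\<^sub>N k))" for k
  let ?\<tau> = "profile_param A N t\<^sub>1 t\<^sub>N"
  have \<Phi>: "\<Phi> k = (\<lambda>j x. complex_of_real (shifted_soliton p \<omega> (shift p \<omega> \<beta> (?\<tau> k j)) x))" for k
    using symmetric_profile_eq_soliton[OF p \<omega> \<beta> A_def NA1]
    by (auto simp: \<Phi>_def profile_param_def asymmetric_profile_def)
  have vc: "vertex_condition p \<omega> \<beta> N (?\<tau> k)" if "k \<in> {1..N}" for k
    using that by (intro profile_param_vertex_condition ts A_def A NA1) auto
  have sym_family: "\<exists>\<theta> \<tau>. vertex_condition p \<omega> \<beta> N \<tau> \<and> soliton_family p \<omega> \<beta> N \<theta> \<tau> \<phi>"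
    if k: "k \<in> {1..N}" and eq: "equal_up_to_symmetry N \<phi> (\<Phi> k)" for k \<phi>
  proof -
    obtain \<pi> \<theta> where \<pi>: "\<pi> permutes {..<N}" and \<phi>: "\<And>j x. j < N \<Longrightarrow> x \<ge> 0 \<Longrightarrow> \<phi> j x = cis \<theta> * \<Phi> k (\<pi> j) x"
      using eq unfolding equal_up_to_symmetry_def by blast
    have \<pi>N: "\<pi> j < N" if "j < N" for j using permutes_in_image[OF \<pi>, of j] that by simp
    have "(\<Sum>j<N. inverse (?\<tau> k (\<pi> j))) = (\<Sum>j<N. inverse (?\<tau> k j))"
      using sum.permute[OF \<pi>, of "\<lambda>j. inverse (?\<tau> k j)"] by (simp add: comp_def)
    then have "vertex_condition p \<omega> \<beta> N (\<lambda>j. ?\<tau> k (\<pi> j))"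
      using vc[OF k] \<pi>N unfolding vertex_condition_def by metis
    moreover have "soliton_family p \<omega> \<beta> N \<theta> (\<lambda>j. ?\<tau> k (\<pi> j)) \<phi>"
      using \<phi> by (simp add: soliton_family_def \<Phi>)
    ultimately show ?thesis by blast
  qed
  have good: "critical_point p \<omega> \<beta> N \<phi> \<and> nontrivial N \<phi> \<and> aligned_at_vertex N \<phi>"
    if k: "k \<in> {1..N}" and eq: "equal_up_to_symmetry N \<phi> (\<Phi> k)" for k \<phi>
    using sym_family[OF k eq] soliton_family_critical[OF p \<omega> \<beta>] N by force
  have crit: "critical_point p \<omega> \<beta> N (\<Phi> k)" if k: "k \<in> {1..N}" for k
  proof -
    have "equal_up_to_symmetry N (\<Phi> k) (\<Phi> k)"
      unfolding equal_up_to_symmetry_def by (intro exI[of _ id] exI[of _ 0]) (auto simp: permutes_id)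
    then show ?thesis using good[OF k] by blast
  qed
  have distinct: "k = l" if k: "k \<in> {1..N}" and l: "l \<in> {1..N}" and eq: "equal_up_to_symmetry N (\<Phi> k) (\<Phi> l)" for k l
  proof -
    obtain \<pi> \<theta> where \<pi>: "\<pi> permutes {..<N}" and \<phi>: "\<And>j x. j < N \<Longrightarrow> x \<ge> 0 \<Longrightarrow> \<Phi> k j x = cis \<theta> * \<Phi> l (\<pi> j) x"
      using eq unfolding equal_up_to_symmetry_def by blast
    have \<pi>N: "\<pi> j < N" if "j < N" for j using permutes_in_image[OF \<pi>, of j] that by simp
    have bounds: "0 < ?\<tau> k j" "?\<tau> k j < 1" if "k \<in> {1..N}" "j < N" for k j
      using vertex_conditionD(1,2)[OF vc[OF that(1)] that(2)] .
    have val: "cmod (\<Phi> k j 0) = amplitude p \<omega> (?\<tau> k j)" if "k \<in> {1..N}" "j < N" for k j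
      using shifted_soliton_at_vertex(1)[OF p \<omega> \<beta> bounds[OF that]] amplitude_pos[OF p \<omega> bounds[OF that]]
      by (simp add: \<Phi>)
    have eq\<tau>: "?\<tau> k j = ?\<tau> l (\<pi> j)" if j: "j < N" for j
    proof (rule amplitude_inj[OF p \<omega> bounds[OF k j] bounds[OF l \<pi>N[OF j]]])
      have "cmod (\<Phi> k j 0) = cmod (\<Phi> l (\<pi> j) 0)" using \<phi>[OF j, of 0] by (simp add: norm_mult)
      then show "amplitude p \<omega> (?\<tau> k j) = amplitude p \<omega> (?\<tau> l (\<pi> j))"
        using val[OF k j] val[OF l \<pi>N[OF j]] by simp
    qed
    let ?c = "sqrt ((p - 1) / (p + 1))"
    have count: "card {j \<in> {..<N}. ?\<tau> k j < ?c} = k" if "k \<in> {1..N}" for k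
      using that by (intro profile_param_count[OF ts p NA]) auto
    have "\<pi> ` {j \<in> {..<N}. ?\<tau> k j < ?c} = {j \<in> {..<N}. ?\<tau> l j < ?c}"
    proof (intro equalityI subsetI)
      fix i assume "i \<in> {j \<in> {..<N}. ?\<tau> l j < ?c}"
      then have i: "i < N" "?\<tau> l i < ?c" by auto
      then obtain j where "j < N" "i = \<pi> j" using permutes_image[OF \<pi>] by (metis imageE lessThan_iff)
      then show "i \<in> \<pi> ` {j \<in> {..<N}. ?\<tau> k j < ?c}" using i eq\<tau> by auto
    next
      fix i assume "i \<in> \<pi> ` {j \<in> {..<N}. ?\<tau> k j < ?c}"
      then obtain j where j: "j < N" "?\<tau> k j < ?c" "i = \<pi> j" by auto
      then show "i \<in> {j \<in> {..<N}. ?\<tau> l j < ?c}" using \<pi>N[OF j(1)] eq\<tau>[OF j(1)] by simp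
    qed
    then have "card {j \<in> {..<N}. ?\<tau> l j < ?c} = card (\<pi> ` {j \<in> {..<N}. ?\<tau> k j < ?c})" by (rule arg_cong[OF sym])
    also have "\<dots> = card {j \<in> {..<N}. ?\<tau> k j < ?c}" by (rule card_image[OF permutes_inj_on[OF \<pi>]])
    finally show ?thesis using count[OF k] count[OF l] by simp
  qed
  have classify: "\<exists>k\<in>{1..N}. equal_up_to_symmetry N \<phi> (\<Phi> k)"
    if \<phi>: "critical_point p \<omega> \<beta> N \<phi> \<and> nontrivial N \<phi> \<and> aligned_at_vertex N \<phi>" for \<phi>
  proof -
    obtain \<theta> \<tau> where \<tau>: "vertex_condition p \<omega> \<beta> N \<tau>" and fam: "soliton_family p \<omega> \<beta> N \<theta> \<tau> \<phi>"
      using critical_point_is_soliton_family[OF p \<omega> \<beta>, of N \<phi>] \<phi> by blast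
    have "N \<ge> 1" using N by simp
    obtain k \<pi> where k: "k \<in> {1..N}" and \<pi>: "\<pi> permutes {..<N}" "\<And>j. j < N \<Longrightarrow> \<tau> j = ?\<tau> k (\<pi> j)"
      using vertex_condition_classification[where t\<^sub>1=t\<^sub>1 and t\<^sub>N=t\<^sub>N, OF p \<open>N \<ge> 1\<close> uniq A_def A \<tau>] by blast
    have "equal_up_to_symmetry N \<phi> (\<Phi> k)"
      unfolding equal_up_to_symmetry_def using \<pi> fam
      by (intro exI[of _ \<pi>] exI[of _ \<theta>]) (simp add: soliton_family_def \<Phi>)
    then show ?thesis using k by blast
  qed
  have system: "t_system p \<omega> \<beta> N k s\<^sub>1 s\<^sub>N \<longleftrightarrow> s\<^sub>1 = t\<^sub>1 k \<and> s\<^sub>N = t\<^sub>N k" if "k \<in> {1..N - 1}" for k s\<^sub>1 s\<^sub>N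
  proof -
    have k: "1 \<le> k" "k < N" using that N by auto
    show ?thesis using ts[OF k] uniq[OF k] by blast
  qed
  show ?thesis
  proof (rule exI[of _ t\<^sub>1], rule exI[of _ t\<^sub>N], rule exI[of _ \<Phi>], intro conjI)
    show "\<forall>k\<in>{1..N - 1}. \<forall>s\<^sub>1 s\<^sub>N. t_system p \<omega> \<beta> N k s\<^sub>1 s\<^sub>N \<longleftrightarrow> s\<^sub>1 = t\<^sub>1 k \<and> s\<^sub>N = t\<^sub>N k"
      using system by blast
    show "\<forall>k\<in>{1..N - 1}. \<Phi> k = asymmetric_profile p \<omega> \<beta> k (t\<^sub>1 k) (t\<^sub>N k)"
      using N by (auto simp: \<Phi>_def)
    show "\<Phi> N = symmetric_profile p \<omega> \<beta> N" by (simp add: \<Phi>_def)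
    show "\<forall>k\<in>{1..N}. critical_point p \<omega> \<beta> N (\<Phi> k)" using crit by blast
    show "\<forall>k\<in>{1..N}. \<forall>l\<in>{1..N}. equal_up_to_symmetry N (\<Phi> k) (\<Phi> l) \<longrightarrow> k = l" using distinct by blast
    show "\<forall>\<phi>. critical_point p \<omega> \<beta> N \<phi> \<and> nontrivial N \<phi> \<and> aligned_at_vertex N \<phi> \<longleftrightarrow>
        (\<exists>k\<in>{1..N}. equal_up_to_symmetry N \<phi> (\<Phi> k))"
      using classify good by blast
  qed
qed

end
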